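(* Let $\Gamma_A,\Gamma_B$ be a pair of $n$-coloured flag simplicial complexes that is pairwise 5-large. Then the fundamental group of each connected component of $X_{\Gamma_A,\Gamma_B}$ is (Gromov) hyperbolic.
   Context: All simplicial complexes are finite, and the empty set counts as a simplex of every complex. An $n$-coloured simplicial complex is a simplicial complex whose vertex set is partitioned into $n$ labelled (possibly empty) classes, the colours $1,\dots,n$, so that adjacent vertices have different colours. Let $\Gamma_A,\Gamma_B$ be $n$-coloured with colour classes $A_1,\dots,A_n$ and $B_1,\dots,B_n$. Let $K=\prod_{i=1}^n (A_i*B_i)$, a product of complete bipartite graphs, viewed as a cube complex. A vertex $(x_1,\dots,x_n)$ of $K$, $x_i\in A_i\sqcup B_i$, is identified with the pair $(\mathfrak a,\mathfrak b)$, $\mathfrak a=\{x_i: x_i\in A_i\}$, $\mathfrak b=\{x_i: x_i\in B_i\}$. The coupled link cube complex $X_{\Gamma_A,\Gamma_B}$ is the full subcomplex of $K$ (all cubes all of whose vertices belong to it) on the vertices $(\mathfrak a,\mathfrak b)$ such that $\mathfrak a$ is a (possibly empty) simplex of $\Gamma_A$ and $\mathfrak b$ is a (possibly empty) simplex of $\Gamma_B$. A simplicial complex is flag if every set of pairwise adjacent vertices spans a simplex. A square in a simplicial complex is a cycle $(v_1,v_2,v_3,v_4)$ of length $4$ in its $1$-skeleton; it is flat if neither pair of diagonally opposite vertices is joined by an edge. Two $n$-coloured flag simplicial complexes are pairwise 5-large if, whenever $(v_1,v_2,v_3,v_4)$ is a flat square in one of the complexes, with $v_j$ of colour $k_j$,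 there exists $j\in\{1,\dots,4\}$ such that the other complex contains no flat square having two adjacent vertices of colours $k_j$ and $k_{j+1}$ (indices mod $4$). *)

theory Defs
  imports "HOL-Analysis.Analysis" "HOL-Algebra.Generated_Groups"
begin

record 'v coloured_complex =
  simplices :: "'v set set"
  colour :: "'v \<Rightarrow> nat"

definition vertices :: "'v coloured_complex \<Rightarrow> 'v set" where
  "vertices \<Gamma> = \<Union> (simplices \<Gamma>)"

definition adjacent :: "'v coloured_complex \<Rightarrow> 'v \<Rightarrow> 'v \<Rightarrow> bool" where
  "adjacent \<Gamma> u v \<longleftrightarrow> u \<noteq> v \<and> {u, v} \<in> simplices \<Gamma>"

definition coloured_simplicial_complex :: "nat \<Rightarrow> 'v coloured_complex \<Rightarrow> bool" where
  "coloured_simplicial_complex n \<Gamma> \<longleftrightarrow>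
     finite (vertices \<Gamma>) \<and>
     {} \<in> simplices \<Gamma> \<and>
     (\<forall>\<sigma>\<in>simplices \<Gamma>. \<forall>\<tau>. \<tau> \<subseteq> \<sigma> \<longrightarrow> \<tau> \<in> simplices \<Gamma>) \<and>
     (\<forall>v\<in>vertices \<Gamma>. colour \<Gamma> v \<in> {1..n}) \<and>
     (\<forall>u v. adjacent \<Gamma> u v \<longrightarrow> colour \<Gamma> u \<noteq> colour \<Gamma> v)"

definition colour_class :: "'v coloured_complex \<Rightarrow> nat \<Rightarrow> 'v set" where
  "colour_class \<Gamma> i = {v \<in> vertices \<Gamma>. colour \<Gamma> v = i}"

definition flag_complex :: "'v coloured_complex \<Rightarrow> bool" where
  "flag_complex \<Gamma> \<longleftrightarrow>
     (\<forall>U\<subseteq>vertices \<Gamma>. (\<forall>u\<in>U. \<forall>v\<in>U. u \<noteq> v \<longrightarrow> adjacent \<Gamma> u v) \<longrightarrow> U \<in> simplices \<Gamma>)"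

text \<open>The vertices of a square are indexed by \<open>0, 1, 2, 3\<close>, with cyclic successor
  \<open>(j + 1) mod 4\<close> and diagonal opposite \<open>(j + 2) mod 4\<close>.\<close>

definition square :: "'v coloured_complex \<Rightarrow> (nat \<Rightarrow> 'v) \<Rightarrow> bool" where
  "square \<Gamma> v \<longleftrightarrow> inj_on v {..<4} \<and> (\<forall>j<4. adjacent \<Gamma> (v j) (v ((j + 1) mod 4)))"

definition flat_square :: "'v coloured_complex \<Rightarrow> (nat \<Rightarrow> 'v) \<Rightarrow> bool" where
  "flat_square \<Gamma> v \<longleftrightarrow> square \<Gamma> v \<and> (\<forall>j<4. \<not> adjacent \<Gamma> (v j) (v ((j + 2) mod 4)))"

definition flat_square_with_colours :: "'v coloured_complex \<Rightarrow> nat \<Rightarrow> nat \<Rightarrow> bool" where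
  "flat_square_with_colours \<Gamma> k l \<longleftrightarrow>
     (\<exists>w. flat_square \<Gamma> w \<and>
        (\<exists>i<4. {colour \<Gamma> (w i), colour \<Gamma> (w ((i + 1) mod 4))} = {k, l}))"

definition five_large_relative_to :: "'v coloured_complex \<Rightarrow> 'w coloured_complex \<Rightarrow> bool" where
  "five_large_relative_to \<Gamma> \<Gamma>' \<longleftrightarrow>
     (\<forall>v. flat_square \<Gamma> v \<longrightarrow>
        (\<exists>j<4. \<not> flat_square_with_colours \<Gamma>' (colour \<Gamma> (v j)) (colour \<Gamma> (v ((j + 1) mod 4)))))"

definition pairwise_5_large :: "'v coloured_complex \<Rightarrow> 'w coloured_complex \<Rightarrow> bool" where
  "pairwise_5_large \<Gamma> \<Gamma>' \<longleftrightarrow> five_large_relative_to \<Gamma> \<Gamma>' \<and> five_large_relative_to \<Gamma>' \<Gamma>"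

text \<open>Nonempty simplices of the join of two discrete sets, i.e. the vertices and edges
  of a complete bipartite graph.\<close>

definition join_cells :: "'a set \<Rightarrow> 'b set \<Rightarrow> ('a + 'b) set set" where
  "join_cells A B = {{x} |x. x \<in> A <+> B} \<union> {{Inl a, Inr b} |a b. a \<in> A \<and> b \<in> B}"

text \<open>A cube of the product \<open>K\<close> is a family of cells, one in each factor. Its vertex set is the
  product of these cells.\<close>

definition product_cubes ::
  "nat \<Rightarrow> 'a coloured_complex \<Rightarrow> 'b coloured_complex \<Rightarrow> (nat \<Rightarrow> ('a + 'b) set) set" where
  "product_cubes n \<Gamma>A \<Gamma>B = (\<Pi>\<^sub>E i\<in>{1..n}. join_cells (colour_class \<Gamma>A i) (colour_class \<Gamma>B i))"

definition cube_vertices :: "nat \<Rightarrow> (nat \<Rightarrow> ('a + 'b) set) \<Rightarrow> (nat \<Rightarrow> 'a + 'b) set" where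
  "cube_vertices n Q = (\<Pi>\<^sub>E i\<in>{1..n}. Q i)"

definition coupled_link_vertices ::
  "nat \<Rightarrow> 'a coloured_complex \<Rightarrow> 'b coloured_complex \<Rightarrow> (nat \<Rightarrow> 'a + 'b) set" where
  "coupled_link_vertices n \<Gamma>A \<Gamma>B =
     {x \<in> (\<Pi>\<^sub>E i\<in>{1..n}. colour_class \<Gamma>A i <+> colour_class \<Gamma>B i).
        {a. Inl a \<in> x ` {1..n}} \<in> simplices \<Gamma>A \<and> {b. Inr b \<in> x ` {1..n}} \<in> simplices \<Gamma>B}"

definition coupled_link_cubes ::
  "nat \<Rightarrow> 'a coloured_complex \<Rightarrow> 'b coloured_complex \<Rightarrow> (nat \<Rightarrow> ('a + 'b) set) set" where
  "coupled_link_cubes n \<Gamma>A \<Gamma>B =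
     {Q \<in> product_cubes n \<Gamma>A \<Gamma>B. cube_vertices n Q \<subseteq> coupled_link_vertices n \<Gamma>A \<Gamma>B}"

text \<open>The closed simplex spanned by a finite set, in barycentric coordinates.\<close>

definition simplex_realization :: "'v set \<Rightarrow> ('v \<Rightarrow> real) set" where
  "simplex_realization \<sigma> = {t. (\<forall>v. 0 \<le> t v) \<and> (\<forall>v. v \<notin> \<sigma> \<longrightarrow> t v = 0) \<and> sum t \<sigma> = 1}"

text \<open>The underlying space of the coupled link cube complex, with the subspace topology of the
  product topology on functions. As there are finitely many cubes, this is the usual (weak) topology
  of the cube complex.\<close>

definition coupled_link_complex ::
  "nat \<Rightarrow> 'a coloured_complex \<Rightarrow> 'b coloured_complex \<Rightarrow> (nat \<Rightarrow> 'a + 'b \<Rightarrow> real) set" where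
  "coupled_link_complex n \<Gamma>A \<Gamma>B =
     (\<Union>Q\<in>coupled_link_cubes n \<Gamma>A \<Gamma>B. \<Pi>\<^sub>E i\<in>{1..n}. simplex_realization (Q i))"

definition loops_at :: "'x::topological_space set \<Rightarrow> 'x \<Rightarrow> (real \<Rightarrow> 'x) set" where
  "loops_at S x = {p. path p \<and> path_image p \<subseteq> S \<and> pathstart p = x \<and> pathfinish p = x}"

definition fundamental_group :: "'x::topological_space set \<Rightarrow> 'x \<Rightarrow> (real \<Rightarrow> 'x) set monoid" where
  "fundamental_group S x =
     \<lparr>carrier = loops_at S x // {(p, q). homotopic_paths S p q},
      monoid.mult = (\<lambda>c d. {r. \<exists>p\<in>c. \<exists>q\<in>d. homotopic_paths S (p +++ q) r}),
      one = {r. homotopic_paths S (\<lambda>_. x) r}\<rparr>"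

definition word_length :: "('g, 'm) monoid_scheme \<Rightarrow> 'g set \<Rightarrow> 'g \<Rightarrow> nat" where
  "word_length G S g =
     (LEAST k. \<exists>ws. length ws = k \<and> set ws \<subseteq> S \<union> m_inv G ` S \<and> foldr (mult G) ws \<one>\<^bsub>G\<^esub> = g)"

definition word_dist :: "('g, 'm) monoid_scheme \<Rightarrow> 'g set \<Rightarrow> 'g \<Rightarrow> 'g \<Rightarrow> real" where
  "word_dist G S g h = real (word_length G S (inv\<^bsub>G\<^esub> g \<otimes>\<^bsub>G\<^esub> h))"

definition gromov_product :: "('x \<Rightarrow> 'x \<Rightarrow> real) \<Rightarrow> 'x \<Rightarrow> 'x \<Rightarrow> 'x \<Rightarrow> real" where
  "gromov_product d w x y = (d w x + d w y - d x y) / 2"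

definition gromov_hyperbolic :: "'x set \<Rightarrow> ('x \<Rightarrow> 'x \<Rightarrow> real) \<Rightarrow> bool" where
  "gromov_hyperbolic M d \<longleftrightarrow>
     (\<exists>\<delta>. \<forall>w\<in>M. \<forall>x\<in>M. \<forall>y\<in>M. \<forall>z\<in>M.
        min (gromov_product d w x y) (gromov_product d w y z) - \<delta> \<le> gromov_product d w x z)"

definition hyperbolic_group :: "('g, 'm) monoid_scheme \<Rightarrow> bool" where
  "hyperbolic_group G \<longleftrightarrow> group G \<and>
     (\<exists>S. finite S \<and> S \<subseteq> carrier G \<and> generate G S = carrier G \<and>
        gromov_hyperbolic (carrier G) (word_dist G S))"

end

theory Submission
  imports Defs
begin

text \<open>The complex \<open>X\<close> is special: label an edge by the pair \<open>(a, b)\<close> of vertices that it exchanges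
  and call two labels independent if they are adjacent in both complexes. Flagness implies that two
  consecutive edges of \<open>X\<close> span a square as soon as their labels are independent. So homotopy classes
  of edge paths are words in a right-angled Artin group, and valid edge paths are closed under
  reduction; the reduced words form the universal cover, with its graph metric given by word length.

  If \<open>p\<close> lies on a geodesic from \<open>x\<close> to \<open>y\<close>, the gates of \<open>p\<close> on the intervals \<open>[x, z]\<close>
  and \<open>[z, y]\<close> are reached by words \<open>u\<close> and \<open>w\<close> whose letters are mutually independent. A long \<open>u\<close>
  contains a chain of five successively dependent letters, which alternate between edges from \<open>A\<close>
  to \<open>B\<close> and from \<open>B\<close> to \<open>A\<close>; two such chains span a flat grid in which a flat square of one complex
  is surrounded by flat squares of the other, against pairwise 5-largeness. Hence intervals form
  uniformly thin triangles, and hyperbolicity follows by guessing geodesics in the Cayley graph of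
  the fundamental group.\<close>

subsection \<open>Guessing geodesics\<close>

text \<open>The elements of the fundamental group are words of edge paths closed at a base vertex,
  while an interval between two of them contains words that end at other vertices. The complex being
  finite, every end vertex has a return word of bounded length, so intervals can be pushed into the
  group at bounded cost. The pushed sets are not geodesics of the Cayley graph; this is why
  hyperbolicity is derived from a criterion that accepts any coarsely connected sets forming thin
  triangles. The thinness constant starts from \<open>4 * n\<close>: independent letters have
  different colours, so a layer of pairwise independent letters has at most \<open>n\<close> of
  them, and a longer reduced word has at least five layers. Four letters on each side fill the grid;
  the fifth allows one chain to be shifted by one letter, so that the nonadjacent middle pairs of
  both chains lie in the same complex. On the topological side no covering space is constructed:
  open stars of vertices act as charts, transitions between them are words satisfying a cocycle
  identity on each cube, and the word read off a path is locally constant under homotopy.\<close>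

locale guessed_geodesics =
  fixes M :: "'x set" and d :: "'x \<Rightarrow> 'x \<Rightarrow> nat" and L :: "'x \<Rightarrow> 'x \<Rightarrow> 'x set" and D :: nat
  assumes d_self: "x \<in> M \<Longrightarrow> d x x = 0"
    and d_sym: "\<lbrakk>x \<in> M; y \<in> M\<rbrakk> \<Longrightarrow> d x y = d y x"
    and d_tri: "\<lbrakk>x \<in> M; y \<in> M; z \<in> M\<rbrakk> \<Longrightarrow> d x z \<le> d x y + d y z"
    and d_geodesic: "\<lbrakk>x \<in> M; y \<in> M; k \<le> d x y\<rbrakk> \<Longrightarrow> \<exists>z\<in>M. d x z = k \<and> d z y = d x y - k"
    and L_sub: "\<lbrakk>x \<in> M; y \<in> M; p \<in> L x y\<rbrakk> \<Longrightarrow> p \<in> M"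
    and L_chain: "\<lbrakk>x \<in> M; y \<in> M\<rbrakk> \<Longrightarrow> \<exists>p m. p 0 = x \<and> p m = y \<and> (\<forall>i\<le>m. p i \<in> L x y)
        \<and> (\<forall>i<m. d (p i) (p (Suc i)) \<le> 1)"
    and L_small: "\<lbrakk>x \<in> M; y \<in> M; d x y \<le> 1; p \<in> L x y\<rbrakk> \<Longrightarrow> d x p \<le> D"
    and L_thin: "\<lbrakk>x \<in> M; y \<in> M; z \<in> M; p \<in> L x y\<rbrakk> \<Longrightarrow> \<exists>q\<in>L x z \<union> L z y. d p q \<le> D"
begin

definition I :: "'x \<Rightarrow> 'x \<Rightarrow> 'x set" where
  "I x y = {q \<in> M. d x q + d q y = d x y}"

lemma I_left: "\<lbrakk>x \<in> M; y \<in> M; z \<in> I x y; q \<in> I x z\<rbrakk> \<Longrightarrow> q \<in> I x y \<and> z \<in> I q y"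
  using d_tri[of q z y] d_tri[of x q y] unfolding I_def mem_Collect_eq by linarith

lemma I_right: "\<lbrakk>x \<in> M; y \<in> M; z \<in> I x y; q \<in> I z y\<rbrakk> \<Longrightarrow> q \<in> I x y \<and> z \<in> I x q"
  using d_tri[of x z q] d_tri[of x q y] unfolding I_def mem_Collect_eq by linarith

text \<open>Cut a geodesic from \<open>x\<close> to \<open>y\<close> in half: a point of
  \<open>L x y\<close> is within \<open>D\<close> of the guess for one of the halves. Each halving
  costs \<open>D\<close>, and the last pair, at distance at most 1, costs \<open>D\<close> once
  more, so the error is only logarithmic in the distance.\<close>

lemma dyadic_bound:
  "\<lbrakk>x \<in> M; y \<in> M; d x y \<le> 2 ^ k; p \<in> L x y\<rbrakk> \<Longrightarrow> \<exists>q\<in>I x y. d p q \<le> D * (k + 1)"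
proof (induction k arbitrary: x y p)
  case 0
  then have "p \<in> M" using L_sub by blast
  have "x \<in> I x y" using 0 d_self by (auto simp: I_def)
  moreover have "d p x \<le> D" using L_small[of x y p] 0 d_sym[OF \<open>p \<in> M\<close>] by simp
  ultimately show ?case by auto
next
  case (Suc k)
  obtain z where z: "z \<in> M" "d x z = d x y div 2" "d z y = d x y - d x y div 2"
    using d_geodesic[of x y "d x y div 2"] Suc.prems by auto
  then have zI: "z \<in> I x y" by (auto simp: I_def)
  have b: "d x z \<le> 2 ^ k" "d z y \<le> 2 ^ k" using z Suc.prems(3) by auto
  obtain p' where p': "p' \<in> L x z \<union> L z y" "d p p' \<le> D"
    using L_thin Suc.prems z by blast
  have "\<exists>q\<in>I x y. d p' q \<le> D * (k + 1)"
  proof (cases "p' \<in> L x z")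
    case True
    then show ?thesis using Suc.IH[OF Suc.prems(1) z(1) b(1)] I_left zI Suc.prems by blast
  next
    case False
    then show ?thesis using Suc.IH[OF z(1) Suc.prems(2) b(2)] I_right zI Suc.prems p' by blast
  qed
  then obtain q where q: "q \<in> I x y" "d p' q \<le> D * (k + 1)" by blast
  have "p \<in> M" "p' \<in> M" "q \<in> M" using L_sub Suc.prems p' z q unfolding I_def by blast+
  then have "d p q \<le> D * (Suc k + 1)" using d_tri[of p p' q] p' q by simp
  then show ?case using q by blast
qed

lemma four_le_square_exp: "4 \<le> k \<Longrightarrow> k * k \<le> (2::nat) ^ k"
proof (induction k rule: dec_induct)
  case (step k)
  have "2 * k + 1 \<le> k * k"
    using step(1) mult_le_mono1[of 4 k k] by linarith
  then show ?case using step by simp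
qed simp

text \<open>A logarithm is beaten by a linear function, in the form needed below:
  \<open>6 * t\<close> bounds the length of a piece reaching \<open>3 * t\<close> to either side of
  a point, \<open>D * (k + 1)\<close> is the dyadic error on it, and \<open>2 * D\<close> is spent
  on two thin triangles. With \<open>k = j + 1\<close>, the exponent \<open>30 * D + 4\<close> makes
  \<open>6 * D * (j + 4)\<close> at most \<open>j * j\<close>, hence at most
  \<open>2 ^ j\<close>.\<close>

lemma threshold: "\<exists>K. \<forall>t>K. \<exists>k. 6 * t \<le> 2 ^ k \<and> D * (k + 3) < t"
proof (rule exI[of _ "2 ^ (30 * D + 4)"], intro allI impI)
  fix t :: nat
  assume t: "2 ^ (30 * D + 4) < t"
  define k where "k = (LEAST k. 6 * t \<le> 2 ^ k)"
  have "6 * t \<le> 2 ^ (6 * t)" by (simp add: less_imp_le)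
  then have k: "6 * t \<le> 2 ^ k" unfolding k_def by (rule LeastI)
  then have "(2::nat) ^ (30 * D + 4) < 2 ^ k" using t by linarith
  then have kk: "30 * D + 4 < k" by (simp add: power_strict_increasing_iff)
  then obtain j where j: "k = Suc j" using less_imp_Suc_add by blast
  have "j < k" using j by simp
  then have "2 ^ j < 6 * t" unfolding k_def using not_less_Least by fastforce
  moreover have "6 * (D * (j + 4)) \<le> j * j"
  proof -
    have "6 * (D * (j + 4)) \<le> 6 * (D * (5 * j))" using kk j by (intro mult_le_mono) auto
    also have "\<dots> = (30 * D) * j" by simp
    also have "\<dots> \<le> j * j" using kk j by (intro mult_le_mono) auto
    finally show ?thesis .
  qed
  moreover have "j * j \<le> 2 ^ j" using kk j by (intro four_le_square_exp) auto
  ultimately have "D * (j + 4) < t" by linarith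
  then have "D * (k + 3) < t" using j by (simp add: numeral_eq_Suc)
  then show "\<exists>k. 6 * t \<le> 2 ^ k \<and> D * (k + 3) < t" using k by blast
qed

text \<open>Take a point \<open>p\<close> of some \<open>L x y\<close> whose distance \<open>s\<close> to the interval is largest, and cut the interval
  at distance \<open>3 * s\<close> on both sides of the point nearest to \<open>p\<close>. The outer two guesses cannot come
  near \<open>p\<close> without exceeding \<open>s\<close>, and on the middle one \<open>s\<close> is logarithmic in \<open>s\<close>.\<close>

lemma close_to_interval: "\<exists>T. \<forall>x\<in>M. \<forall>y\<in>M. \<forall>p\<in>L x y. \<exists>q\<in>I x y. d p q \<le> T"
proof -
  obtain K where K: "\<And>t. K < t \<Longrightarrow> \<exists>k. 6 * t \<le> 2 ^ k \<and> D * (k + 3) < t"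
    using threshold by blast
  \<comment> \<open>\<open>3 * D\<close> deals with the outer pieces and with points close to an end
    of the interval, \<open>K\<close> with the middle piece.\<close>
  define T where "T = max (3 * D) K"
  \<comment> \<open>The bound \<open>n\<close> on \<open>d x y\<close> guarantees through
    \<open>dyadic_bound\<close> that a largest \<open>t\<close> exists; the resulting bound
    \<open>T\<close> does not depend on \<open>n\<close>.\<close>
  define far where "far n t \<longleftrightarrow> (\<exists>x\<in>M. \<exists>y\<in>M. \<exists>p\<in>L x y. d x y \<le> n \<and> (\<forall>q\<in>I x y. t \<le> d p q))" for n t
  have bound: "t \<le> T" if "far n t" for n t
  proof -
    have "t \<le> D * (n + 1)" if far: "far n t" for t
    proof -
      obtain x y p where "x \<in> M" "y \<in> M" "p \<in> L x y" "d x y \<le> n" "\<forall>q\<in>I x y. t \<le> d p q"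
        using far unfolding far_def by blast
      moreover from this have "d x y \<le> 2 ^ n" using less_exp[of n] by linarith
      ultimately show ?thesis using dyadic_bound by (meson order_trans)
    qed
    then obtain s where s: "far n s" "\<And>t. far n t \<Longrightarrow> t \<le> s"
      using Nat.ex_has_greatest_nat[of "far n" t "D * (n + 1)"] \<open>far n t\<close> by blast
    then obtain x y p where xyp: "x \<in> M" "y \<in> M" "p \<in> L x y" "d x y \<le> n" "\<forall>q\<in>I x y. s \<le> d p q"
      unfolding far_def by blast
    have close: "\<exists>q\<in>I u v. d r q \<le> s" if "u \<in> M" "v \<in> M" "r \<in> L u v" "d u v \<le> n" for u v r
    proof (rule ccontr)
      assume "\<not> ?thesis"
      then have "far n (Suc s)" unfolding far_def using that by (meson not_less_eq_eq)
      then show False using s(2) by fastforce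
    qed
    obtain q where q: "q \<in> I x y" "d p q \<le> s" using close xyp by blast
    have "p \<in> M" "q \<in> M" and qd: "d x q + d q y = d x y" using L_sub xyp q unfolding I_def by blast+
    have "s \<le> T"
    proof (rule ccontr)
      assume "\<not> s \<le> T"
      then have sD: "3 * D < s" and "K < s" by (auto simp: T_def)
      obtain x' where x': "x' \<in> M" "d x x' = d x q - min (3 * s) (d x q)" "d x' q = min (3 * s) (d x q)"
        using d_geodesic[of x q "d x q - min (3 * s) (d x q)"] xyp \<open>q \<in> M\<close> by auto
      obtain y' where y': "y' \<in> M" "d q y' = min (3 * s) (d q y)" "d y' y = d q y - min (3 * s) (d q y)"
        using d_geodesic[of q y "min (3 * s) (d q y)"] xyp \<open>q \<in> M\<close> by auto
      have "x' \<in> I x q" "y' \<in> I q y" using x' y' by (auto simp: I_def)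
      then have x'I: "x' \<in> I x y" "q \<in> I x' y" and y'I: "y' \<in> I x y" "q \<in> I x y'"
        using I_left[OF xyp(1,2) q(1)] I_right[OF xyp(1,2) q(1)] by blast+
      then have y'x': "y' \<in> I x' y" using I_right[of x' y q y'] \<open>y' \<in> I q y\<close> x' xyp by blast
      obtain p1 where p1: "p1 \<in> L x x' \<union> L x' y" "d p p1 \<le> D" using L_thin xyp x' by blast
      have "\<exists>p'. p' \<in> L x x' \<union> L x' y' \<union> L y' y \<and> d p p' \<le> 2 * D"
      proof (cases "p1 \<in> L x x'")
        case False
        then have p1L: "p1 \<in> L x' y" using p1 by blast
        then obtain p2 where p2: "p2 \<in> L x' y' \<union> L y' y" "d p1 p2 \<le> D" using L_thin x' y' xyp by blast
        have "p1 \<in> M" "p2 \<in> M" using L_sub p1L p2 x' y' xyp by blast+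
        then have "d p p2 \<le> 2 * D" using d_tri[of p p1 p2] \<open>p \<in> M\<close> p1 p2 by simp
        then show ?thesis using p2 by blast
      qed (use p1 in force)
      then obtain p' where p': "p' \<in> L x x' \<union> L x' y' \<union> L y' y" "d p p' \<le> 2 * D" by blast
      have "p' \<in> M" using L_sub p' x' y' xyp by blast
      have xI: "x \<in> I x y" "y \<in> I x y" using xyp d_self by (auto simp: I_def)
      consider "p' \<in> L x x'" | "p' \<in> L x' y'" | "p' \<in> L y' y" using p' by blast
      then show False
      proof cases
        case 1
        show False
        \<comment> \<open>If \<open>q\<close> is within \<open>3 * s\<close> of \<open>x\<close>,
          the cut point \<open>x'\<close> is \<open>x\<close> itself, and \<open>p\<close> would be
          within \<open>3 * D\<close> of an end. Otherwise the point \<open>r\<close> between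
          \<open>x\<close> and \<open>x'\<close> is at least \<open>3 * s\<close> away from
          \<open>q\<close>, but the detour through \<open>p'\<close> and \<open>p\<close> gives at
          most \<open>2 * s + 2 * D\<close>.\<close>
        proof (cases "d x q \<le> 3 * s")
          case True
          then have "d x x' \<le> 1" using x' by simp
          then have "d x p' \<le> D" using L_small 1 xyp x' by blast
          then have "d p x \<le> 3 * D" using d_tri[of p p' x] d_sym[of x p'] p' \<open>p \<in> M\<close> \<open>p' \<in> M\<close> xyp by simp
          then show False using xyp(5) xI sD by fastforce
        next
          case False
          have "d x x' \<le> n" using x' qd xyp(4) by linarith
          then obtain r where r: "r \<in> I x x'" "d p' r \<le> s" using close 1 xyp x' by blast
          then have "r \<in> M" "x' \<in> I r q"
            using I_left[of x q x' r] \<open>x' \<in> I x q\<close> xyp \<open>q \<in> M\<close> by (auto simp: I_def)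
          then have "3 * s \<le> d r q" using x' False by (auto simp: I_def)
          moreover have "d r q \<le> d r p' + d p' q" "d p' q \<le> d p' p + d p q"
            using d_tri \<open>r \<in> M\<close> \<open>q \<in> M\<close> \<open>p \<in> M\<close> \<open>p' \<in> M\<close> by blast+
          moreover have "d r p' \<le> s" "d p' p \<le> 2 * D"
            using r p' d_sym \<open>r \<in> M\<close> \<open>p \<in> M\<close> \<open>p' \<in> M\<close> by metis+
          ultimately show False using q(2) sD by linarith
        qed
      next
        case 2
        obtain k where k: "6 * s \<le> 2 ^ k" "D * (k + 3) < s" using K \<open>K < s\<close> by blast
        have "d x' y' \<le> d x' q + d q y'" using d_tri x' y' \<open>q \<in> M\<close> by blast
        then have "d x' y' \<le> 2 ^ k" using x' y' k by linarith
        then obtain r where r: "r \<in> I x' y'" "d p' r \<le> D * (k + 1)" using dyadic_bound 2 x' y' by blast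
        then have "r \<in> I x y" using I_left[of x' y y' r] I_right[of x y x' r] y'x' x' x'I xyp by blast
        then have "s \<le> d p r" using xyp(5) by blast
        also have "\<dots> \<le> d p p' + d p' r" using d_tri \<open>p \<in> M\<close> \<open>p' \<in> M\<close> r by (auto simp: I_def)
        also have "\<dots> \<le> D * (k + 3)" using p' r by (simp add: algebra_simps)
        finally show False using k by simp
      next
        case 3
        show False
        proof (cases "d q y \<le> 3 * s")
          case True
          then have "d y' y = 0" using y' by simp
          then have "d y' p' \<le> D" using L_small[of y' y p'] 3 xyp y' by simp
          then have "d p y \<le> 3 * D"
            using d_tri[of p p' y'] d_tri[of p y' y] d_sym[of y' p'] p' \<open>p \<in> M\<close> \<open>p' \<in> M\<close> xyp y' \<open>d y' y = 0\<close>
            by simp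
          then show False using xyp(5) xI sD by fastforce
        next
          case False
          have "d y' y \<le> n" using y' qd xyp(4) by linarith
          then obtain r where r: "r \<in> I y' y" "d p' r \<le> s" using close 3 xyp y' by blast
          then have "r \<in> M" "y' \<in> I q r"
            using I_right[of q y y' r] \<open>y' \<in> I q y\<close> xyp \<open>q \<in> M\<close> by (auto simp: I_def)
          then have "3 * s \<le> d q r" using y' False by (auto simp: I_def)
          moreover have "d q r \<le> d q p + d p r" "d p r \<le> d p p' + d p' r"
            using d_tri \<open>r \<in> M\<close> \<open>q \<in> M\<close> \<open>p \<in> M\<close> \<open>p' \<in> M\<close> by blast+
          moreover have "d q p \<le> s" using q d_sym \<open>q \<in> M\<close> \<open>p \<in> M\<close> by metis
          ultimately show False using r p' sD by linarith
        qed
      qed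
    qed
    then show ?thesis using s(2) \<open>far n t\<close> le_trans by blast
  qed
  have "\<exists>q\<in>I x y. d p q \<le> T" if "x \<in> M" "y \<in> M" "p \<in> L x y" for x y p
  proof (rule ccontr)
    assume "\<not> ?thesis"
    then have "far (d x y) (Suc T)" unfolding far_def using that by (meson not_less_eq_eq order_refl)
    then show False using bound by fastforce
  qed
  then show ?thesis by blast
qed

text \<open>Discrete connectedness along the chain of \<open>L x y\<close>: each of its points is
  close to one of the other two sides, the first point to \<open>L x w\<close> and the last to
  \<open>L w y\<close>, so a single point or two consecutive ones are close to both. The extra 1 is
  one step of the chain.\<close>

lemma close_to_sides:
  assumes "x \<in> M" "y \<in> M" "w \<in> M"
  obtains q a b where "q \<in> L x y" "a \<in> L x w" "b \<in> L w y" "d q a \<le> D" "d q b \<le> D + 1"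
proof -
  obtain p m where p: "p 0 = x" "p m = y" "\<And>i. i \<le> m \<Longrightarrow> p i \<in> L x y"
    "\<And>i. i < m \<Longrightarrow> d (p i) (p (Suc i)) \<le> 1" using L_chain[OF assms(1,2)] by blast
  have ends: "u \<in> L u v \<and> v \<in> L u v" if "u \<in> M" "v \<in> M" for u v
    using L_chain[OF that] by (metis le_refl zero_le)
  define A where "A i \<longleftrightarrow> (\<exists>a\<in>L x w. d (p i) a \<le> D)" for i
  define B where "B i \<longleftrightarrow> (\<exists>b\<in>L w y. d (p i) b \<le> D)" for i
  have AB: "A i \<or> B i" if "i \<le> m" for i
    using L_thin[OF assms(1,2,3) p(3)[OF that]] unfolding A_def B_def by blast
  have "A 0" unfolding A_def using p(1) ends[OF assms(1,3)] d_self[OF assms(1)] by (metis zero_le)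
  have "B m" unfolding B_def using p(2) ends[OF assms(3,2)] d_self[OF assms(2)] by (metis zero_le)
  have "\<exists>i\<le>m. A i \<and> (B i \<or> (i < m \<and> B (Suc i)))"
  proof (rule ccontr)
    assume neg: "\<not> ?thesis"
    have "i \<le> m \<Longrightarrow> A i" for i
    proof (induction i)
      case (Suc i)
      then show ?case using neg AB[of "Suc i"] by auto
    qed (use \<open>A 0\<close> in simp)
    then show False using \<open>B m\<close> neg by blast
  qed
  then obtain i where i: "i \<le> m" "A i" "B i \<or> (i < m \<and> B (Suc i))" by blast
  have pM: "j \<le> m \<Longrightarrow> p j \<in> M" for j using p(3) L_sub assms by blast
  have "\<exists>b\<in>L w y. d (p i) b \<le> D + 1"
    using i(3)
  proof
    assume "i < m \<and> B (Suc i)"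
    then obtain b where b: "b \<in> L w y" "d (p (Suc i)) b \<le> D" "i < m" unfolding B_def by blast
    then have "b \<in> M" using L_sub assms by blast
    then have "d (p i) b \<le> D + 1" using d_tri[of "p i" "p (Suc i)" b] pM b p(4)[OF b(3)] by simp
    then show ?thesis using b by blast
  next
    assume "B i"
    then show ?thesis unfolding B_def by (meson le_add1 order_trans)
  qed
  then show ?thesis using that p(3)[OF i(1)] i(2) unfolding A_def by blast
qed

text \<open>Up to a constant, the Gromov product of \<open>x\<close> and \<open>y\<close> at
  \<open>w\<close> is the distance from \<open>w\<close> to the set \<open>L x y\<close>;
  \<open>upper\<close> and \<open>lower\<close> are the two estimates. The four-point inequality
  then says that a point of \<open>L x z\<close> is close to \<open>L x y\<close> or to
  \<open>L y z\<close>.\<close>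

lemma hyperbolic: "gromov_hyperbolic M (\<lambda>x y. real (d x y))"
proof -
  obtain T where T: "\<And>x y p. \<lbrakk>x \<in> M; y \<in> M; p \<in> L x y\<rbrakk> \<Longrightarrow> \<exists>q\<in>I x y. d p q \<le> T"
    using close_to_interval by blast
  have excess: "d x p + d p y \<le> d x y + 2 * T" if "x \<in> M" "y \<in> M" "p \<in> L x y" for x y p
  proof -
    obtain q where "q \<in> I x y" "d p q \<le> T" using T \<open>x \<in> M\<close> \<open>y \<in> M\<close> \<open>p \<in> L x y\<close> by blast
    moreover have "p \<in> M" using L_sub \<open>x \<in> M\<close> \<open>y \<in> M\<close> \<open>p \<in> L x y\<close> by blast
    ultimately show ?thesis
      using d_tri[of x q p] d_tri[of p q y] d_sym[of q p] \<open>x \<in> M\<close> \<open>y \<in> M\<close> by (auto simp: I_def)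
  qed
  define C where "C = 2 * T + 2 * (D + 1)"
  let ?P = "gromov_product (\<lambda>x y. real (d x y))"
  have upper: "\<exists>q\<in>L x y. real (d w q) \<le> ?P w x y + C" if M: "x \<in> M" "y \<in> M" "w \<in> M" for x y w
  proof -
    obtain q a b where q: "q \<in> L x y" "a \<in> L x w" "b \<in> L w y" "d q a \<le> D" "d q b \<le> D + 1"
      using close_to_sides[OF M] by blast
    have mem: "q \<in> M" "a \<in> M" "b \<in> M" using L_sub q that by blast+
    have "d x q \<le> d x a + d q a" "d w q \<le> d a w + d q a"
      using d_tri[of x a q] d_tri[of q a w] d_sym mem that by (metis, metis add.commute)
    moreover have "d y q \<le> d b y + d q b" "d w q \<le> d w b + d q b"
      using d_tri[of y b q] d_tri[of w b q] d_sym mem that by metis+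
    moreover have "d x a + d a w \<le> d x w + 2 * T" "d w b + d b y \<le> d w y + 2 * T"
      using excess q that by blast+
    moreover have "d x y \<le> d x q + d y q" using d_tri[of x q y] d_sym[of y q] mem that by simp
    ultimately have "2 * d w q + d x y \<le> (d x w + 2 * T) + (d w y + 2 * T) + 2 * d q a + 2 * d q b"
      by linarith
    then have "2 * d w q + d x y \<le> d x w + d w y + 2 * C"
      using q(4,5) by (simp add: C_def)
    then have "2 * real (d w q) + real (d x y) \<le> real (d x w) + real (d w y) + 2 * real C"
      by (simp flip: of_nat_add of_nat_mult)
    then show ?thesis using q(1) d_sym[of x w] that unfolding gromov_product_def
      by (intro bexI[of _ q]) (auto simp: field_simps)
  qed
  have lower: "?P w x y \<le> real (d w q) + T" if "x \<in> M" "y \<in> M" "w \<in> M" "q \<in> L x y" for x y w q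
  proof -
    have "q \<in> M" using L_sub that by blast
    then have "d w x \<le> d w q + d x q" "d w y \<le> d w q + d q y"
      using d_tri[of w q x] d_tri[of w q y] d_sym[of q x] that by simp_all
    moreover have "d x q + d q y \<le> d x y + 2 * T" using excess that by blast
    ultimately have "d w x + d w y \<le> 2 * d w q + d x y + 2 * T" by linarith
    then have "real (d w x) + real (d w y) \<le> 2 * real (d w q) + real (d x y) + 2 * real T"
      by (simp flip: of_nat_add of_nat_mult)
    then show ?thesis unfolding gromov_product_def by (simp add: field_simps)
  qed
  show ?thesis unfolding gromov_hyperbolic_def
  proof (intro exI[of _ "real (C + D + T)"] ballI)
    fix w x y z assume M: "w \<in> M" "x \<in> M" "y \<in> M" "z \<in> M"
    obtain q where q: "q \<in> L x z" "real (d w q) \<le> ?P w x z + C" using upper M by blast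
    obtain q' where q': "q' \<in> L x y \<union> L y z" "d q q' \<le> D" using L_thin q M by blast
    have "q \<in> M" "q' \<in> M" using L_sub q q' M by blast+
    then have "real (d w q') \<le> real (d w q) + real D"
      using d_tri[of w q q'] q' M by (simp flip: of_nat_add)
    moreover have "min (?P w x y) (?P w y z) \<le> real (d w q') + T"
      using lower[of x y w q'] lower[of y z w q'] q' M by fastforce
    ultimately show "min (?P w x y) (?P w y z) - real (C + D + T) \<le> ?P w x z"
      using q by simp
  qed
qed

end

subsection \<open>Words in a right-angled Artin group\<close>

locale trace_letters =
  fixes iv :: "'l \<Rightarrow> 'l" and ind :: "'l \<Rightarrow> 'l \<Rightarrow> bool"
  assumes iv_iv [simp]: "iv (iv l) = l"
    and ind_sym: "ind l m \<Longrightarrow> ind m l"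
    and ind_irrefl [simp]: "\<not> ind l l"
    and ind_iv_left [simp]: "ind (iv l) m \<longleftrightarrow> ind l m"
begin

lemma ind_iv_right [simp]: "ind l (iv m) \<longleftrightarrow> ind l m"
  using ind_sym ind_iv_left by blast

text \<open>Equality of traces, with commutations only, so that length and letters are invariants.
  \<open>geq\<close> below is equality in the right-angled Artin group; reduced words that are equal
  in the group turn out to be equal as traces.\<close>

inductive ceq :: "'l list \<Rightarrow> 'l list \<Rightarrow> bool" (infix "\<asymp>" 50) where
  ceq_refl [simp, intro]: "w \<asymp> w"
| ceq_swap: "ind l m \<Longrightarrow> l # m # w \<asymp> m # l # w"
| ceq_Cons: "u \<asymp> w \<Longrightarrow> l # u \<asymp> l # w"
| ceq_trans [trans]: "u \<asymp> w \<Longrightarrow> w \<asymp> x \<Longrightarrow> u \<asymp> x"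

inductive geq :: "'l list \<Rightarrow> 'l list \<Rightarrow> bool" (infix "\<sim>" 50) where
  geq_refl [simp, intro]: "w \<sim> w"
| geq_swap: "ind l m \<Longrightarrow> l # m # w \<sim> m # l # w"
| geq_cancel: "l # iv l # w \<sim> w"
| geq_Cons: "u \<sim> w \<Longrightarrow> l # u \<sim> l # w"
| geq_sym: "u \<sim> w \<Longrightarrow> w \<sim> u"
| geq_trans [trans]: "u \<sim> w \<Longrightarrow> w \<sim> x \<Longrightarrow> u \<sim> x"

lemma ceq_sym: "u \<asymp> w \<Longrightarrow> w \<asymp> u"
  by (induction rule: ceq.induct) (auto intro: ceq.intros ind_sym)

lemma ceq_imp_geq: "u \<asymp> w \<Longrightarrow> u \<sim> w"
  by (induction rule: ceq.induct) (auto intro: geq.intros)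

lemma ceq_length: "u \<asymp> w \<Longrightarrow> length u = length w"
  by (induction rule: ceq.induct) auto

lemma ceq_set: "u \<asymp> w \<Longrightarrow> set u = set w"
  by (induction rule: ceq.induct) auto

lemma ceq_append_left: "u \<asymp> w \<Longrightarrow> x @ u \<asymp> x @ w"
  by (induction x) (auto intro: ceq_Cons)

lemma ceq_append_right: "u \<asymp> w \<Longrightarrow> u @ x \<asymp> w @ x"
  by (induction rule: ceq.induct) (auto intro: ceq.intros)

lemma ceq_append: "u \<asymp> w \<Longrightarrow> u' \<asymp> w' \<Longrightarrow> u @ u' \<asymp> w @ w'"
  by (meson ceq_append_left ceq_append_right ceq_trans)

lemma geq_append_left: "u \<sim> w \<Longrightarrow> x @ u \<sim> x @ w"
  by (induction x) (auto intro: geq_Cons)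

lemma geq_append_right: "u \<sim> w \<Longrightarrow> u @ x \<sim> w @ x"
  by (induction rule: geq.induct) (auto intro: geq.intros)

lemma geq_append: "u \<sim> w \<Longrightarrow> u' \<sim> w' \<Longrightarrow> u @ u' \<sim> w @ w'"
  by (meson geq_append_left geq_append_right geq_trans)

lemma ceq_move: "\<forall>m\<in>set x. ind l m \<Longrightarrow> x @ l # y \<asymp> l # x @ y"
proof (induction x)
  case (Cons m x)
  then have "m # (x @ l # y) \<asymp> m # l # x @ y" by (auto intro: ceq_Cons)
  also have "\<dots> \<asymp> l # m # x @ y" using Cons.prems by (auto intro: ceq_swap ind_sym)
  finally show ?case by simp
qed simp

definition winv :: "'l list \<Rightarrow> 'l list" where
  "winv w = rev (map iv w)"

lemma winv_simps [simp]: "winv [] = []" "winv (l # w) = winv w @ [iv l]"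
  "winv (u @ w) = winv w @ winv u" "winv (winv w) = w" "length (winv w) = length w"
  by (auto simp: winv_def rev_map o_def)

lemma geq_cancel': "iv l # l # w \<sim> w"
  using geq_cancel[of "iv l" w] by simp

lemma geq_winv_right: "w @ winv w @ x \<sim> x"
proof (induction w arbitrary: x)
  case (Cons l w)
  have "w @ winv w @ iv l # x \<sim> iv l # x" by (rule Cons.IH)
  then have "l # w @ winv w @ iv l # x \<sim> l # iv l # x" by (rule geq_Cons)
  also have "\<dots> \<sim> x" by (rule geq_cancel)
  finally show ?case by simp
qed simp

lemma geq_winv_left: "winv w @ w @ x \<sim> x"
  using geq_winv_right[of "winv w" x] by simp

lemma geq_winv: "u \<sim> w \<Longrightarrow> winv u \<sim> winv w"
proof -
  assume *: "u \<sim> w"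
  have "winv u @ w @ winv w \<sim> winv u @ []"
    using geq_winv_right[of w "[]"] by (intro geq_append_left) simp
  then have "winv u \<sim> winv u @ w @ winv w" by (simp add: geq_sym)
  also have "\<dots> \<sim> winv u @ u @ winv w"
    by (intro geq_append_left geq_append_right geq_sym[OF *])
  also have "\<dots> \<sim> winv w" by (rule geq_winv_left)
  finally show ?thesis .
qed

section \<open>Left division of traces and normal forms\<close>

fun del :: "'l \<Rightarrow> 'l list \<Rightarrow> 'l list option" where
  "del l [] = None"
| "del l (m # w) = (if m = l then Some w else if ind l m then map_option ((#) m) (del l w) else None)"

lemma del_Some_iff:
  "del l w \<noteq> None \<longleftrightarrow> (\<exists>x y. w = x @ l # y \<and> (\<forall>m\<in>set x. ind l m))"
proof (induction w)
  case (Cons m w)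
  show ?case
  proof (cases "m = l")
    case True
    then have "m # w = [] @ l # w" by simp
    then show ?thesis using True by force
  next
    case False
    have "(\<exists>x y. m # w = x @ l # y \<and> (\<forall>k\<in>set x. ind l k)) \<longleftrightarrow>
        ind l m \<and> (\<exists>x y. w = x @ l # y \<and> (\<forall>k\<in>set x. ind l k))"
      using False by (fastforce simp: Cons_eq_append_conv)
    then show ?thesis using False Cons by auto
  qed
qed simp

lemma del_imp_ceq: "del l w = Some w' \<Longrightarrow> w \<asymp> l # w'"
proof (induction w arbitrary: w')
  case (Cons m w)
  show ?case
  proof (cases "m = l")
    case False
    then obtain w1 where w1: "ind l m" "del l w = Some w1" "w' = m # w1"
      using Cons.prems by (auto split: if_splits)
    have "m # w \<asymp> m # l # w1" using Cons.IH[OF w1(2)] by (rule ceq_Cons)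
    also have "\<dots> \<asymp> l # m # w1" using w1 by (auto intro: ceq_swap ind_sym)
    finally show ?thesis using w1 by simp
  qed (use Cons in auto)
qed simp

lemma del_append:
  "del l (u @ w) = (case del l u of Some u' \<Rightarrow> Some (u' @ w)
     | None \<Rightarrow> if \<forall>m\<in>set u. ind l m then map_option (\<lambda>w'. u @ w') (del l w) else None)"
proof (induction u)
  case Nil
  show ?case by (cases "del l w") auto
next
  case (Cons m u)
  then show ?case by (cases "del l w") (auto split: option.splits)
qed

text \<open>Left division by a letter is well defined on traces: it removes the first occurrence of
  \<open>l\<close>, and a swap of independent letters neither frees nor blocks that
  occurrence.\<close>

lemma del_ceq: "u \<asymp> w \<Longrightarrow> rel_option (\<asymp>) (del l u) (del l w)"
proof (induction rule: ceq.induct)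
  case (ceq_refl w)
  then show ?case by (simp add: option.rel_refl)
next
  case (ceq_swap m k w)
  then show ?case
    using ind_sym[OF ceq_swap] by (cases "del l w") (auto intro: ceq.intros)
next
  case (ceq_Cons u w m)
  then show ?case
    by (cases "del l u"; cases "del l w") (auto intro: ceq.intros)
next
  case (ceq_trans u w x)
  then show ?case
    by (cases "del l u"; cases "del l w"; cases "del l x") (auto intro: ceq.ceq_trans)
qed

lemma del_ceq_None: "u \<asymp> w \<Longrightarrow> del l u = None \<longleftrightarrow> del l w = None"
  using del_ceq[of u w l] by (cases "del l u"; cases "del l w") auto

fun red :: "'l list \<Rightarrow> bool" where
  "red [] \<longleftrightarrow> True"
| "red (l # w) \<longleftrightarrow> red w \<and> del (iv l) w = None"

lemma ind_neq: "ind l m \<Longrightarrow> l \<noteq> m \<and> m \<noteq> l \<and> iv l \<noteq> m \<and> m \<noteq> iv l \<and> l \<noteq> iv m \<and> iv m \<noteq> l"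
  by (metis ind_irrefl ind_iv_left ind_iv_right)

lemma red_ceq: "u \<asymp> w \<Longrightarrow> red u \<longleftrightarrow> red w"
proof (induction rule: ceq.induct)
  case (ceq_swap l m w)
  then have "ind m l" by (rule ind_sym)
  then show ?case using ceq_swap ind_neq[OF ceq_swap] by auto
next
  case (ceq_Cons u w l)
  then show ?case using del_ceq_None by auto
qed auto

lemma red_appendD: "red (u @ w) \<Longrightarrow> red u \<and> red w"
  by (induction u) (auto simp: del_append split: option.splits if_splits)

text \<open>Left multiplication by a letter, as an action on reduced words modulo
  \<open>ceq\<close>. The normal form of a word is obtained by letting it act on the empty
  word.\<close>

definition mul :: "'l \<Rightarrow> 'l list \<Rightarrow> 'l list" where
  "mul l w = (case del (iv l) w of Some w' \<Rightarrow> w' | None \<Rightarrow> l # w)"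

definition nf :: "'l list \<Rightarrow> 'l list" where
  "nf w = foldr mul w []"

lemma nf_simps [simp]: "nf [] = []" "nf (l # w) = mul l (nf w)"
  by (auto simp: nf_def)

lemma red_mul: "red w \<Longrightarrow> red (mul l w)"
  unfolding mul_def
  using red_ceq[OF del_imp_ceq, of "iv l" w] by (auto split: option.splits)

lemma red_nf [simp]: "red (nf w)"
  by (induction w) (auto intro: red_mul)

lemma geq_mul: "mul l w \<sim> l # w"
proof (cases "del (iv l) w")
  case None
  then show ?thesis by (simp add: mul_def)
next
  case (Some w')
  have "l # w \<sim> l # iv l # w'"
    using del_imp_ceq[OF Some] by (auto intro: geq_Cons ceq_imp_geq)
  also have "\<dots> \<sim> w'" by (rule geq_cancel)
  finally show ?thesis using Some by (simp add: mul_def geq_sym)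
qed

lemma geq_nf: "nf w \<sim> w"
proof (induction w)
  case (Cons l w)
  have "mul l (nf w) \<sim> l # nf w" by (rule geq_mul)
  also have "\<dots> \<sim> l # w" using Cons by (rule geq_Cons)
  finally show ?case by simp
qed simp

lemma geq_nf': "w \<sim> nf w"
  by (rule geq_sym) (rule geq_nf)

lemma nf_red: "red w \<Longrightarrow> nf w = w"
  by (induction w) (auto simp: mul_def)

lemma mul_ceq: "u \<asymp> w \<Longrightarrow> mul l u \<asymp> mul l w"
  using del_ceq[of u w "iv l"] unfolding mul_def
  by (cases "del (iv l) u"; cases "del (iv l) w") (auto intro: ceq_Cons)

lemma mul_mul_iv: "red w \<Longrightarrow> mul l (mul (iv l) w) \<asymp> w"
proof (cases "del l w")
  case None
  then show ?thesis by (simp add: mul_def)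
next
  case (Some w')
  assume "red w"
  then have "red (l # w')" using red_ceq[OF del_imp_ceq[OF Some]] by simp
  then have "mul l w' = l # w'" by (simp add: mul_def)
  then show ?thesis using Some del_imp_ceq[OF Some] by (simp add: mul_def ceq_sym)
qed

text \<open>Divisions by two independent letters remove different occurrences, so they commute, and
  carrying out one does not affect whether the other is possible. This is the case analysis behind
  \<open>mul_commute\<close>.\<close>

lemma del_del:
  assumes "ind l m" "del l w = Some u"
  shows "case del m w of None \<Rightarrow> del m u = None
    | Some v \<Rightarrow> \<exists>x. del m u = Some x \<and> del l v = Some x"
  using assms
proof (induction w arbitrary: u)
  case (Cons k w)
  have lm: "l \<noteq> m" "ind m l" using Cons.prems(1) ind_sym ind_neq by blast+
  show ?case
  proof (cases "k = l")
    case True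
    then show ?thesis using Cons.prems lm by (auto split: option.splits)
  next
    case False
    then obtain u1 where u1: "ind l k" "del l w = Some u1" "u = k # u1"
      using Cons.prems by (auto split: if_splits)
    show ?thesis using Cons.IH[OF Cons.prems(1) u1(2)] False lm u1
      by (auto split: option.splits)
  qed
qed simp

lemma mul_commute:
  assumes "ind l m"
  shows "mul l (mul m w) \<asymp> mul m (mul l w)"
proof -
  have i: "ind (iv l) (iv m)" "ind (iv m) (iv l)" "ind l (iv m)" "ind m (iv l)" "ind m l"
    "ind (iv l) m" "ind (iv m) l"
    using assms ind_sym by auto
  note n = ind_neq[OF assms]
  show ?thesis
  proof (cases "del (iv l) w")
    case (Some u)
    show ?thesis
    proof (cases "del (iv m) w")
      case None
      then have "del (iv m) u = None" using del_del[OF i(1) Some] by simp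
      then show ?thesis using Some None i n by (auto simp: mul_def)
    next
      case (Some v)
      show ?thesis using del_del[OF i(1) \<open>del (iv l) w = Some u\<close>] Some \<open>del (iv l) w = Some u\<close>
        by (auto simp: mul_def)
    qed
  next
    case None
    show ?thesis
    proof (cases "del (iv m) w")
      case (Some v)
      then have "del (iv l) v = None" using del_del[OF i(2) Some] None by simp
      then show ?thesis using Some None i n by (auto simp: mul_def)
    next
      case None2: None
      show ?thesis using None None2 i n assms by (auto simp: mul_def intro: ceq_swap)
    qed
  qed
qed

text \<open>The normal form theorem by an action instead of confluence: by
  \<open>mul_commute\<close> and \<open>mul_mul_iv\<close> the action of letters on reduced words
  modulo \<open>ceq\<close> satisfies the defining relations of the group, so equal group elements
  send the empty word to the same trace.\<close>

lemma nf_geq: "u \<sim> w \<Longrightarrow> nf u \<asymp> nf w"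
proof (induction rule: geq.induct)
  case (geq_swap l m w)
  then show ?case by (simp add: mul_commute)
next
  case (geq_cancel l w)
  then show ?case by (simp add: mul_mul_iv)
next
  case (geq_Cons u w l)
  then show ?case by (simp add: mul_ceq)
qed (auto intro: ceq_sym ceq.ceq_trans)

lemma length_mul: "length (mul l w) \<le> Suc (length w)"
  using ceq_length[OF del_imp_ceq, of "iv l" w] by (auto simp: mul_def split: option.splits)

lemma length_nf: "length (nf w) \<le> length w"
proof (induction w)
  case (Cons l w)
  then show ?case using length_mul[of l "nf w"] by simp
qed simp

section \<open>Length and distance in the Artin group\<close>

definition wnorm :: "'l list \<Rightarrow> nat" where
  "wnorm w = length (nf w)"

lemma wnorm_geq: "u \<sim> w \<Longrightarrow> wnorm u = wnorm w"
  unfolding wnorm_def by (intro ceq_length nf_geq)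

lemma wnorm_red: "red w \<Longrightarrow> wnorm w = length w"
  by (simp add: wnorm_def nf_red)

lemma wnorm_le: "wnorm w \<le> length w"
  by (simp add: wnorm_def length_nf)

lemma wnorm_append: "wnorm (u @ w) \<le> wnorm u + wnorm w"
proof -
  have "u @ w \<sim> nf u @ nf w" by (intro geq_append geq_nf')
  then have "wnorm (u @ w) = wnorm (nf u @ nf w)" by (rule wnorm_geq)
  also have "\<dots> \<le> length (nf u @ nf w)" by (rule wnorm_le)
  finally show ?thesis by (simp add: wnorm_def)
qed

lemma wnorm_winv: "wnorm (winv w) = wnorm w"
proof -
  have "wnorm (winv w) \<le> wnorm w" for w
  proof -
    have "wnorm (winv w) = wnorm (winv (nf w))"
      by (intro wnorm_geq geq_winv geq_nf')
    also have "\<dots> \<le> length (winv (nf w))" by (rule wnorm_le)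
    finally show ?thesis by (simp add: wnorm_def)
  qed
  from this[of w] this[of "winv w"] show ?thesis by simp
qed

definition wdist :: "'l list \<Rightarrow> 'l list \<Rightarrow> nat" where
  "wdist u w = wnorm (winv u @ w)"

lemma wdist_commute: "wdist u w = wdist w u"
  using wnorm_winv[of "winv u @ w"] by (simp add: wdist_def)

lemma wdist_geq: "u \<sim> u' \<Longrightarrow> w \<sim> w' \<Longrightarrow> wdist u w = wdist u' w'"
  unfolding wdist_def by (intro wnorm_geq geq_append geq_winv)

lemma wdist_triangle: "wdist u w \<le> wdist u x + wdist x w"
proof -
  have "winv u @ w \<sim> winv u @ x @ winv x @ w"
    by (intro geq_append_left geq_winv_right[THEN geq_sym])
  then have "wdist u w = wnorm ((winv u @ x) @ (winv x @ w))"
    unfolding wdist_def by (intro wnorm_geq) simp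
  then show ?thesis using wnorm_append[of "winv u @ x" "winv x @ w"] by (simp add: wdist_def)
qed

lemma wdist_append_left: "wdist (x @ u) (x @ w) = wdist u w"
  unfolding wdist_def by (intro wnorm_geq) (simp add: geq_append_left geq_winv_left)

lemma winv_del: "del l (winv w) \<noteq> None \<longleftrightarrow> (\<exists>x y. w = x @ iv l # y \<and> (\<forall>m\<in>set y. ind l m))"
proof
  assume "del l (winv w) \<noteq> None"
  then obtain x y where "winv w = x @ l # y" "\<forall>m\<in>set x. ind l m" unfolding del_Some_iff by blast
  then have "w = winv y @ iv l # winv x" "\<forall>m\<in>set (winv x). ind l m"
    using winv_simps(4)[of w] by (auto simp: winv_def)
  then show "\<exists>x y. w = x @ iv l # y \<and> (\<forall>m\<in>set y. ind l m)" by blast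
next
  assume "\<exists>x y. w = x @ iv l # y \<and> (\<forall>m\<in>set y. ind l m)"
  then obtain x y where "w = x @ iv l # y" "\<forall>m\<in>set y. ind l m" by blast
  then have "winv w = winv y @ l # winv x" "\<forall>m\<in>set (winv y). ind l m" by (auto simp: winv_def)
  then show "del l (winv w) \<noteq> None" unfolding del_Some_iff by blast
qed

text \<open>A word whose normal form has the same length is reduced, and the length of the normal
  form is invariant under inversion.\<close>

lemma red_winv: "red w \<Longrightarrow> red (winv w)"
proof -
  assume "red w"
  have "length (nf (winv w)) = length (winv w)"
    using wnorm_winv[of w] \<open>red w\<close> by (simp add: wnorm_def nf_red)
  moreover have "length (nf w) = length w \<Longrightarrow> red w" for w
  proof (induction w)
    case (Cons l w)
    have "length (nf w) = length w"
      using Cons.prems length_mul[of l "nf w"] length_nf[of w] by simp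
    then have "red w" by (rule Cons.IH)
    then have "length (mul l w) = Suc (length w)" using Cons.prems by (simp add: nf_red)
    then have "del (iv l) w = None"
      using ceq_length[OF del_imp_ceq, of "iv l" w] by (auto simp: mul_def split: option.splits)
    then show ?case using \<open>red w\<close> by simp
  qed simp
  ultimately show ?thesis by blast
qed

text \<open>Strip common first letters as long as there are any. Seen from the origin, the common
  prefix \<open>u\<close> becomes the gate of the origin on the interval between \<open>x\<close>
  and \<open>z\<close>.\<close>

lemma meet:
  assumes "red x" "red z"
  obtains u x' z' where "x \<asymp> u @ x'" "z \<asymp> u @ z'" "\<And>l. del l x' = None \<or> del l z' = None"
  using assms
proof (induction "length x" arbitrary: x z thesis rule: less_induct)
  case less
  show ?case
  proof (cases "\<exists>l. del l x \<noteq> None \<and> del l z \<noteq> None")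
    case False
    then show ?thesis using less.prems(1)[of "[]" x z] by auto
  next
    case True
    then obtain l x1 z1 where d: "del l x = Some x1" "del l z = Some z1" by auto
    note c = del_imp_ceq[OF d(1)] del_imp_ceq[OF d(2)]
    have r: "red x1" "red z1" using red_ceq[OF c(1)] red_ceq[OF c(2)] less.prems by auto
    have "length x1 < length x" using ceq_length[OF c(1)] by simp
    then obtain u x' z' where u: "x1 \<asymp> u @ x'" "z1 \<asymp> u @ z'"
      "\<And>l. del l x' = None \<or> del l z' = None" using less.hyps r by blast
    have "x \<asymp> (l # u) @ x'" "z \<asymp> (l # u) @ z'"
      using c u(1,2) by (auto intro: ceq_trans ceq_Cons)
    then show ?thesis using less.prems(1) u(3) by blast
  qed
qed

text \<open>Two reduced words \<open>a\<close> and \<open>b\<close> can cancel only across the seam,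
  where a last letter of \<open>a\<close> meets its inverse among the first letters of
  \<open>b\<close>; for \<open>a = winv x\<close> and \<open>b = z\<close> this would be a first
  letter common to \<open>x\<close> and \<open>z\<close>.\<close>

lemma red_winv_append:
  assumes "red x" "red z" "\<And>l. del l x = None \<or> del l z = None"
  shows "red (winv x @ z)"
proof -
  have "red (a @ b)" if "red a" "red b" "\<And>l. del l (winv a) = None \<or> del l b = None" for a b
    using that
  proof (induction a)
    case (Cons l a)
    have "red (a @ b)"
    proof (rule Cons.IH)
      fix m show "del m (winv a) = None \<or> del m b = None"
        using Cons.prems(3)[of m] by (auto simp: del_append split: option.splits)
    qed (use Cons.prems in auto)
    moreover have "del (iv l) (a @ b) = None"
    proof (rule ccontr)
      assume "del (iv l) (a @ b) \<noteq> None"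
      moreover have "del (iv l) a = None" using Cons.prems by simp
      ultimately have *: "\<forall>m\<in>set a. ind l m" "del (iv l) b \<noteq> None"
        by (auto simp: del_append split: if_splits)
      have "l # a = [] @ iv (iv l) # a" by simp
      then have "del (iv l) (winv (l # a)) \<noteq> None"
        unfolding winv_del using *(1) by (metis ind_iv_left)
      then show False using Cons.prems(3)[of "iv l"] *(2) by simp
    qed
    ultimately show ?case by simp
  qed simp
  from this[of "winv x" z] show ?thesis using assms red_winv by simp
qed

text \<open>The coprime case of Levi's lemma for traces: the letters of \<open>w\<close>, taken in
  turn, divide the common word but not \<open>u\<close>, so each of them moves to the front through
  all of \<open>u\<close>.\<close>

lemma levi_disjoint:
  assumes "u @ u' \<asymp> w @ w'" "\<And>l. del l u = None \<or> del l w = None"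
  shows "\<forall>l\<in>set u. \<forall>m\<in>set w. ind l m"
  using assms
proof (induction w arbitrary: u')
  case (Cons m w)
  have "del m u = None" using Cons.prems(2)[of m] by simp
  moreover have r: "rel_option (\<asymp>) (del m (u @ u')) (Some (w @ w'))"
    using del_ceq[OF Cons.prems(1), of m] by simp
  ultimately obtain u'' where u: "\<forall>k\<in>set u. ind m k" "del m u' = Some u''" "u @ u'' \<asymp> w @ w'"
    by (cases "del m u'") (auto simp: del_append split: if_splits)
  have "\<forall>l\<in>set u. \<forall>m\<in>set w. ind l m"
  proof (rule Cons.IH[OF u(3)])
    fix l
    show "del l u = None \<or> del l w = None"
    proof (cases "del l u")
      case (Some y)
      then have "l \<in> set u" using ceq_set[OF del_imp_ceq[OF Some]] by auto
      then have "ind l m" using u(1) ind_sym by blast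
      then have "l \<noteq> m" using ind_neq by blast
      then show ?thesis using Cons.prems(2)[of l] Some \<open>ind l m\<close> by auto
    qed simp
  qed
  then show ?case using u(1) ind_sym by auto
qed simp

text \<open>The origin stands for a point on a geodesic from \<open>x\<close> to \<open>y\<close>:
  by \<open>geo\<close> nothing cancels in \<open>winv x @ y\<close>. So \<open>x\<close> and
  \<open>y\<close> have no common first letter, and neither have their prefixes \<open>u\<close> and
  \<open>v\<close>. As both prefixes divide \<open>z\<close>, Levi's lemma makes them
  independent.\<close>

lemma interval_meets:
  assumes xyz: "red x" "red y" "red z" and geo: "wnorm (winv x @ y) = length x + length y"
  obtains u x' z' v y' z'' where "x \<asymp> u @ x'" "z \<asymp> u @ z'" "y \<asymp> v @ y'" "z \<asymp> v @ z''"
    "wnorm (winv x @ z) = length x' + length z'" "wnorm (winv y @ z) = length y' + length z''"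
    "\<forall>l\<in>set u. \<forall>m\<in>set v. ind l m"
proof -
  obtain u x' z' where u: "x \<asymp> u @ x'" "z \<asymp> u @ z'" "\<And>l. del l x' = None \<or> del l z' = None"
    using meet xyz by blast
  obtain v y' z'' where v: "y \<asymp> v @ y'" "z \<asymp> v @ z''" "\<And>l. del l y' = None \<or> del l z'' = None"
    using meet xyz by blast
  have norm: "wnorm (winv x @ z) = length x' + length z'"
    if "red x" "red z" "x \<asymp> u @ x'" "z \<asymp> u @ z'" "\<And>l. del l x' = None \<or> del l z' = None" for x z u x' z'
  proof -
    have r: "red x'" "red z'"
      using that red_ceq red_appendD by blast+
    have "winv x @ z \<sim> winv (u @ x') @ u @ z'"
      using that by (intro geq_append geq_winv ceq_imp_geq)
    also have "\<dots> \<sim> winv x' @ z'" by (simp add: geq_append_left geq_winv_left)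
    finally have "wnorm (winv x @ z) = wnorm (winv x' @ z')" by (rule wnorm_geq)
    also have "\<dots> = length (winv x' @ z')" by (intro wnorm_red red_winv_append r that)
    finally show ?thesis by simp
  qed
  have "del l u = None \<or> del l v = None" for l
  proof (rule ccontr)
    assume "\<not> ?thesis"
    then have "del l (u @ x') \<noteq> None" "del l (v @ y') \<noteq> None" by (auto simp: del_append)
    then obtain x1 y1 where d: "del l x = Some x1" "del l y = Some y1"
      using del_ceq_None[OF u(1), of l] del_ceq_None[OF v(1), of l] by (meson not_None_eq)
    note c = del_imp_ceq[OF d(1)] del_imp_ceq[OF d(2)]
    have "winv x @ y \<sim> winv (l # x1) @ (l # y1)"
      using c by (intro geq_append geq_winv ceq_imp_geq)
    also have "\<dots> \<sim> winv x1 @ y1" by (simp add: geq_append_left geq_cancel')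
    finally have "wnorm (winv x @ y) \<le> length (winv x1 @ y1)" using wnorm_geq wnorm_le by metis
    then show False using geo ceq_length[OF c(1)] ceq_length[OF c(2)] by simp
  qed
  moreover have "u @ z' \<asymp> v @ z''" using u(2) v(2) ceq_sym ceq_trans by blast
  ultimately have "\<forall>l\<in>set u. \<forall>m\<in>set v. ind l m" by (intro levi_disjoint)
  then show ?thesis
    using that u v norm[OF xyz(1,3) u] norm[OF xyz(2,3) v] by blast
qed

text \<open>Take a longest list of pairwise independent letters that can be moved to the front
  together. By maximality every first letter of the rest is blocked by a letter of the list.\<close>

lemma peel:
  obtains f w' where "w \<asymp> f @ w'" "pairwise ind (set f)" "distinct f"
    "\<And>l. del l w' \<noteq> None \<Longrightarrow> \<exists>m\<in>set f. \<not> ind m l"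
proof -
  define P where "P k \<longleftrightarrow> (\<exists>f w'. w \<asymp> f @ w' \<and> pairwise ind (set f) \<and> distinct f \<and> length f = k)" for k
  have "P 0" unfolding P_def by (intro exI[of _ "[]"] exI[of _ w]) auto
  moreover have "P k \<Longrightarrow> k \<le> length w" for k unfolding P_def using ceq_length by fastforce
  ultimately obtain k where k: "P k" "\<And>j. P j \<Longrightarrow> j \<le> k"
    using Nat.ex_has_greatest_nat[of P 0 "length w"] by blast
  then obtain f w' where f: "w \<asymp> f @ w'" "pairwise ind (set f)" "distinct f" "length f = k"
    unfolding P_def by blast
  have "\<exists>m\<in>set f. \<not> ind m l" if dl: "del l w' \<noteq> None" for l
  proof (rule ccontr)
    assume neg: "\<not> ?thesis"
    obtain w'' where "w' \<asymp> l # w''" using dl del_imp_ceq[of l w'] by (meson not_None_eq)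
    then have "f @ w' \<asymp> f @ l # w''" by (rule ceq_append_left)
    with f(1) have "w \<asymp> (f @ [l]) @ w''" using ceq_trans by fastforce
    moreover have "pairwise ind (set (f @ [l]))" "distinct (f @ [l])"
      using f(2,3) neg ind_sym by (auto simp: pairwise_insert)
    ultimately have "P (length (f @ [l]))" unfolding P_def by blast
    then show False using k(2) f(4) by fastforce
  qed
  then show ?thesis using that f by blast
qed

end

subsection \<open>Edge words in a coupled link complex\<close>

text \<open>The letter \<open>(a, b, s)\<close> is the edge labelled \<open>(a, b)\<close>, oriented from \<open>a\<close> to \<open>b\<close> if
  \<open>s\<close> holds and from \<open>b\<close> to \<open>a\<close> otherwise.\<close>

type_synonym ('a, 'b) letter = "'a \<times> 'b \<times> bool"

fun flip :: "('a, 'b) letter \<Rightarrow> ('a, 'b) letter" where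
  "flip (a, b, s) = (a, b, \<not> s)"

fun source :: "('a, 'b) letter \<Rightarrow> 'a + 'b" where
  "source (a, b, s) = (if s then Inl a else Inr b)"

fun target :: "('a, 'b) letter \<Rightarrow> 'a + 'b" where
  "target (a, b, s) = (if s then Inr b else Inl a)"

lemma flip_simps [simp]: "flip (flip l) = l" "source (flip l) = target l" "target (flip l) = source l"
  "fst (flip l) = fst l"
  by (cases l; simp)+

lemma flag_complexD:
  "\<lbrakk>flag_complex \<Gamma>; U \<subseteq> vertices \<Gamma>; \<And>u v. \<lbrakk>u \<in> U; v \<in> U; u \<noteq> v\<rbrakk> \<Longrightarrow> adjacent \<Gamma> u v\<rbrakk>
    \<Longrightarrow> U \<in> simplices \<Gamma>"
  unfolding flag_complex_def by simp

locale coloured_pair =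
  fixes n :: nat and \<Gamma>A :: "'a coloured_complex" and \<Gamma>B :: "'b coloured_complex"
  assumes complexA: "coloured_simplicial_complex n \<Gamma>A"
    and complexB: "coloured_simplicial_complex n \<Gamma>B"
    and flagA: "flag_complex \<Gamma>A"
    and flagB: "flag_complex \<Gamma>B"
begin

fun lind :: "('a, 'b) letter \<Rightarrow> ('a, 'b) letter \<Rightarrow> bool" where
  "lind (a, b, s) (c, d, t) \<longleftrightarrow> adjacent \<Gamma>A a c \<and> adjacent \<Gamma>B b d"

lemma adjacent_sym: "adjacent \<Gamma> u v \<Longrightarrow> adjacent \<Gamma> v u"
  by (auto simp: adjacent_def insert_commute)

sublocale trace_letters flip lind
proof
  fix l m :: "('a, 'b) letter"
  show "flip (flip l) = l" by simp
  show "lind l m \<Longrightarrow> lind m l" by (cases l; cases m) (auto intro: adjacent_sym)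
  show "\<not> lind l l" by (cases l) (auto simp: adjacent_def)
  show "lind (flip l) m = lind l m" by (cases l; cases m) auto
qed

notation ceq (infix "\<asymp>" 50) and geq (infix "\<sim>" 50)

section \<open>Vertices of the coupled link complex\<close>

fun compat :: "'a + 'b \<Rightarrow> 'a + 'b \<Rightarrow> bool" where
  "compat (Inl a) (Inl c) = adjacent \<Gamma>A a c"
| "compat (Inr b) (Inr d) = adjacent \<Gamma>B b d"
| "compat _ _ = True"

lemma compat_sym: "compat x y \<Longrightarrow> compat y x"
  by (cases x; cases y) (auto intro: adjacent_sym)

abbreviation X where "X \<equiv> coupled_link_vertices n \<Gamma>A \<Gamma>B"

abbreviation cells where "cells i \<equiv> colour_class \<Gamma>A i <+> colour_class \<Gamma>B i"

lemma colour_neq: "adjacent \<Gamma>A a c \<Longrightarrow> colour \<Gamma>A a \<noteq> colour \<Gamma>A c"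
  "adjacent \<Gamma>B b d \<Longrightarrow> colour \<Gamma>B b \<noteq> colour \<Gamma>B d"
  using complexA complexB by (auto simp: coloured_simplicial_complex_def)

text \<open>Flagness turns the two simplex conditions into conditions on pairs of coordinates, so
  whether a vertex stays in the complex after a change of one coordinate can be tested pair by
  pair.\<close>

lemma X_iff:
  "x \<in> X \<longleftrightarrow> x \<in> (\<Pi>\<^sub>E i\<in>{1..n}. cells i)
     \<and> (\<forall>i\<in>{1..n}. \<forall>j\<in>{1..n}. i \<noteq> j \<longrightarrow> compat (x i) (x j))"
  (is "_ \<longleftrightarrow> _ \<and> ?c")
proof (cases "x \<in> (\<Pi>\<^sub>E i\<in>{1..n}. cells i)")
  case True
  then have cl: "x i \<in> cells i" if "i \<in> {1..n}" for i using that by blast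
  let ?A = "{a. Inl a \<in> x ` {1..n}}" and ?B = "{b. Inr b \<in> x ` {1..n}}"
  have colA: "colour \<Gamma>A a = i \<and> a \<in> vertices \<Gamma>A" if "i \<in> {1..n}" "x i = Inl a" for i a
    using cl[OF that(1)] that(2) by (auto simp: colour_class_def)
  have colB: "colour \<Gamma>B a = i \<and> a \<in> vertices \<Gamma>B" if "i \<in> {1..n}" "x i = Inr a" for i a
    using cl[OF that(1)] that(2) by (auto simp: colour_class_def)
  have subA: "\<tau> \<in> simplices \<Gamma>A" if "\<sigma> \<in> simplices \<Gamma>A" "\<tau> \<subseteq> \<sigma>" for \<sigma> \<tau>
    using complexA that by (auto simp: coloured_simplicial_complex_def)
  have subB: "\<tau> \<in> simplices \<Gamma>B" if "\<sigma> \<in> simplices \<Gamma>B" "\<tau> \<subseteq> \<sigma>" for \<sigma> \<tau>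
    using complexB that by (auto simp: coloured_simplicial_complex_def)
  have "?A \<in> simplices \<Gamma>A \<and> ?B \<in> simplices \<Gamma>B \<longleftrightarrow> ?c"
  proof (intro iffI ballI impI conjI)
    fix i j assume s: "?A \<in> simplices \<Gamma>A \<and> ?B \<in> simplices \<Gamma>B" and ij: "i \<in> {1..n}" "j \<in> {1..n}" "i \<noteq> j"
    show "compat (x i) (x j)"
    proof (cases "x i")
      case (Inl a)
      show ?thesis
      proof (cases "x j")
        case Inl2: (Inl c)
        have "{a, c} \<subseteq> ?A" using ij Inl Inl2 by (metis (mono_tags) bot_least image_eqI insert_subset mem_Collect_eq)
        then have "{a, c} \<in> simplices \<Gamma>A" using s subA by blast
        moreover have "a \<noteq> c" using colA ij Inl Inl2 by metis
        ultimately show ?thesis using Inl Inl2 by (simp add: adjacent_def)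
      qed (use Inl in simp)
    next
      case (Inr a)
      show ?thesis
      proof (cases "x j")
        case Inr2: (Inr c)
        have "{a, c} \<subseteq> ?B" using ij Inr Inr2 by (metis (mono_tags) bot_least image_eqI insert_subset mem_Collect_eq)
        then have "{a, c} \<in> simplices \<Gamma>B" using s subB by blast
        moreover have "a \<noteq> c" using colB ij Inr Inr2 by metis
        ultimately show ?thesis using Inr Inr2 by (simp add: adjacent_def)
      qed (use Inr in simp)
    qed
  next
    assume c: ?c
    have "?A \<subseteq> vertices \<Gamma>A" using colA by (auto simp: image_iff)
    moreover have "adjacent \<Gamma>A a a'" if aa: "a \<in> ?A" "a' \<in> ?A" "a \<noteq> a'" for a a'
    proof -
      obtain i j where ij: "i \<in> {1..n}" "Inl a = x i" "j \<in> {1..n}" "Inl a' = x j"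
        using aa(1,2) unfolding mem_Collect_eq by (elim imageE) blast
      then have "i \<noteq> j" using aa(3) by (metis sum.inject)
      then have "compat (x i) (x j)" using c ij by blast
      then show ?thesis using ij by (metis compat.simps(1,2))
    qed
    ultimately show "?A \<in> simplices \<Gamma>A" by (rule flag_complexD[OF flagA])
  next
    assume c: ?c
    have "?B \<subseteq> vertices \<Gamma>B" using colB by (auto simp: image_iff)
    moreover have "adjacent \<Gamma>B a a'" if aa: "a \<in> ?B" "a' \<in> ?B" "a \<noteq> a'" for a a'
    proof -
      obtain i j where ij: "i \<in> {1..n}" "Inr a = x i" "j \<in> {1..n}" "Inr a' = x j"
        using aa(1,2) unfolding mem_Collect_eq by (elim imageE) blast
      then have "i \<noteq> j" using aa(3) by (metis sum.inject)
      then have "compat (x i) (x j)" using c ij by blast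
      then show ?thesis using ij by (metis compat.simps(1,2))
    qed
    ultimately show "?B \<in> simplices \<Gamma>B" by (rule flag_complexD[OF flagB])
  qed
  then show ?thesis using True unfolding coupled_link_vertices_def by blast
qed (auto simp: coupled_link_vertices_def)

lemma X_cell: "x \<in> X \<Longrightarrow> i \<in> {1..n} \<Longrightarrow> x i \<in> cells i"
  unfolding X_iff by blast

lemma X_compat: "x \<in> X \<Longrightarrow> i \<in> {1..n} \<Longrightarrow> j \<in> {1..n} \<Longrightarrow> i \<noteq> j \<Longrightarrow> compat (x i) (x j)"
  unfolding X_iff by blast

lemma finite_X: "finite X"
proof (rule finite_subset)
  show "X \<subseteq> (\<Pi>\<^sub>E i\<in>{1..n}. vertices \<Gamma>A <+> vertices \<Gamma>B)"
  proof
    fix x assume "x \<in> X"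
    then have "x \<in> (\<Pi>\<^sub>E i\<in>{1..n}. cells i)" by (simp add: coupled_link_vertices_def)
    moreover have "cells i \<subseteq> vertices \<Gamma>A <+> vertices \<Gamma>B" for i by (auto simp: colour_class_def)
    ultimately show "x \<in> (\<Pi>\<^sub>E i\<in>{1..n}. vertices \<Gamma>A <+> vertices \<Gamma>B)"
      using PiE_mono[of "{1..n}" cells "\<lambda>_. vertices \<Gamma>A <+> vertices \<Gamma>B"] by blast
  qed
  show "finite (\<Pi>\<^sub>E i\<in>{1..n}. vertices \<Gamma>A <+> vertices \<Gamma>B)"
    using complexA complexB by (intro finite_PiE finite_Plus) (auto simp: coloured_simplicial_complex_def)
qed

text \<open>The coordinate that the edge changes; for a proper letter both of its vertices have this
  colour.\<close>

definition lcol :: "('a, 'b) letter \<Rightarrow> nat" where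
  "lcol l = colour \<Gamma>A (fst l)"

lemma lcol_flip [simp]: "lcol (flip l) = lcol l"
  by (simp add: lcol_def)

definition proper_letter :: "('a, 'b) letter \<Rightarrow> bool" where
  "proper_letter l \<longleftrightarrow> fst l \<in> vertices \<Gamma>A \<and> fst (snd l) \<in> vertices \<Gamma>B
     \<and> colour \<Gamma>A (fst l) = colour \<Gamma>B (fst (snd l))"

lemma proper_flip [simp]: "proper_letter (flip l) = proper_letter l"
  by (cases l) (simp add: proper_letter_def)

lemma proper_cells: "proper_letter l \<Longrightarrow> source l \<in> cells (lcol l) \<and> target l \<in> cells (lcol l)"
  by (cases l) (auto simp: proper_letter_def lcol_def colour_class_def)

lemma proper_lcol: "proper_letter l \<Longrightarrow> lcol l \<in> {1..n}"
  using complexA by (auto simp: proper_letter_def lcol_def coloured_simplicial_complex_def)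

lemma lind_lcol: "lind l m \<Longrightarrow> lcol l \<noteq> lcol m"
  using colour_neq by (cases l; cases m) (auto simp: lcol_def)

lemma lind_compat: "lind l m \<Longrightarrow> compat (source l) (source m) \<and> compat (source l) (target m)
    \<and> compat (target l) (source m) \<and> compat (target l) (target m)"
  by (cases l; cases m) auto

section \<open>Edges and edge paths\<close>

definition step :: "(nat \<Rightarrow> 'a + 'b) \<Rightarrow> ('a, 'b) letter \<Rightarrow> (nat \<Rightarrow> 'a + 'b) \<Rightarrow> bool" where
  "step v l u \<longleftrightarrow> v \<in> X \<and> u \<in> X \<and> proper_letter l \<and> v (lcol l) = source l \<and> u = v(lcol l := target l)"

lemma step_flip: "step v l u \<Longrightarrow> step u (flip l) v"
  by (auto simp: step_def)

text \<open>The fourth corner of the square: its new value \<open>target m\<close> is compatible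
  with the value at \<open>lcol l\<close> because the letters are independent, and with all other
  values because it already occurs beside them in \<open>t\<close>.\<close>

lemma step_swap:
  assumes "step v l u" "step u m t" "lind l m"
  shows "\<exists>u'. step v m u' \<and> step u' l t"
proof -
  let ?i = "lcol l" and ?j = "lcol m"
  have s: "v \<in> X" "u \<in> X" "t \<in> X" "proper_letter l" "proper_letter m" "v ?i = source l"
    "u = v(?i := target l)" "u ?j = source m" "t = u(?j := target m)"
    using assms by (auto simp: step_def)
  have ij: "?i \<noteq> ?j" using assms(3) by (rule lind_lcol)
  then have vj: "v ?j = source m" using s by simp
  define u' where "u' = v(?j := target m)"
  have "u' \<in> X" unfolding X_iff
  proof (intro conjI ballI impI)
    show "u' \<in> (\<Pi>\<^sub>E i\<in>{1..n}. cells i)"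
      using s(1) proper_cells[OF s(5)] proper_lcol[OF s(5)] unfolding u'_def X_iff
      by (auto intro!: PiE_I simp: PiE_iff extensional_def)
    fix k k' assume k: "k \<in> {1..n}" "k' \<in> {1..n}" "k \<noteq> k'"
    have *: "compat (target m) (v k')" if "k' \<in> {1..n}" "k' \<noteq> ?j" for k'
    proof (cases "k' = ?i")
      case True
      then show ?thesis using lind_compat[OF assms(3)] s(6) compat_sym by simp
    next
      case False
      then show ?thesis using X_compat[OF s(3), of ?j k'] that proper_lcol[OF s(5)] s by simp
    qed
    show "compat (u' k) (u' k')"
      using X_compat[OF s(1) k] *[of k'] *[of k, THEN compat_sym] k by (auto simp: u'_def)
  qed
  moreover have "t = u'(?i := target l)" using s ij by (auto simp: u'_def fun_upd_twist)
  ultimately show ?thesis using s vj ij unfolding step_def u'_def by (intro exI[of _ "v(?j := target m)"]) auto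
qed

fun walk :: "(nat \<Rightarrow> 'a + 'b) \<Rightarrow> ('a, 'b) letter list \<Rightarrow> (nat \<Rightarrow> 'a + 'b) \<Rightarrow> bool" where
  "walk v [] u \<longleftrightarrow> v \<in> X \<and> u = v"
| "walk v (l # w) u \<longleftrightarrow> (\<exists>x. step v l x \<and> walk x w u)"

lemma walk_append: "walk v (u @ w) t \<longleftrightarrow> (\<exists>x. walk v u x \<and> walk x w t)"
proof (induction u arbitrary: v)
  case Nil
  have "walk v w t \<Longrightarrow> v \<in> X" by (cases w) (auto simp: step_def)
  then show ?case by auto
qed auto

lemma walk_in_X: "walk v w u \<Longrightarrow> v \<in> X \<and> u \<in> X"
  by (induction w arbitrary: v) (auto simp: step_def)

lemma walk_det: "walk v w u \<Longrightarrow> walk v w u' \<Longrightarrow> u = u'"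
  by (induction w arbitrary: v) (auto simp: step_def)

lemma walk_ceq: "w \<asymp> w' \<Longrightarrow> walk v w u \<Longrightarrow> walk v w' u"
proof (induction arbitrary: v rule: ceq.induct)
  case (ceq_swap l m w)
  then show ?case using step_swap by (metis walk.simps(2))
qed auto

lemma walk_winv: "walk v w u \<Longrightarrow> walk u (winv w) v"
proof (induction w arbitrary: v)
  case (Cons l w)
  then obtain x where x: "step v l x" "walk x w u" by auto
  have "walk x [flip l] v" using step_flip[OF x(1)] by (auto simp: step_def)
  then show ?case using Cons.IH[OF x(2)] by (auto simp: walk_append simp del: walk.simps)
qed simp

lemma walk_mul:
  assumes "step v l x" "walk x w u"
  shows "walk v (mul l w) u"
proof (cases "del (flip l) w")
  case None
  then show ?thesis using assms by (auto simp: mul_def)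
next
  case (Some w')
  then have "walk x (flip l # w') u" using walk_ceq[OF del_imp_ceq assms(2)] by simp
  moreover have "step x (flip l) v" using step_flip assms by blast
  ultimately have "walk v w' u" by (auto simp: step_def)
  then show ?thesis using Some by (simp add: mul_def)
qed

lemma walk_nf: "walk v w u \<Longrightarrow> walk v (nf w) u"
  by (induction w arbitrary: v) (auto intro: walk_mul)

lemma walk_proper: "walk v w u \<Longrightarrow> l \<in> set w \<Longrightarrow> proper_letter l"
  by (induction w arbitrary: v) (auto simp: step_def)

section \<open>Chains of dependent letters\<close>

fun alternating :: "('a, 'b) letter \<Rightarrow> ('a, 'b) letter \<Rightarrow> bool" where
  "alternating (a, b, s) (c, d, t) \<longleftrightarrow> t = (\<not> s) \<and>
     (if s then a \<noteq> c \<and> \<not> adjacent \<Gamma>A a c else b \<noteq> d \<and> \<not> adjacent \<Gamma>B b d)"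

text \<open>If the colours agree, the second edge starts where the first one ends, so the direction
  is reversed. If they differ, three corners of the would-be square lie in the complex. With equal
  directions, the first and the last corner make the labels adjacent in both complexes. With
  opposite directions, the middle corner gives adjacency in one complex, so it fails in the other
  one, from which \<open>l\<close> departs.\<close>

lemma walk_alternating:
  assumes "walk v (l # m # w) v'" "m \<noteq> flip l" "\<not> lind l m"
  shows "alternating l m"
proof -
  obtain a b s c d t where lm: "l = (a, b, s)" "m = (c, d, t)" by (cases l; cases m)
  let ?i = "lcol l" and ?j = "lcol m"
  obtain u x where ux: "step v l u" "step u m x" using assms(1) by auto
  then have st: "v \<in> X" "u \<in> X" "x \<in> X" "v ?i = source l"
    "u = v(?i := target l)" "u ?j = source m" "x = u(?j := target m)"
    and pr: "proper_letter l" "proper_letter m"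
    unfolding step_def by blast+
  have ij: "?i \<in> {1..n}" "?j \<in> {1..n}" using pr proper_lcol by blast+
  have col: "?i = colour \<Gamma>A a" "?i = colour \<Gamma>B b" "?j = colour \<Gamma>A c" "?j = colour \<Gamma>B d"
    using pr unfolding lm proper_letter_def lcol_def by auto
  show ?thesis
  proof (cases "?i = ?j")
    case True
    then have e: "source m = target l" using st by simp
    have "\<not> adjacent \<Gamma>A a c" "\<not> adjacent \<Gamma>B b d" using colour_neq col True by metis+
    then show ?thesis using e assms(2) lm by (auto split: if_splits)
  next
    case False
    then have vj: "v ?j = source m" using st by simp
    have "compat (v ?i) (v ?j)" "compat (u ?i) (u ?j)" "compat (x ?i) (x ?j)"
      using X_compat st(1-3) ij False by blast+
    then have "compat (source l) (source m)" "compat (target l) (source m)" "compat (target l) (target m)"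
      using st vj False by auto
    moreover have "a \<noteq> c" "b \<noteq> d" using False col by auto
    ultimately show ?thesis using assms(3) lm by (auto split: if_splits)
  qed
qed

text \<open>Each peeled layer has at most \<open>n\<close> letters, as independent letters have
  different colours. The chain found in the rest starts with a letter blocked by some
  \<open>m\<close> of the layer, and \<open>m\<close> is prepended. That the head of the chain
  divides the word is the invariant that lets the next layer attach.\<close>

lemma long_word_chain:
  assumes "walk v w v'" "red w" "n * k < length w"
  shows "\<exists>c. length c = Suc k \<and> set c \<subseteq> set w \<and> successively alternating c \<and> del (hd c) w \<noteq> None"
  using assms
proof (induction k arbitrary: v w)
  case 0
  then have "w \<noteq> []" by auto
  then obtain l w' where "w = l # w'" by (meson neq_Nil_conv)
  then have "length [l] = Suc 0 \<and> set [l] \<subseteq> set w \<and> successively alternating [l] \<and> del (hd [l]) w \<noteq> None"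
    by simp
  then show ?case by blast
next
  case (Suc k)
  obtain f w' where f: "w \<asymp> f @ w'" "pairwise lind (set f)" "distinct f"
    "\<And>l. del l w' \<noteq> None \<Longrightarrow> \<exists>m\<in>set f. \<not> lind m l" using peel by blast
  have wf: "walk v (f @ w') v'" using walk_ceq[OF f(1) Suc.prems(1)] .
  have rf: "red (f @ w')" using red_ceq[OF f(1)] Suc.prems(2) by simp
  have "inj_on lcol (set f)" using f(2) lind_lcol unfolding pairwise_def inj_on_def by blast
  moreover have "lcol ` set f \<subseteq> {1..n}" using walk_proper[OF wf] proper_lcol by auto
  ultimately have "card (set f) \<le> n" by (metis card_atLeastAtMost card_inj_on_le diff_Suc_1 finite_atLeastAtMost)
  then have "length f \<le> n" using f(3) by (simp add: distinct_card)
  moreover have "length w = length f + length w'" using ceq_length[OF f(1)] by simp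
  ultimately have len: "n * k < length w'" using Suc.prems(3) by simp
  obtain x where x: "walk x w' v'" using wf by (auto simp: walk_append)
  then obtain c where c: "length c = Suc k" "set c \<subseteq> set w'" "successively alternating c" "del (hd c) w' \<noteq> None"
    using Suc.IH[OF x _ len] rf red_appendD by blast
  obtain m where m: "m \<in> set f" "\<not> lind m (hd c)" using f(4) c(4) by blast
  obtain f1 f2 where f12: "f = f1 @ m # f2" using m(1) by (meson split_list)
  obtain w'' where w'': "w' \<asymp> hd c # w''" using c(4) del_imp_ceq by (meson not_None_eq)
  have mind: "\<forall>k\<in>set f1 \<union> set f2. lind m k"
    using f(2,3) f12 unfolding pairwise_def by auto
  \<comment> \<open>\<open>m\<close> is moved to the end of its layer and \<open>hd c\<close> to the
    front of the rest, which makes them consecutive edges of one walk.\<close>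
  have "[m] @ f2 \<asymp> f2 @ [m]"
    using ceq_sym[OF ceq_move[of f2 m "[]"]] mind by auto
  then have "f @ w' \<asymp> f1 @ (f2 @ [m]) @ hd c # w''"
    unfolding f12 using w'' ceq_append[of "[m] @ f2" "f2 @ [m]" w' "hd c # w''"] ceq_append_left by simp
  then have W: "f @ w' \<asymp> (f1 @ f2) @ m # hd c # w''" by simp
  obtain y where y: "walk y (m # hd c # w'') v'" using walk_ceq[OF W wf] unfolding walk_append by blast
  have "red (m # hd c # w'')" using red_ceq[OF W] rf red_appendD by blast
  then have "hd c \<noteq> flip m" by auto
  then have alt: "alternating m (hd c)" using walk_alternating[OF y] m(2) by blast
  have "del m w \<noteq> None"
  proof -
    have "f @ w' = f1 @ m # (f2 @ w')" using f12 by simp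
    then have "del m (f @ w') \<noteq> None" unfolding del_Some_iff using mind by blast
    then show ?thesis using del_ceq_None[OF f(1), of m] by simp
  qed
  moreover have "set (m # c) \<subseteq> set w" using ceq_set[OF f(1)] m(1) c(2) by auto
  moreover have "successively alternating (m # c)" using c(1,3) alt by (cases c) auto
  ultimately show ?case using c(1) by (intro exI[of _ "m # c"]) auto
qed

end

section \<open>Flat squares and the forbidden grid\<close>

lemma flat_square_of_pairs:
  assumes "adjacent \<Gamma> p r" "adjacent \<Gamma> p r'" "adjacent \<Gamma> p' r" "adjacent \<Gamma> p' r'"
    "p \<noteq> p'" "\<not> adjacent \<Gamma> p p'" "r \<noteq> r'" "\<not> adjacent \<Gamma> r r'"
  shows "flat_square \<Gamma> ((!) [p, r, p', r'])"
proof -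
  have sym: "adjacent \<Gamma> u v \<Longrightarrow> adjacent \<Gamma> v u" for u v by (auto simp: adjacent_def insert_commute)
  have neq: "adjacent \<Gamma> u v \<Longrightarrow> u \<noteq> v" for u v by (auto simp: adjacent_def)
  have four: "{..<4::nat} = {0, 1, 2, 3}" by auto
  have all: "(\<forall>j<4::nat. P j) \<longleftrightarrow> P 0 \<and> P 1 \<and> P 2 \<and> P 3" for P
    by (auto simp: numeral_eq_Suc less_Suc_eq)
  have "inj_on ((!) [p, r, p', r']) {..<4}"
    unfolding four using assms(5,7) neq[OF assms(1)] neq[OF assms(2)] neq[OF assms(3)] neq[OF assms(4)]
    by (auto simp: inj_on_def)
  moreover have "\<not> adjacent \<Gamma> p' p" "\<not> adjacent \<Gamma> r' r" using assms(6,8) sym by blast+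
  ultimately show ?thesis unfolding flat_square_def square_def all
    using assms sym[OF assms(2)] sym[OF assms(1)] sym[OF assms(3)] sym[OF assms(4)] by simp
qed

lemma flat_square_with_colours_of_pairs:
  assumes "adjacent \<Gamma> p r" "adjacent \<Gamma> p r'" "adjacent \<Gamma> p' r" "adjacent \<Gamma> p' r'"
    "p \<noteq> p'" "\<not> adjacent \<Gamma> p p'" "r \<noteq> r'" "\<not> adjacent \<Gamma> r r'"
  shows "flat_square_with_colours \<Gamma> (colour \<Gamma> p) (colour \<Gamma> r)"
  unfolding flat_square_with_colours_def
  using flat_square_of_pairs[OF assms] by (intro exI[of _ "(!) [p, r, p', r']"] conjI exI[of _ 0]) auto

text \<open>The inner square on \<open>p 1\<close>, \<open>r 1\<close>, \<open>p 2\<close>,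
  \<open>r 2\<close> is flat in \<open>\<Gamma>\<close>. Each of its edges has the colours of an
  edge of a flat square of \<open>\<Gamma>'\<close>, completed by the outer partners: index 0 for 1
  and index 3 for 2. So none of the four edges can be the one that largeness demands.\<close>

lemma no_flat_grid:
  assumes large: "five_large_relative_to \<Gamma> \<Gamma>'"
    and adj: "\<And>i j. \<lbrakk>i < 4; j < 4\<rbrakk> \<Longrightarrow> adjacent \<Gamma> (p i) (r j) \<and> adjacent \<Gamma>' (p' i) (r' j)"
    and far: "p 1 \<noteq> p 2" "\<not> adjacent \<Gamma> (p 1) (p 2)" "r 1 \<noteq> r 2" "\<not> adjacent \<Gamma> (r 1) (r 2)"
    and far': "p' 0 \<noteq> p' 1" "\<not> adjacent \<Gamma>' (p' 0) (p' 1)" "r' 0 \<noteq> r' 1" "\<not> adjacent \<Gamma>' (r' 0) (r' 1)"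
      "p' 2 \<noteq> p' 3" "\<not> adjacent \<Gamma>' (p' 2) (p' 3)" "r' 2 \<noteq> r' 3" "\<not> adjacent \<Gamma>' (r' 2) (r' 3)"
    and col: "\<And>i. i < (4::nat) \<Longrightarrow> colour \<Gamma> (p i) = colour \<Gamma>' (p' i) \<and> colour \<Gamma> (r i) = colour \<Gamma>' (r' i)"
  shows False
proof -
  have sym: "adjacent \<Gamma>' u v \<Longrightarrow> adjacent \<Gamma>' v u" for u v by (auto simp: adjacent_def insert_commute)
  have "flat_square \<Gamma> ((!) [p 1, r 1, p 2, r 2])"
    by (intro flat_square_of_pairs far) (use adj in auto)
  then obtain j where j: "j < 4" "\<not> flat_square_with_colours \<Gamma>' (colour \<Gamma> ([p 1, r 1, p 2, r 2] ! j))
      (colour \<Gamma> ([p 1, r 1, p 2, r 2] ! ((j + 1) mod 4)))"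
    using large unfolding five_large_relative_to_def by blast
  have fl: "flat_square_with_colours \<Gamma>' (colour \<Gamma>' (p' i)) (colour \<Gamma>' (r' k))
     \<and> flat_square_with_colours \<Gamma>' (colour \<Gamma>' (r' k)) (colour \<Gamma>' (p' i))"
    if ik: "i = 1 \<and> i' = 0 \<or> i = 2 \<and> i' = 3" "k = 1 \<and> k' = 0 \<or> k = 2 \<and> k' = 3" for i i' k k' :: nat
  proof -
    have lt: "i < 4" "i' < 4" "k < 4" "k' < 4" using ik by auto
    have f: "p' i \<noteq> p' i'" "\<not> adjacent \<Gamma>' (p' i) (p' i')" "r' k \<noteq> r' k'" "\<not> adjacent \<Gamma>' (r' k) (r' k')"
      using ik far' sym by auto
    have f': "\<not> adjacent \<Gamma>' (p' i') (p' i)" "\<not> adjacent \<Gamma>' (r' k') (r' k)" using f sym by blast+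
    show ?thesis
      using adj lt sym f f' by (intro conjI flat_square_with_colours_of_pairs[where p' = "p' i'" and r' = "r' k'"]
        flat_square_with_colours_of_pairs[where p' = "r' k'" and r' = "p' i'"]) auto
  qed
  consider "j = 0" | "j = 1" | "j = 2" | "j = 3" using j(1) by linarith
  then show False
    using j(2) fl[of 1 0 1 0] fl[of 1 0 2 3] fl[of 2 3 1 0] fl[of 2 3 2 3] col[of 1] col[of 2]
    by cases simp_all
qed

locale large_coloured_pair = coloured_pair n \<Gamma>A \<Gamma>B
  for n :: nat and \<Gamma>A :: "'a coloured_complex" and \<Gamma>B :: "'b coloured_complex" +
  assumes large: "pairwise_5_large \<Gamma>A \<Gamma>B"
begin

text \<open>The nonadjacent consecutive pairs of an alternating chain lie in the two complexes by
  turns. Equal signs at index 1 put the middle pairs of both chains into the same complex and the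
  outer pairs into the other, which is the excluded grid; the sign decides which complex contains
  the inner square.\<close>

lemma no_grid:
  assumes c: "length c = 4" "successively alternating c" and e: "length e = 4" "successively alternating e"
    and ind: "\<And>l m. \<lbrakk>l \<in> set c; m \<in> set e\<rbrakk> \<Longrightarrow> lind l m"
    and proper: "\<And>l. l \<in> set c \<union> set e \<Longrightarrow> proper_letter l"
    and sgn: "snd (snd (c ! 1)) = snd (snd (e ! 1))"
  shows False
proof -
  let ?a = "\<lambda>l::('a, 'b) letter. fst l" and ?b = "\<lambda>l::('a, 'b) letter. fst (snd l)"
  have alt: "alternating (w ! i) (w ! Suc i)" if "length w = 4" "successively alternating w" "i < 3" for w i
    using that by (simp add: successively_conv_nth)
  have L: "w ! i \<in> set w" if "length w = 4" "i < 4" for w :: "('a, 'b) letter list" and i using that by simp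
  have indn: "adjacent \<Gamma>A (?a (c ! i)) (?a (e ! j)) \<and> adjacent \<Gamma>B (?b (c ! i)) (?b (e ! j))" if "i < 4" "j < 4" for i j
    using ind[OF L[OF c(1) that(1)] L[OF e(1) that(2)]] by (cases "c ! i"; cases "e ! j") auto
  have coln: "colour \<Gamma>A (?a (c ! i)) = colour \<Gamma>B (?b (c ! i)) \<and> colour \<Gamma>A (?a (e ! i)) = colour \<Gamma>B (?b (e ! i))"
    if "i < 4" for i
    using proper L[OF c(1) that] L[OF e(1) that] unfolding proper_letter_def by blast
  have altp: "(snd (snd (w ! Suc i)) = (\<not> snd (snd (w ! i)))) \<and>
     (if snd (snd (w ! i)) then ?a (w ! i) \<noteq> ?a (w ! Suc i) \<and> \<not> adjacent \<Gamma>A (?a (w ! i)) (?a (w ! Suc i))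
      else ?b (w ! i) \<noteq> ?b (w ! Suc i) \<and> \<not> adjacent \<Gamma>B (?b (w ! i)) (?b (w ! Suc i)))"
    if "length w = 4" "successively alternating w" "i < 3" for w i
    using alt[OF that] by (cases "w ! i"; cases "w ! Suc i") auto
  note ac = altp[OF c, of 0] altp[OF c, of 1] altp[OF c, of 2]
  note ae = altp[OF e, of 0] altp[OF e, of 1] altp[OF e, of 2]
  show False
  proof (cases "snd (snd (c ! 1))")
    case True
    have "five_large_relative_to \<Gamma>A \<Gamma>B" using large by (simp add: pairwise_5_large_def)
    then show False
      by (rule no_flat_grid[where p = "\<lambda>i. ?a (c ! i)" and p' = "\<lambda>i. ?b (c ! i)"
            and r = "\<lambda>i. ?a (e ! i)" and r' = "\<lambda>i. ?b (e ! i)"])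
        (use True sgn ac ae indn coln in \<open>auto simp: numeral_eq_Suc\<close>)
  next
    case False
    have "five_large_relative_to \<Gamma>B \<Gamma>A" using large by (simp add: pairwise_5_large_def)
    then show False
      by (rule no_flat_grid[where p = "\<lambda>i. ?b (c ! i)" and p' = "\<lambda>i. ?a (c ! i)"
            and r = "\<lambda>i. ?b (e ! i)" and r' = "\<lambda>i. ?a (e ! i)"])
        (use False sgn ac ae indn coln in \<open>auto simp: numeral_eq_Suc\<close>)
  qed
qed

text \<open>Otherwise both words contain chains of five letters. The first four letters of one chain
  match, in the sign at index 1, either the first four or the last four letters of the
  other.\<close>

lemma no_thick_product:
  assumes "walk v u v'" "walk x w x'" "red u" "red w" "\<forall>l\<in>set u. \<forall>m\<in>set w. lind l m"
  shows "length u \<le> 4 * n \<or> length w \<le> 4 * n"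
proof (rule ccontr)
  assume "\<not> ?thesis"
  then have "n * 4 < length u" "n * 4 < length w" by auto
  then obtain c e where c: "length c = 5" "set c \<subseteq> set u" "successively alternating c"
    and e: "length e = 5" "set e \<subseteq> set w" "successively alternating e"
    using long_word_chain assms by (metis Suc_numeral add_One_commute semiring_norm(2,8) add_num_simps(2))
  obtain e0 e1 e2 e3 e4 where ee: "e = [e0, e1, e2, e3, e4]"
    using e(1) by (auto simp: numeral_eq_Suc length_Suc_conv)
  obtain c0 c1 c2 c3 c4 where cc: "c = [c0, c1, c2, c3, c4]"
    using c(1) by (auto simp: numeral_eq_Suc length_Suc_conv)
  have *: "False" if "snd (snd c1) = snd (snd (f ! 1))" "set f \<subseteq> set e" "length f = 4" "successively alternating f" for f
  proof (rule no_grid[of "[c0, c1, c2, c3]" f])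
    show "\<And>l m. \<lbrakk>l \<in> set [c0, c1, c2, c3]; m \<in> set f\<rbrakk> \<Longrightarrow> lind l m"
      using assms(5) c(2) e(2) that(2) unfolding cc by auto
    show "\<And>l. l \<in> set [c0, c1, c2, c3] \<union> set f \<Longrightarrow> proper_letter l"
      using walk_proper[OF assms(1)] walk_proper[OF assms(2)] c(2) e(2) that(2) unfolding cc by auto
  qed (use that c cc in auto)
  have "snd (snd e2) = (\<not> snd (snd e1))" using e(3) unfolding ee by (cases e1; cases e2) auto
  then consider "snd (snd c1) = snd (snd e1)" | "snd (snd c1) = snd (snd e2)" by blast
  then show False
  proof cases
    case 1
    then show False using *[of "[e0, e1, e2, e3]"] e(3) unfolding ee by auto
  next
    case 2
    then show False using *[of "[e1, e2, e3, e4]"] e(3) unfolding ee by auto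
  qed
qed

text \<open>All words are rewritten as seen from \<open>p\<close>. The gates \<open>p @ u\<close>
  and \<open>p @ t\<close> on the other two intervals belong to independent \<open>u\<close> and
  \<open>t\<close>, one of which is short; that gate is the point \<open>q\<close>.\<close>

lemma thin_intervals:
  assumes p: "walk v p s" and x: "walk v x sx" and y: "walk v y sy" and z: "walk v z sz"
    and geo: "wdist x p + wdist p y = wdist x y"
  shows "\<exists>q t. walk v q t \<and> wdist p q \<le> 4 * n \<and>
    (wdist x q + wdist q z = wdist x z \<or> wdist z q + wdist q y = wdist z y)"
proof -
  define r where "r w = nf (winv p @ w)" for w
  have red: "red (r w)" for w by (simp add: r_def)
  have rg: "r w \<sim> winv p @ w" for w unfolding r_def by (rule geq_nf)
  have rl: "length (r w) = wdist p w" for w by (simp add: r_def wdist_def wnorm_def)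
  have rw: "walk s (r w) t" if "walk v w t" for w t
    unfolding r_def using walk_nf walk_winv[OF p] that walk_append by blast
  have rd: "wnorm (winv (r w) @ r w') = wdist w w'" for w w'
  proof -
    have "wnorm (winv (r w) @ r w') = wdist (winv p @ w) (winv p @ w')"
      using wdist_geq[OF rg rg] by (simp add: wdist_def)
    then show ?thesis by (simp only: wdist_append_left)
  qed
  have geo': "wnorm (winv (r x) @ r y) = length (r x) + length (r y)"
    using geo wdist_commute[of x p] by (simp add: rd rl)
  obtain u x' z' t y' z'' where m: "r x \<asymp> u @ x'" "r z \<asymp> u @ z'" "r y \<asymp> t @ y'" "r z \<asymp> t @ z''"
    "wnorm (winv (r x) @ r z) = length x' + length z'" "wnorm (winv (r y) @ r z) = length y' + length z''"
    "\<forall>l\<in>set u. \<forall>m\<in>set t. lind l m"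
    using interval_meets[OF red red red geo'] by blast
  have ru: "red u" "red t" using m(1,3) red_ceq red red_appendD by blast+
  obtain su where su: "walk s u su" using walk_ceq[OF m(1) rw[OF x]] by (auto simp: walk_append)
  obtain st where st: "walk s t st" using walk_ceq[OF m(3) rw[OF y]] by (auto simp: walk_append)
  have short: "length u \<le> 4 * n \<or> length t \<le> 4 * n" using no_thick_product[OF su st ru m(7)] .
  have pq: "wdist p (p @ u) \<le> length u" for u
    using wdist_append_left[of p "[]" u] wnorm_le[of u] by (simp add: wdist_def)
  have le: "wdist w (p @ u) \<le> length w'" if "r w \<asymp> u @ w'" for w u w'
  proof -
    have "p @ r w \<sim> p @ winv p @ w" by (intro geq_append_left rg)
    also have "\<dots> \<sim> w" by (rule geq_winv_right)
    finally have "w \<sim> p @ r w" by (rule geq_sym)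
    also have "\<dots> \<sim> p @ u @ w'" using that by (intro geq_append_left ceq_imp_geq)
    finally have "wdist w (p @ u) = wdist (p @ u @ w') (p @ u)" by (intro wdist_geq geq_refl)
    also have "\<dots> = wdist w' []" using wdist_append_left[of "p @ u" w' "[]"] by simp
    also have "\<dots> \<le> length w'" using wnorm_le[of "winv w'"] by (simp add: wdist_def)
    finally show ?thesis .
  qed
  show ?thesis
    using short
  proof
    assume u: "length u \<le> 4 * n"
    have "wdist x (p @ u) + wdist (p @ u) z \<le> wdist x z"
      using le[OF m(1)] le[OF m(2)] m(5) wdist_commute[of z "p @ u"] unfolding rd by linarith
    then have "wdist x (p @ u) + wdist (p @ u) z = wdist x z"
      using wdist_triangle[of x z "p @ u"] by linarith
    moreover have "walk v (p @ u) su" using p su walk_append by blast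
    ultimately show ?thesis using pq[of u] u le_trans by blast
  next
    assume t: "length t \<le> 4 * n"
    have "wdist z (p @ t) + wdist (p @ t) y \<le> wdist z y"
      using le[OF m(3)] le[OF m(4)] m(6) wdist_commute[of y "p @ t"] wdist_commute[of y z] unfolding rd by linarith
    then have "wdist z (p @ t) + wdist (p @ t) y = wdist z y"
      using wdist_triangle[of z y "p @ t"] by linarith
    moreover have "walk v (p @ t) st" using p st walk_append by blast
    ultimately show ?thesis using pq[of t] t le_trans by blast
  qed
qed

end

subsection \<open>Hyperbolicity from words\<close>

locale word_metric =
  fixes G :: "('g, 'm) monoid_scheme" (structure) and S :: "'g set"
  assumes grp: "group G" and S_carrier: "S \<subseteq> carrier G"
    and S_inv: "g \<in> S \<Longrightarrow> inv g \<in> S"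
begin

interpretation group G by (rule grp)

definition wd :: "'g list \<Rightarrow> 'g" where
  "wd ws = foldr (mult G) ws \<one>"

text \<open>Exactly \<open>k\<close> generators, neither at most \<open>k\<close> nor a least
  number: in this form spellings can be multiplied, inverted and cut, and minimality enters only
  through \<open>word_length\<close>.\<close>

definition spelled :: "nat \<Rightarrow> 'g \<Rightarrow> bool" where
  "spelled k g \<longleftrightarrow> (\<exists>ws. length ws = k \<and> set ws \<subseteq> S \<and> wd ws = g)"

lemma S_Un: "S \<union> m_inv G ` S = S"
  using S_inv by auto

lemma word_length_eq: "word_length G S g = (LEAST k. spelled k g)"
  unfolding word_length_def spelled_def S_Un wd_def by simp

lemma wd_closed: "set ws \<subseteq> S \<Longrightarrow> wd ws \<in> carrier G"
  unfolding wd_def using S_carrier by (induction ws) auto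

lemma wd_append: "set us \<subseteq> S \<Longrightarrow> set ws \<subseteq> S \<Longrightarrow> wd (us @ ws) = wd us \<otimes> wd ws"
proof (induction us)
  case Nil
  then show ?case using wd_closed[of ws] by (simp add: wd_def)
next
  case (Cons g us)
  then show ?case using wd_closed[of ws] wd_closed[of us] S_carrier by (auto simp: wd_def m_assoc)
qed

lemma spelled_closed: "spelled k g \<Longrightarrow> g \<in> carrier G"
  using wd_closed by (auto simp: spelled_def)

lemma spelled_mult: "spelled k g \<Longrightarrow> spelled j h \<Longrightarrow> spelled (k + j) (g \<otimes> h)"
proof -
  assume "spelled k g" "spelled j h"
  then obtain us ws where "length us = k" "set us \<subseteq> S" "wd us = g" "length ws = j" "set ws \<subseteq> S" "wd ws = h"
    unfolding spelled_def by blast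
  then have "length (us @ ws) = k + j \<and> set (us @ ws) \<subseteq> S \<and> wd (us @ ws) = g \<otimes> h"
    using wd_append by simp
  then show ?thesis unfolding spelled_def by blast
qed

lemma spelled_one: "spelled 0 \<one>"
  by (auto simp: spelled_def wd_def)

lemma spelled_gen: "g \<in> S \<Longrightarrow> spelled 1 g"
  unfolding spelled_def wd_def using S_carrier by (intro exI[of _ "[g]"]) auto

lemma spelled_inv: "spelled k g \<Longrightarrow> spelled k (inv g)"
proof -
  have "spelled (length ws) (inv (wd ws))" if "set ws \<subseteq> S" for ws
    using that
  proof (induction ws)
    case Nil
    then show ?case using spelled_one by (simp add: wd_def)
  next
    case (Cons g ws)
    have "spelled (length ws + 1) (inv (wd ws) \<otimes> inv g)"
      using Cons by (intro spelled_mult spelled_gen S_inv) auto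
    moreover have "inv (wd (g # ws)) = inv (wd ws) \<otimes> inv g"
      using inv_mult_group[of g "wd ws"] wd_closed[of ws] Cons.prems S_carrier by (auto simp: wd_def)
    ultimately show ?case by simp
  qed
  then show "spelled k g \<Longrightarrow> spelled k (inv g)" by (auto simp: spelled_def)
qed

lemma spelled_split: "spelled (k + j) g \<Longrightarrow> \<exists>h h'. spelled k h \<and> spelled j h' \<and> g = h \<otimes> h'"
proof -
  assume "spelled (k + j) g"
  then obtain ws where ws: "length ws = k + j" "set ws \<subseteq> S" "wd ws = g" unfolding spelled_def by blast
  let ?u = "take k ws" and ?w = "drop k ws"
  have sub: "set ?u \<subseteq> S" "set ?w \<subseteq> S" using ws(2) set_take_subset set_drop_subset by fastforce+
  then have "g = wd ?u \<otimes> wd ?w" using wd_append[OF sub] ws(3) by simp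
  moreover have "spelled k (wd ?u)" "spelled j (wd ?w)"
    unfolding spelled_def using ws(1) sub by (auto intro: exI[of _ ?u] exI[of _ ?w])
  ultimately show ?thesis by blast
qed

lemma word_length_le: "spelled k g \<Longrightarrow> word_length G S g \<le> k"
  unfolding word_length_eq by (rule Least_le)

definition wdst :: "'g \<Rightarrow> 'g \<Rightarrow> nat" where
  "wdst g h = word_length G S (inv g \<otimes> h)"

end

text \<open>Separate from \<open>word_metric\<close> because the existence of spellings is itself
  proved with the rules for \<open>spelled\<close>.\<close>

locale generating_word_metric = word_metric +
  assumes spelled_ex: "g \<in> carrier G \<Longrightarrow> \<exists>k. spelled k g"
begin

interpretation group G by (rule grp)

lemma spelled_word_length: "g \<in> carrier G \<Longrightarrow> spelled (word_length G S g) g"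
  unfolding word_length_eq using spelled_ex by (meson LeastI_ex)

lemma generate_eq: "generate G S = carrier G"
proof
  show "generate G S \<subseteq> carrier G" using generate_incl[OF S_carrier] .
  have "set ws \<subseteq> S \<Longrightarrow> wd ws \<in> generate G S" for ws
    by (induction ws) (auto simp: wd_def intro: generate.intros)
  then show "carrier G \<subseteq> generate G S" using spelled_ex unfolding spelled_def by blast
qed

lemma wdst_self: "g \<in> carrier G \<Longrightarrow> wdst g g = 0"
  using word_length_le[OF spelled_one] by (simp add: wdst_def)

lemma wdst_le_sym: "g \<in> carrier G \<Longrightarrow> h \<in> carrier G \<Longrightarrow> wdst g h \<le> wdst h g"
  unfolding wdst_def
  using word_length_le[OF spelled_inv[OF spelled_word_length[of "inv h \<otimes> g"]]] inv_mult_group[of "inv h" g]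
  by simp

lemma wdst_sym: "g \<in> carrier G \<Longrightarrow> h \<in> carrier G \<Longrightarrow> wdst g h = wdst h g"
  using wdst_le_sym by (simp add: antisym)

lemma wdst_tri:
  assumes "g \<in> carrier G" "h \<in> carrier G" "k \<in> carrier G"
  shows "wdst g k \<le> wdst g h + wdst h k"
proof -
  have "spelled (wdst g h + wdst h k) ((inv g \<otimes> h) \<otimes> (inv h \<otimes> k))"
    unfolding wdst_def using assms by (intro spelled_mult spelled_word_length) auto
  moreover have "(inv g \<otimes> h) \<otimes> (inv h \<otimes> k) = inv g \<otimes> k"
  proof -
    have "h \<otimes> (inv h \<otimes> k) = k" using assms by (simp flip: m_assoc)
    then show ?thesis using assms by (simp add: m_assoc)
  qed
  ultimately show ?thesis unfolding wdst_def[of g k] using word_length_le by simp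
qed

lemma wdst_geodesic:
  assumes "g \<in> carrier G" "h \<in> carrier G" "k \<le> wdst g h"
  shows "\<exists>z\<in>carrier G. wdst g z = k \<and> wdst z h = wdst g h - k"
proof -
  have "spelled (k + (wdst g h - k)) (inv g \<otimes> h)"
    using spelled_word_length[of "inv g \<otimes> h"] assms by (simp add: wdst_def)
  then obtain u u' where u: "spelled k u" "spelled (wdst g h - k) u'" "inv g \<otimes> h = u \<otimes> u'"
    using spelled_split by blast
  have c: "u \<in> carrier G" "u' \<in> carrier G" using u spelled_closed by auto
  let ?z = "g \<otimes> u"
  have z: "?z \<in> carrier G" using assms c by simp
  have a: "inv g \<otimes> ?z = u" using assms c by (simp flip: m_assoc)
  have "g \<otimes> (u \<otimes> u') = h" using u(3) assms by (simp flip: u(3) m_assoc)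
  then have "?z \<otimes> u' = h" using assms c by (simp add: m_assoc)
  then have "inv ?z \<otimes> h = inv ?z \<otimes> (?z \<otimes> u')" by simp
  also have "\<dots> = u'" using z c by (subst m_assoc[symmetric]) auto
  finally have b: "inv ?z \<otimes> h = u'" .
  have "wdst g ?z \<le> k" "wdst ?z h \<le> wdst g h - k"
    using word_length_le u a b by (auto simp: wdst_def)
  moreover have "wdst g h \<le> wdst g ?z + wdst ?z h" using wdst_tri assms z by blast
  ultimately show ?thesis using z assms(3) by (intro bexI[of _ ?z]) auto
qed

end

section \<open>Closed words and the Cayley graph\<close>

context large_coloured_pair
begin

text \<open>The map \<open>\<rho>\<close> identifies the group with the closed words at
  \<open>v0\<close> modulo \<open>geq\<close>. The word distance \<open>W\<close> is compared with
  the Cayley distance by three facts: it is an upper bound, and Cayley distance at most 1 means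
  exactly that \<open>W\<close> is at most \<open>R\<close>.\<close>

lemma hyperbolic_group_of_words:
  fixes G :: "('g, 'm) monoid_scheme" (structure) and \<rho> :: "'g \<Rightarrow> ('a, 'b) letter list"
  assumes grp: "group G" and v0: "v0 \<in> X"
    and rho_walk: "\<And>g. g \<in> carrier G \<Longrightarrow> walk v0 (\<rho> g) v0"
    and rho_mult: "\<And>g h. \<lbrakk>g \<in> carrier G; h \<in> carrier G\<rbrakk> \<Longrightarrow> \<rho> (g \<otimes> h) \<sim> \<rho> g @ \<rho> h"
    and rho_inj: "\<And>g h. \<lbrakk>g \<in> carrier G; h \<in> carrier G; \<rho> g \<sim> \<rho> h\<rbrakk> \<Longrightarrow> g = h"
    and rho_onto: "\<And>w. walk v0 w v0 \<Longrightarrow> \<exists>g\<in>carrier G. \<rho> g \<sim> w"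
  shows "hyperbolic_group G"
proof -
  interpret group G by (rule grp)
  define W where "W g h = wdist (\<rho> g) (\<rho> h)" for g h
  have rho_one: "\<rho> \<one> \<sim> []"
  proof -
    have "\<rho> \<one> \<sim> \<rho> \<one> @ \<rho> \<one>" using rho_mult[of \<one> \<one>] by simp
    then have "winv (\<rho> \<one>) @ \<rho> \<one> \<sim> winv (\<rho> \<one>) @ \<rho> \<one> @ \<rho> \<one>" by (rule geq_append_left)
    then have "[] \<sim> winv (\<rho> \<one>) @ \<rho> \<one> @ \<rho> \<one>" using geq_winv_left[of "\<rho> \<one>" "[]"] geq_sym geq_trans by (metis append_Nil2)
    also have "\<dots> \<sim> \<rho> \<one>" by (rule geq_winv_left)
    finally show ?thesis by (rule geq_sym)
  qed
  have rho_inv_mult: "\<rho> (inv g \<otimes> h) \<sim> winv (\<rho> g) @ \<rho> h" if gh: "g \<in> carrier G" "h \<in> carrier G" for g h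
  proof -
    have "g \<otimes> (inv g \<otimes> h) = h" using gh by (simp flip: m_assoc)
    then have "\<rho> h \<sim> \<rho> g @ \<rho> (inv g \<otimes> h)" using rho_mult[of g "inv g \<otimes> h"] gh by simp
    then have "winv (\<rho> g) @ \<rho> h \<sim> winv (\<rho> g) @ \<rho> g @ \<rho> (inv g \<otimes> h)" by (rule geq_append_left)
    also have "\<dots> \<sim> \<rho> (inv g \<otimes> h)" by (rule geq_winv_left)
    finally show ?thesis by (rule geq_sym)
  qed
  have "\<exists>c. (\<exists>w. walk v0 w s) \<longrightarrow> walk s c v0 \<and> (s = v0 \<longrightarrow> c = [])" for s
  proof (cases "s = v0")
    case True
    then show ?thesis using v0 by (intro exI[of _ "[]"]) auto
  qed (use walk_winv in blast)
  \<comment> \<open>The return word at \<open>v0\<close> is empty, so closing up a word that is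
    already closed does not change it; the chain constructed below therefore ends exactly in
    \<open>x\<close> and \<open>y\<close>.\<close>
  then obtain ret where ret: "\<And>s w. walk v0 w s \<Longrightarrow> walk s (ret s) v0" "ret v0 = []"
    using v0 by (metis walk.simps(1))
  define D0 where "D0 = Max ((\<lambda>s. length (ret s)) ` X)"
  have D0: "length (ret s) \<le> D0" if "s \<in> X" for s
    unfolding D0_def using finite_X that by (intro Max_ge) auto
  \<comment> \<open>The length of one edge together with the return words at its two ends.\<close>
  define R where "R = 2 * D0 + 1"
  define S where "S = {g \<in> carrier G. wnorm (\<rho> g) \<le> R}"
  have "finite S"
  proof -
    let ?\<Lambda> = "vertices \<Gamma>A \<times> vertices \<Gamma>B \<times> (UNIV :: bool set)"
    have "finite ?\<Lambda>" using complexA complexB by (auto simp: coloured_simplicial_complex_def)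
    then have "finite {xs. set xs \<subseteq> ?\<Lambda> \<and> length xs \<le> R}" by (rule finite_lists_length_le)
    moreover have "(\<lambda>g. nf (\<rho> g)) ` S \<subseteq> {xs. set xs \<subseteq> ?\<Lambda> \<and> length xs \<le> R}"
    proof clarify
      fix g assume g: "g \<in> S"
      then have "walk v0 (nf (\<rho> g)) v0" using rho_walk walk_nf by (simp add: S_def)
      then have "proper_letter l" if "l \<in> set (nf (\<rho> g))" for l using walk_proper that by blast
      then have "set (nf (\<rho> g)) \<subseteq> ?\<Lambda>" unfolding proper_letter_def by (auto simp: mem_Times_iff)
      then show "set (nf (\<rho> g)) \<subseteq> ?\<Lambda> \<and> length (nf (\<rho> g)) \<le> R" using g by (simp add: S_def wnorm_def)
    qed
    moreover have "inj_on (\<lambda>g. nf (\<rho> g)) S"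
    proof (rule inj_onI)
      fix g h assume "g \<in> S" "h \<in> S" "nf (\<rho> g) = nf (\<rho> h)"
      moreover from this have "\<rho> g \<sim> \<rho> h" using geq_nf geq_nf' geq_trans by metis
      ultimately show "g = h" using rho_inj by (simp add: S_def)
    qed
    ultimately show ?thesis by (meson finite_subset finite_imageD)
  qed
  have wm: "word_metric G S"
  proof (rule word_metric.intro)
    show "group G" by (rule grp)
    show "S \<subseteq> carrier G" by (auto simp: S_def)
    fix g assume g: "g \<in> S"
    have "\<rho> (inv g) \<sim> winv (\<rho> g) @ \<rho> \<one>" using rho_inv_mult[of g \<one>] g by (simp add: S_def)
    also have "\<dots> \<sim> winv (\<rho> g) @ []" using rho_one by (rule geq_append_left)
    finally have "wnorm (\<rho> (inv g)) = wnorm (\<rho> g)" using wnorm_geq wnorm_winv by simp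
    then show "inv g \<in> S" using g by (simp add: S_def)
  qed
  then interpret wm: word_metric G S .
  \<comment> \<open>Each prefix is closed up by its return word; extending it by one edge multiplies
    the group element by a generator.\<close>
  have spell: "wm.spelled (length w) g"
    if "walk v0 w s" "g \<in> carrier G" "\<rho> g \<sim> w @ ret s" for w s g
    using that
  proof (induction w arbitrary: s g rule: rev_induct)
    case Nil
    then have "\<rho> g \<sim> []" using ret(2) by simp
    then have "\<rho> g \<sim> \<rho> \<one>" using rho_one geq_sym geq_trans by blast
    then have "g = \<one>" using rho_inj Nil by simp
    then show ?case using wm.spelled_one by simp
  next
    case (snoc l w)
    obtain s1 where s1: "walk v0 w s1" "walk s1 [l] s" using snoc.prems(1) by (auto simp: walk_append)
    note r = ret(1)[OF s1(1)] ret(1)[OF snoc.prems(1)]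
    have "walk v0 (w @ ret s1) v0" using s1 r walk_append by blast
    then obtain g1 where g1: "g1 \<in> carrier G" "\<rho> g1 \<sim> w @ ret s1" using rho_onto by blast
    have sp: "wm.spelled (length w) g1" using snoc.IH[OF s1(1) g1] .
    let ?h = "inv g1 \<otimes> g"
    have "\<rho> ?h \<sim> winv (\<rho> g1) @ \<rho> g" using rho_inv_mult g1 snoc.prems by blast
    also have "\<dots> \<sim> winv (w @ ret s1) @ (w @ [l]) @ ret s"
      using g1 snoc.prems by (intro geq_append geq_winv) auto
    also have "\<dots> \<sim> winv (ret s1) @ [l] @ ret s" by (simp add: geq_append_left geq_winv_left)
    finally have "wnorm (\<rho> ?h) \<le> length (winv (ret s1) @ [l] @ ret s)" using wnorm_geq wnorm_le by metis
    also have "\<dots> \<le> R" using D0[of s1] D0[of s] walk_in_X[OF s1(1)] walk_in_X[OF s1(2)] by (simp add: R_def)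
    finally have "?h \<in> S" using g1 snoc.prems by (simp add: S_def)
    then have "wm.spelled (length w + 1) (g1 \<otimes> ?h)" using sp by (intro wm.spelled_mult wm.spelled_gen)
    moreover have "g1 \<otimes> ?h = g" using g1 snoc.prems by (simp flip: m_assoc)
    ultimately show ?case by simp
  qed
  have spell': "wm.spelled (wnorm (\<rho> g)) g" if "g \<in> carrier G" for g
    unfolding wnorm_def using spell[OF walk_nf[OF rho_walk[OF that]] that] ret(2) geq_nf' by simp
  then interpret gm: generating_word_metric G S
    by unfold_locales blast
  have d_le_W: "wm.wdst g h \<le> W g h" if gh: "g \<in> carrier G" "h \<in> carrier G" for g h
  proof -
    have "wm.wdst g h \<le> wnorm (\<rho> (inv g \<otimes> h))"
      unfolding wm.wdst_def using wm.word_length_le[OF spell'] gh by simp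
    also have "\<dots> = W g h" unfolding W_def wdist_def using wnorm_geq[OF rho_inv_mult[OF gh]] .
    finally show ?thesis .
  qed
  have d1_W: "W g h \<le> R" if gh: "g \<in> carrier G" "h \<in> carrier G" "wm.wdst g h \<le> 1" for g h
  proof -
    have "wm.spelled (wm.wdst g h) (inv g \<otimes> h)"
      unfolding wm.wdst_def using gh by (intro gm.spelled_word_length) auto
    then obtain ws where "length ws = wm.wdst g h" and ws: "set ws \<subseteq> S" "wm.wd ws = inv g \<otimes> h"
      unfolding wm.spelled_def by blast
    then have len: "length ws \<le> 1" using gh(3) by simp
    have "wnorm (\<rho> (inv g \<otimes> h)) \<le> R"
    proof (cases ws)
      case Nil
      then have "inv g \<otimes> h = \<one>" using ws(2) by (simp add: wm.wd_def)
      then show ?thesis using wnorm_geq[OF rho_one] by (simp add: wnorm_def)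
    next
      case (Cons k vs)
      then have "ws = [k]" using len by simp
      moreover have "k \<in> S" using ws(1) Cons by simp
      ultimately have "inv g \<otimes> h = k" using ws(2) by (simp add: wm.wd_def S_def)
      then show ?thesis using \<open>k \<in> S\<close> by (simp add: S_def)
    qed
    then show ?thesis unfolding W_def wdist_def using wnorm_geq[OF rho_inv_mult[OF gh(1,2)]] by simp
  qed
  have WR_d: "wm.wdst g h \<le> 1" if gh: "g \<in> carrier G" "h \<in> carrier G" "W g h \<le> R" for g h
  proof -
    have "wnorm (\<rho> (inv g \<otimes> h)) \<le> R"
      using wnorm_geq[OF rho_inv_mult[OF gh(1,2)]] gh(3) by (simp add: W_def wdist_def)
    then have "inv g \<otimes> h \<in> S" using gh by (simp add: S_def)
    then show ?thesis unfolding wm.wdst_def using wm.word_length_le[OF wm.spelled_gen] by simp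
  qed
  have near: "\<exists>k\<in>carrier G. \<rho> k \<sim> q @ ret s \<and> wdist q (\<rho> k) \<le> D0" if "walk v0 q s" for q s
  proof -
    have "walk v0 (q @ ret s) v0" using that ret(1) walk_append by blast
    then obtain k where k: "k \<in> carrier G" "\<rho> k \<sim> q @ ret s" using rho_onto by blast
    have "wdist q (\<rho> k) = wdist (q @ []) (q @ ret s)" using k by (intro wdist_geq) auto
    also have "\<dots> = wdist [] (ret s)" by (rule wdist_append_left)
    also have "\<dots> \<le> D0" using D0[of s] walk_in_X[OF that] wnorm_le[of "ret s"] by (simp add: wdist_def)
    finally show ?thesis using k by blast
  qed
  \<comment> \<open>The guess is the interval of the word metric, whose points may end at any
    vertex, moved into the group along return words.\<close>
  define L where "L g h = {k \<in> carrier G. \<exists>p s. walk v0 p s \<and> wdist (\<rho> g) p + wdist p (\<rho> h) = W g h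
    \<and> wdist p (\<rho> k) \<le> D0}" for g h
  \<comment> \<open>\<open>4 * n\<close> comes from \<open>thin_intervals\<close>,
    \<open>2 * D0\<close> from moving both points into the group, and \<open>R + D0\<close> bounds
    the guess between neighbours.\<close>
  define D where "D = R + 2 * D0 + 4 * n"
  interpret gg: guessed_geodesics "carrier G" wm.wdst L D
  proof
    fix x y p assume "x \<in> carrier G" "y \<in> carrier G" "p \<in> L x y"
    then show "p \<in> carrier G" by (simp add: L_def)
  next
    fix x y p assume xy: "x \<in> carrier G" "y \<in> carrier G" "wm.wdst x y \<le> 1" "p \<in> L x y"
    then obtain q where q: "p \<in> carrier G" "wdist (\<rho> x) q + wdist q (\<rho> y) = W x y" "wdist q (\<rho> p) \<le> D0"
      unfolding L_def by blast
    have "wm.wdst x p \<le> W x p" using d_le_W xy q by blast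
    also have "\<dots> \<le> R + D0" unfolding W_def
      using wdist_triangle[of "\<rho> x" "\<rho> p" q] q d1_W[OF xy(1-3)] by linarith
    finally show "wm.wdst x p \<le> D" by (simp add: D_def)
  next
    fix x y z p assume xyz: "x \<in> carrier G" "y \<in> carrier G" "z \<in> carrier G" "p \<in> L x y"
    then obtain q s where q: "p \<in> carrier G" "walk v0 q s" "wdist (\<rho> x) q + wdist q (\<rho> y) = wdist (\<rho> x) (\<rho> y)"
      "wdist q (\<rho> p) \<le> D0"
      unfolding L_def W_def by blast
    obtain q' s' where q': "walk v0 q' s'" "wdist q q' \<le> 4 * n"
      "wdist (\<rho> x) q' + wdist q' (\<rho> z) = wdist (\<rho> x) (\<rho> z)
        \<or> wdist (\<rho> z) q' + wdist q' (\<rho> y) = wdist (\<rho> z) (\<rho> y)"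
      using thin_intervals[OF q(2) rho_walk[OF xyz(1)] rho_walk[OF xyz(2)] rho_walk[OF xyz(3)] q(3)] by blast
    obtain k where k: "k \<in> carrier G" "wdist q' (\<rho> k) \<le> D0" using near[OF q'(1)] by blast
    have "k \<in> L x z \<union> L z y" using q'(1,3) k unfolding L_def W_def by blast
    moreover have "wm.wdst p k \<le> D"
    proof -
      have "wdist (\<rho> p) (\<rho> k) \<le> wdist (\<rho> p) q + wdist q q' + wdist q' (\<rho> k)"
        using wdist_triangle[of "\<rho> p" "\<rho> k" q] wdist_triangle[of q "\<rho> k" q'] by linarith
      also have "\<dots> \<le> D" using q(4) q'(2) k(2) wdist_commute[of "\<rho> p" q] by (simp add: D_def)
      finally show ?thesis using d_le_W[OF q(1) k(1)] by (simp add: W_def)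
    qed
    ultimately show "\<exists>q\<in>L x z \<union> L z y. wm.wdst p q \<le> D" by blast
  next
    fix x y assume xy: "x \<in> carrier G" "y \<in> carrier G"
    \<comment> \<open>The chain follows the geodesic word \<open>r\<close>. Closing up its prefixes
      gives elements of which consecutive ones differ by one edge and two return words, so their
      Cayley distance is at most 1.\<close>
    define r where "r = nf (winv (\<rho> x) @ \<rho> y)"
    define m where "m = length r"
    have m: "m = W x y" by (simp add: m_def r_def W_def wdist_def wnorm_def)
    have "walk v0 (winv (\<rho> x) @ \<rho> y) v0" using walk_winv rho_walk xy walk_append by blast
    then have rw: "walk v0 r v0" unfolding r_def by (rule walk_nf)
    have "\<exists>s. walk v0 (\<rho> x @ take i r) s" for i
    proof -
      have "walk v0 (\<rho> x @ take i r @ drop i r) v0" using rw rho_walk[OF xy(1)] by (auto simp: walk_append)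
      then show ?thesis using walk_append[of v0 "\<rho> x @ take i r" "drop i r" v0] by auto
    qed
    then obtain s where s: "\<And>i. walk v0 (\<rho> x @ take i r) (s i)" by metis
    then have "\<forall>i. \<exists>k. k \<in> carrier G \<and> \<rho> k \<sim> (\<rho> x @ take i r) @ ret (s i) \<and> wdist (\<rho> x @ take i r) (\<rho> k) \<le> D0"
      using near by blast
    then obtain p where p: "\<And>i. p i \<in> carrier G" "\<And>i. \<rho> (p i) \<sim> (\<rho> x @ take i r) @ ret (s i)"
      "\<And>i. wdist (\<rho> x @ take i r) (\<rho> (p i)) \<le> D0"
      by metis
    have "walk v0 (\<rho> x @ take 0 r) v0" using rho_walk xy by simp
    then have "s 0 = v0" using walk_det s by blast
    then have "\<rho> (p 0) \<sim> \<rho> x" using p(2)[of 0] ret(2) by simp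
    then have p0: "p 0 = x" using rho_inj p xy by blast
    have "walk v0 (\<rho> x @ take m r) v0" using rho_walk xy rw walk_append by (auto simp: m_def)
    then have "s m = v0" using walk_det s by blast
    then have "\<rho> (p m) \<sim> \<rho> x @ r" using p(2)[of m] ret(2) by (simp add: m_def)
    also have "\<dots> \<sim> \<rho> x @ winv (\<rho> x) @ \<rho> y" unfolding r_def by (intro geq_append_left geq_nf)
    also have "\<dots> \<sim> \<rho> y" by (rule geq_winv_right)
    finally have pm: "p m = y" using rho_inj p xy by blast
    have "\<rho> y \<sim> \<rho> x @ r"
      using geq_append_left[OF geq_nf, of "\<rho> x" "winv (\<rho> x) @ \<rho> y"] geq_winv_right[of "\<rho> x" "\<rho> y"]
      unfolding r_def by (meson geq_sym geq_trans)
    have inL: "p i \<in> L x y" if "i \<le> m" for i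
    proof -
      have "wdist (\<rho> x) (\<rho> x @ take i r) = wdist [] (take i r)"
        using wdist_append_left[of "\<rho> x" "[]"] by simp
      also have "\<dots> \<le> i" using wnorm_le[of "take i r"] by (simp add: wdist_def)
      finally have a: "wdist (\<rho> x) (\<rho> x @ take i r) \<le> i" .
      have "wdist (\<rho> x @ take i r) (\<rho> y) = wdist (\<rho> x @ take i r) ((\<rho> x @ take i r) @ drop i r)"
        using \<open>\<rho> y \<sim> \<rho> x @ r\<close> by (intro wdist_geq) auto
      also have "\<dots> = wdist [] (drop i r)" using wdist_append_left[of "\<rho> x @ take i r" "[]"] by (simp only: append_Nil2)
      also have "\<dots> \<le> m - i" using wnorm_le[of "drop i r"] by (simp add: wdist_def m_def)
      finally have b: "wdist (\<rho> x @ take i r) (\<rho> y) \<le> m - i" .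
      have "wdist (\<rho> x) (\<rho> x @ take i r) + wdist (\<rho> x @ take i r) (\<rho> y) = W x y"
        using a b m that wdist_triangle[of "\<rho> x" "\<rho> y" "\<rho> x @ take i r"] by (simp add: W_def)
      then show ?thesis unfolding L_def using p s by blast
    qed
    have "wm.wdst (p i) (p (Suc i)) \<le> 1" if "i < m" for i
    proof (rule WR_d)
      let ?q = "\<rho> x @ take i r"
      have t: "\<rho> x @ take (Suc i) r = ?q @ [r ! i]" using that by (simp add: m_def take_Suc_conv_app_nth)
      have "W (p i) (p (Suc i)) = wdist (?q @ ret (s i)) (?q @ [r ! i] @ ret (s (Suc i)))"
        unfolding W_def using p(2)[of i] p(2)[of "Suc i"] t by (intro wdist_geq) auto
      also have "\<dots> = wnorm (winv (ret (s i)) @ [r ! i] @ ret (s (Suc i)))"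
        by (simp only: wdist_append_left) (simp add: wdist_def)
      also have "\<dots> \<le> length (winv (ret (s i)) @ [r ! i] @ ret (s (Suc i)))" by (rule wnorm_le)
      also have "\<dots> \<le> R" using D0[of "s i"] D0[of "s (Suc i)"] walk_in_X[OF s[of i]] walk_in_X[OF s[of "Suc i"]]
        by (simp add: R_def)
      finally show "W (p i) (p (Suc i)) \<le> R" .
    qed (use p in auto)
    then show "\<exists>p m. p 0 = x \<and> p m = y \<and> (\<forall>i\<le>m. p i \<in> L x y) \<and> (\<forall>i<m. wm.wdst (p i) (p (Suc i)) \<le> 1)"
      using p0 pm inL by blast
  qed (rule gm.wdst_self gm.wdst_sym gm.wdst_tri gm.wdst_geodesic; assumption)+
  have "word_dist G S = (\<lambda>x y. real (wm.wdst x y))"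
    by (intro ext) (simp add: word_dist_def wm.wdst_def)
  then have "gromov_hyperbolic (carrier G) (word_dist G S)" using gg.hyperbolic by simp
  then show ?thesis unfolding hyperbolic_group_def
    using grp \<open>finite S\<close> wm.S_carrier gm.generate_eq by blast
qed

end

subsection \<open>Fundamental groups of topological spaces\<close>

text \<open>Two reparametrizations of one path are homotopic because the homotopy can be taken in
  the convex unit interval. This yields the laws for constant, reversed and partial paths in an
  arbitrary topological space.\<close>

lemma homotopic_paths_compose_interval:
  fixes p :: "real \<Rightarrow> 'x::topological_space" and f g :: "real \<Rightarrow> real"
  assumes p: "path p" "path_image p \<subseteq> S" and f: "path f" "path_image f \<subseteq> {0..1}"
    and g: "path g" "path_image g \<subseteq> {0..1}"
    and ends: "pathstart f = pathstart g" "pathfinish f = pathfinish g"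
  shows "homotopic_paths S (p \<circ> f) (p \<circ> g)"
proof (rule homotopic_paths_continuous_image)
  show "homotopic_paths {0..1} f g"
  proof (rule homotopic_paths_linear)
    fix t :: real assume "t \<in> {0..1}"
    then have "f t \<in> {0..1}" "g t \<in> {0..1}" using f g unfolding path_image_def by blast+
    then show "closed_segment (f t) (g t) \<subseteq> {0..1}" by (intro closed_segment_subset) auto
  qed (use f g ends in auto)
  show "continuous_on {0..1} p" using p by (simp add: path_def)
  show "p \<in> {0..1} \<rightarrow> S" using p by (auto simp: path_image_def)
qed

lemma compose_linepath_simps:
  fixes p :: "real \<Rightarrow> 'x::topological_space"
  shows "p \<circ> linepath 0 1 = p" "p \<circ> linepath 1 0 = reversepath p" "p \<circ> linepath a a = (\<lambda>_. p a)"
  by (auto simp: linepath_def reversepath_def fun_eq_iff algebra_simps)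

lemma homotopic_paths_const_left:
  assumes "path p" "path_image p \<subseteq> S" "x = pathstart p"
  shows "homotopic_paths S ((\<lambda>_. x) +++ p) p"
proof -
  have "homotopic_paths S (p \<circ> (linepath 0 0 +++ linepath 0 1)) (p \<circ> linepath 0 1)"
    by (rule homotopic_paths_compose_interval[OF assms(1,2)])
      (auto simp: path_image_join closed_segment_eq_real_ivl)
  then show ?thesis by (simp only: path_compose_join compose_linepath_simps assms(3) pathstart_def)
qed

lemma homotopic_paths_reversepath_right:
  assumes "path p" "path_image p \<subseteq> S"
  shows "homotopic_paths S (p +++ reversepath p) (\<lambda>_. pathstart p)"
proof -
  have "homotopic_paths S (p \<circ> (linepath 0 1 +++ linepath 1 0)) (p \<circ> linepath 0 0)"
    by (rule homotopic_paths_compose_interval[OF assms])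
      (auto simp: path_image_join closed_segment_eq_real_ivl)
  then show ?thesis by (simp only: path_compose_join compose_linepath_simps pathstart_def)
qed

lemma homotopic_paths_reversepath_left:
  assumes "path p" "path_image p \<subseteq> S"
  shows "homotopic_paths S (reversepath p +++ p) (\<lambda>_. pathfinish p)"
  using homotopic_paths_reversepath_right[of "reversepath p" S] assms by simp

lemma homotopic_paths_join_subpaths:
  assumes "path p" "path_image p \<subseteq> S" "u \<in> {0..1}" "v \<in> {0..1}" "w \<in> {0..1}"
  shows "homotopic_paths S ((p \<circ> linepath u v) +++ (p \<circ> linepath v w)) (p \<circ> linepath u w)"
proof -
  have sub: "closed_segment a b \<subseteq> {0..1}" if "a \<in> {0..1}" "b \<in> {0..1}" for a b :: real
    using that by (intro closed_segment_subset) auto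
  have "homotopic_paths S (p \<circ> (linepath u v +++ linepath v w)) (p \<circ> linepath u w)"
    using sub assms by (intro homotopic_paths_compose_interval) (auto simp: path_image_join)
  then show ?thesis by (simp add: path_compose_join compose_linepath_simps)
qed

text \<open>In the convex square one side is homotopic to the path along the other three, and
  \<open>h\<close> transports this homotopy. It turns a contraction, which moves the ends of a path,
  into a homotopy that fixes them.\<close>

lemma homotopic_paths_square:
  fixes h :: "real \<times> real \<Rightarrow> 'x::topological_space"
  assumes "continuous_on ({0..1} \<times> {0..1}) h" "h \<in> {0..1} \<times> {0..1} \<rightarrow> S"
  shows "homotopic_paths S (\<lambda>t. h (0, t)) ((\<lambda>s. h (s, 0)) +++ ((\<lambda>t. h (1, t)) +++ (\<lambda>s. h (1 - s, 1))))"
proof -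
  let ?I = "{0..1::real} \<times> {0..1::real}"
  let ?f = "linepath (0, 0) (0, 1) :: real \<Rightarrow> real \<times> real"
  let ?g = "linepath (0, 0) (1, 0) +++ (linepath (1, 0) (1, 1) +++ linepath (1, 1) (0, 1)) :: real \<Rightarrow> real \<times> real"
  have conv: "convex ?I" by (intro convex_Times) auto
  have sub: "closed_segment u v \<subseteq> ?I" if "u \<in> ?I" "v \<in> ?I" for u v
    using that conv by (rule closed_segment_subset)
  have img: "path_image ?f \<subseteq> ?I" "path_image ?g \<subseteq> ?I"
    by (simp_all add: path_image_join sub del: mem_Times_iff)
  have "homotopic_paths ?I ?f ?g"
  proof (rule homotopic_paths_linear)
    fix t :: real assume "t \<in> {0..1}"
    then have "?f t \<in> ?I" "?g t \<in> ?I" using img unfolding path_image_def by blast+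
    then show "closed_segment (?f t) (?g t) \<subseteq> ?I" by (rule sub)
  qed auto
  then have "homotopic_paths S (h \<circ> ?f) (h \<circ> ?g)"
    using assms by (rule homotopic_paths_continuous_image)
  then show ?thesis unfolding path_compose_join by (simp add: linepath_def o_def)
qed

text \<open>The rebracketing met when two adjacent pieces of a path are replaced by detours through
  vertices: it brings the inner segments \<open>c\<close> and \<open>d\<close> together.\<close>

lemma homotopic_paths_assoc5:
  assumes "path a" "path_image a \<subseteq> S" "path b" "path_image b \<subseteq> S" "path c" "path_image c \<subseteq> S"
    "path d" "path_image d \<subseteq> S" "path e" "path_image e \<subseteq> S"
    "pathfinish a = pathstart b" "pathfinish b = pathstart c" "pathfinish c = pathstart d" "pathfinish d = pathstart e"
  shows "homotopic_paths S ((a +++ (b +++ c)) +++ (d +++ e)) (a +++ ((b +++ (c +++ d)) +++ e))"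
proof -
  have 1: "homotopic_paths S ((a +++ (b +++ c)) +++ (d +++ e)) (a +++ ((b +++ c) +++ (d +++ e)))"
    by (rule homotopic_paths_sym, rule homotopic_paths_assoc) (use assms in \<open>auto simp: path_image_join\<close>)
  have 2: "homotopic_paths S ((b +++ c) +++ (d +++ e)) (((b +++ c) +++ d) +++ e)"
    by (rule homotopic_paths_assoc) (use assms in \<open>auto simp: path_image_join\<close>)
  have 3: "homotopic_paths S ((b +++ c) +++ d) (b +++ (c +++ d))"
    by (rule homotopic_paths_sym, rule homotopic_paths_assoc) (use assms in \<open>auto simp: path_image_join\<close>)
  have 4: "homotopic_paths S (((b +++ c) +++ d) +++ e) ((b +++ (c +++ d)) +++ e)"
    by (rule homotopic_paths_join[OF 3]) (use assms in auto)
  have "homotopic_paths S (a +++ ((b +++ c) +++ (d +++ e))) (a +++ ((b +++ (c +++ d)) +++ e))"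
    by (rule homotopic_paths_join[OF _ homotopic_paths_trans[OF 2 4]]) (use assms in auto)
  with 1 show ?thesis by (rule homotopic_paths_trans)
qed

section \<open>The group of loop classes\<close>

definition hclass :: "'x::topological_space set \<Rightarrow> (real \<Rightarrow> 'x) \<Rightarrow> (real \<Rightarrow> 'x) set" where
  "hclass S p = {q. homotopic_paths S p q}"

lemma hclass_eq: "homotopic_paths S p q \<Longrightarrow> hclass S p = hclass S q"
  unfolding hclass_def using homotopic_paths_sym homotopic_paths_trans by blast

lemma hclass_self: "p \<in> loops_at S x \<Longrightarrow> p \<in> hclass S p"
  by (simp add: hclass_def loops_at_def)

lemma carrier_fundamental_group: "carrier (fundamental_group S x) = hclass S ` loops_at S x"
  unfolding fundamental_group_def hclass_def quotient_def by auto

lemma loops_at_join: "p \<in> loops_at S x \<Longrightarrow> q \<in> loops_at S x \<Longrightarrow> p +++ q \<in> loops_at S x"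
  by (auto simp: loops_at_def path_image_join)

lemma loops_at_reversepath: "p \<in> loops_at S x \<Longrightarrow> reversepath p \<in> loops_at S x"
  by (auto simp: loops_at_def)

lemma loops_at_const: "x \<in> S \<Longrightarrow> (\<lambda>_. x) \<in> loops_at S x"
  by (auto simp: loops_at_def path_def path_image_def pathstart_def pathfinish_def)

lemma mult_fundamental_group:
  assumes "p \<in> loops_at S x" "q \<in> loops_at S x"
  shows "hclass S p \<otimes>\<^bsub>fundamental_group S x\<^esub> hclass S q = hclass S (p +++ q)"
proof -
  have "homotopic_paths S (p +++ q) r" if "homotopic_paths S p p'" "homotopic_paths S q q'"
    "homotopic_paths S (p' +++ q') r" for p' q' r
  proof -
    have "homotopic_paths S (p +++ q) (p' +++ q')"
      using that assms by (intro homotopic_paths_join) (auto simp: loops_at_def)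
    then show ?thesis using that(3) homotopic_paths_trans by blast
  qed
  moreover have "p \<in> hclass S p" "q \<in> hclass S q" using assms hclass_self by blast+
  ultimately have "{r. \<exists>p'\<in>hclass S p. \<exists>q'\<in>hclass S q. homotopic_paths S (p' +++ q') r} = hclass S (p +++ q)"
    unfolding hclass_def by blast
  then show ?thesis by (simp add: fundamental_group_def)
qed

lemma group_fundamental_group:
  assumes "x \<in> S"
  shows "group (fundamental_group S x)"
proof -
  let ?G = "fundamental_group S x"
  have one: "\<one>\<^bsub>?G\<^esub> = hclass S (\<lambda>_. x)" by (simp add: fundamental_group_def hclass_def)
  note L = loops_at_const[OF assms]
  show ?thesis
  proof (rule groupI; unfold carrier_fundamental_group one)
    show "hclass S (\<lambda>_. x) \<in> hclass S ` loops_at S x" using L by blast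
  next
    fix c d assume "c \<in> hclass S ` loops_at S x" "d \<in> hclass S ` loops_at S x"
    then show "c \<otimes>\<^bsub>?G\<^esub> d \<in> hclass S ` loops_at S x"
      using mult_fundamental_group loops_at_join by fastforce
  next
    fix c d e assume "c \<in> hclass S ` loops_at S x" "d \<in> hclass S ` loops_at S x" "e \<in> hclass S ` loops_at S x"
    then obtain p q r where pqr: "p \<in> loops_at S x" "q \<in> loops_at S x" "r \<in> loops_at S x"
      "c = hclass S p" "d = hclass S q" "e = hclass S r" by blast
    have "homotopic_paths S ((p +++ q) +++ r) (p +++ (q +++ r))"
      by (rule homotopic_paths_sym, rule homotopic_paths_assoc) (use pqr in \<open>auto simp: loops_at_def\<close>)
    then show "c \<otimes>\<^bsub>?G\<^esub> d \<otimes>\<^bsub>?G\<^esub> e = c \<otimes>\<^bsub>?G\<^esub> (d \<otimes>\<^bsub>?G\<^esub> e)"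
      using pqr by (simp add: mult_fundamental_group loops_at_join hclass_eq)
  next
    fix c assume "c \<in> hclass S ` loops_at S x"
    then obtain p where p: "p \<in> loops_at S x" "c = hclass S p" by blast
    have "homotopic_paths S ((\<lambda>_. x) +++ p) p"
      using p by (intro homotopic_paths_const_left) (auto simp: loops_at_def)
    then show "hclass S (\<lambda>_. x) \<otimes>\<^bsub>?G\<^esub> c = c"
      using p L by (simp add: mult_fundamental_group hclass_eq)
    have "homotopic_paths S (reversepath p +++ p) (\<lambda>_. pathfinish p)"
      using p by (intro homotopic_paths_reversepath_left) (auto simp: loops_at_def)
    then have "homotopic_paths S (reversepath p +++ p) (\<lambda>_. x)" using p by (simp add: loops_at_def)
    then have "hclass S (reversepath p) \<otimes>\<^bsub>?G\<^esub> c = hclass S (\<lambda>_. x)"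
      using p by (simp add: mult_fundamental_group loops_at_reversepath hclass_eq)
    then show "\<exists>y\<in>hclass S ` loops_at S x. y \<otimes>\<^bsub>?G\<^esub> c = hclass S (\<lambda>_. x)"
      using loops_at_reversepath[OF p(1)] by blast
  qed
qed

text \<open>The image of the homotopy is connected and meets \<open>C\<close>, so it stays in the
  component. Homotopy of loops in \<open>C\<close> can therefore be tested in the whole
  complex.\<close>

lemma homotopic_paths_component:
  assumes "homotopic_paths S p q" "C \<in> components S" "pathstart p \<in> C"
  shows "homotopic_paths C p q"
proof -
  obtain h where h: "continuous_on ({0..1} \<times> {0..1}) h" "h \<in> ({0..1} \<times> {0..1}) \<rightarrow> S"
    "\<forall>x \<in> {0..1}. h(0,x) = p x" "\<forall>x \<in> {0..1}. h(1,x) = q x"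
    "\<forall>t \<in> {0..1::real}. pathstart(h \<circ> Pair t) = pathstart p \<and> pathfinish(h \<circ> Pair t) = pathfinish p"
    using assms(1) unfolding homotopic_paths by blast
  let ?T = "h ` ({0..1} \<times> {0..1})"
  have "connected ?T"
    using h(1) by (intro connected_continuous_image connected_Times) auto
  moreover have "h (0, 0) = pathstart p" using h(3) by (simp add: pathstart_def)
  then have "C \<inter> ?T \<noteq> {}" using assms(3) by (metis IntI SigmaI atLeastAtMost_iff empty_iff imageI order_refl zero_le_one)
  moreover have "?T \<subseteq> S" using h(2) by auto
  ultimately have "?T \<subseteq> C" using components_maximal[OF assms(2)] by blast
  then have "h \<in> ({0..1} \<times> {0..1}) \<rightarrow> C" by auto
  with h show ?thesis unfolding homotopic_paths by blast
qed

lemma path_image_component: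
  assumes "path p" "path_image p \<subseteq> S" "C \<in> components S" "pathstart p \<in> C"
  shows "path_image p \<subseteq> C"
  using components_maximal[OF assms(3) connected_path_image[OF assms(1)] assms(2)]
    assms(4) pathstart_in_path_image[of p] by blast

subsection \<open>Edge paths in the realization\<close>

definition mix :: "real \<Rightarrow> (nat \<Rightarrow> 'v \<Rightarrow> real) \<Rightarrow> (nat \<Rightarrow> 'v \<Rightarrow> real) \<Rightarrow> nat \<Rightarrow> 'v \<Rightarrow> real" where
  "mix s t t' = (\<lambda>i z. (1 - s) * t i z + s * t' i z)"

definition seg :: "(nat \<Rightarrow> 'v \<Rightarrow> real) \<Rightarrow> (nat \<Rightarrow> 'v \<Rightarrow> real) \<Rightarrow> real \<Rightarrow> nat \<Rightarrow> 'v \<Rightarrow> real" where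
  "seg t t' = (\<lambda>s. mix s t t')"

lemma mix_simps [simp]: "mix 0 t t' = t" "mix 1 t t' = t'" "mix s t t = t"
  by (auto simp: mix_def fun_eq_iff algebra_simps)

lemma mix_swap: "mix (1 - s) t t' = mix s t' t"
  by (auto simp: mix_def fun_eq_iff algebra_simps)

lemma continuous_on_mix:
  fixes f g :: "'x::topological_space \<Rightarrow> nat \<Rightarrow> 'v \<Rightarrow> real"
  assumes "continuous_on A s" "continuous_on A f" "continuous_on A g"
  shows "continuous_on A (\<lambda>x. mix (s x) (f x) (g x))"
  unfolding mix_def
proof (rule continuous_on_coordinatewise_then_product, rule continuous_on_coordinatewise_then_product)
  fix i z
  have c: "continuous_on A (\<lambda>x. r x i z)" if "continuous_on A r" for r :: "'x \<Rightarrow> nat \<Rightarrow> 'v \<Rightarrow> real"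
    by (rule continuous_on_product_then_coordinatewise[OF continuous_on_product_then_coordinatewise[OF that]])
  show "continuous_on A (\<lambda>x. (1 - s x) * f x i z + s x * g x i z)"
    by (intro continuous_on_add continuous_on_mult continuous_on_diff continuous_on_const c assms)
qed

lemma path_seg [simp]: "path (seg t t')"
  unfolding path_def seg_def by (intro continuous_on_mix continuous_intros)

lemma seg_ends [simp]: "pathstart (seg t t') = t" "pathfinish (seg t t') = t'"
  by (simp_all add: seg_def pathstart_def pathfinish_def)

section \<open>Cubes, vertices and open stars of the realization\<close>

context coloured_pair
begin

abbreviation Z where "Z \<equiv> coupled_link_complex n \<Gamma>A \<Gamma>B"

abbreviation cubes where "cubes \<equiv> coupled_link_cubes n \<Gamma>A \<Gamma>B"

definition realize :: "(nat \<Rightarrow> ('a + 'b) set) \<Rightarrow> (nat \<Rightarrow> 'a + 'b \<Rightarrow> real) set" where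
  "realize Q = (\<Pi>\<^sub>E i\<in>{1..n}. simplex_realization (Q i))"

lemma Z_eq: "Z = (\<Union>Q\<in>cubes. realize Q)"
  by (simp add: coupled_link_complex_def realize_def)

lemma realize_Z: "Q \<in> cubes \<Longrightarrow> t \<in> realize Q \<Longrightarrow> t \<in> Z"
  unfolding Z_eq by blast

lemma cube_vertices_X: "Q \<in> cubes \<Longrightarrow> v \<in> cube_vertices n Q \<Longrightarrow> v \<in> X"
  by (auto simp: coupled_link_cubes_def)

lemma cube_cell: "Q \<in> cubes \<Longrightarrow> i \<in> {1..n} \<Longrightarrow> Q i \<in> join_cells (colour_class \<Gamma>A i) (colour_class \<Gamma>B i)"
  by (auto simp: coupled_link_cubes_def product_cubes_def)

lemma join_cells_finite: "c \<in> join_cells A B \<Longrightarrow> finite c"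
  by (auto simp: join_cells_def)

lemma simplex_mix:
  assumes "t \<in> simplex_realization c" "t' \<in> simplex_realization c" "s \<in> {0..1}"
  shows "(\<lambda>z. (1 - s) * t z + s * t' z) \<in> simplex_realization c"
proof -
  have "(\<Sum>z\<in>c. (1 - s) * t z + s * t' z) = (1 - s) * sum t c + s * sum t' c"
    by (simp add: sum.distrib sum_distrib_left)
  then show ?thesis using assms by (auto simp: simplex_realization_def)
qed

lemma realize_mix:
  assumes "t \<in> realize Q" "t' \<in> realize Q" "s \<in> {0..1}"
  shows "mix s t t' \<in> realize Q"
  unfolding realize_def
proof (rule PiE_I)
  fix i assume "i \<in> {1..n}"
  then show "mix s t t' i \<in> simplex_realization (Q i)"
    using assms simplex_mix unfolding mix_def realize_def by (metis PiE_mem)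
next
  fix i assume "i \<notin> {1..n}"
  \<comment> \<open>Outside \<open>{1..n}\<close> both points have the default value, and mixing a
    value with itself gives it back.\<close>
  then have "t i = undefined" "t' i = undefined" using assms by (auto simp: realize_def PiE_iff extensional_def)
  then show "mix s t t' i = undefined" by (simp add: mix_def fun_eq_iff algebra_simps)
qed

definition pt :: "(nat \<Rightarrow> 'a + 'b) \<Rightarrow> nat \<Rightarrow> 'a + 'b \<Rightarrow> real" where
  "pt v = (\<lambda>i\<in>{1..n}. \<lambda>z. if z = v i then 1 else 0)"

lemma pt_realize: "Q \<in> cubes \<Longrightarrow> v \<in> cube_vertices n Q \<Longrightarrow> pt v \<in> realize Q"
  unfolding realize_def
proof (rule PiE_I)
  fix i assume "Q \<in> cubes" "v \<in> cube_vertices n Q" and i: "i \<in> {1..n}"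
  then have "finite (Q i)" "v i \<in> Q i"
    using cube_cell join_cells_finite by (blast, auto simp: cube_vertices_def)
  then show "pt v i \<in> simplex_realization (Q i)"
    using i by (auto simp: pt_def simplex_realization_def)
qed (auto simp: pt_def)

text \<open>The open star of a vertex. Open stars cover the complex and are contracted to
  \<open>pt v\<close> along segments; they are the charts inside which no letter has to be
  read.\<close>

definition star :: "(nat \<Rightarrow> 'a + 'b) \<Rightarrow> (nat \<Rightarrow> 'a + 'b \<Rightarrow> real) set" where
  "star v = {t \<in> Z. \<forall>i\<in>{1..n}. t i (v i) > 0}"

lemma star_Z: "t \<in> star v \<Longrightarrow> t \<in> Z"
  by (simp add: star_def)

lemma star_cube:
  assumes "t \<in> star v" "t \<in> realize Q" "v \<in> X"
  shows "v \<in> cube_vertices n Q"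
  unfolding cube_vertices_def
proof (rule PiE_I)
  fix i assume i: "i \<in> {1..n}"
  have "t i \<in> simplex_realization (Q i)" using assms(2) i unfolding realize_def by blast
  moreover have "t i (v i) > 0" using assms(1) i by (simp add: star_def)
  ultimately show "v i \<in> Q i" unfolding simplex_realization_def by force
next
  fix i assume "i \<notin> {1..n}"
  then show "v i = undefined" using assms(3) unfolding X_iff PiE_iff extensional_def by blast
qed

lemma star_ex:
  assumes "t \<in> Z"
  obtains v where "v \<in> X" "t \<in> star v"
proof -
  obtain Q where Q: "Q \<in> cubes" "t \<in> realize Q" using assms unfolding Z_eq by blast
  have "\<exists>z\<in>Q i. t i z > 0" if "i \<in> {1..n}" for i
  proof (rule ccontr)
    assume neg: "\<not> ?thesis"
    have "t i \<in> simplex_realization (Q i)" using Q that unfolding realize_def by blast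
    then have s: "sum (t i) (Q i) = 1" by (simp add: simplex_realization_def)
    have "sum (t i) (Q i) \<le> 0" using neg by (intro sum_nonpos) force
    then show False using s by simp
  qed
  then obtain f where f: "\<And>i. i \<in> {1..n} \<Longrightarrow> f i \<in> Q i \<and> t i (f i) > 0" by metis
  have "restrict f {1..n} \<in> cube_vertices n Q" using f unfolding cube_vertices_def by auto
  then have "restrict f {1..n} \<in> X" using Q cube_vertices_X by blast
  moreover have "t \<in> star (restrict f {1..n})" using assms f by (simp add: star_def)
  ultimately show ?thesis using that by blast
qed

lemma star_open: "\<exists>U. open U \<and> star v = Z \<inter> U"
proof (intro exI conjI)
  show "open (\<Inter>i\<in>{1..n}. {t :: nat \<Rightarrow> 'a + 'b \<Rightarrow> real. 0 < t i (v i)})"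
  proof (intro open_INT ballI open_Collect_less continuous_intros)
    fix i
    show "continuous_on UNIV (\<lambda>t :: nat \<Rightarrow> 'a + 'b \<Rightarrow> real. t i (v i))"
      by (rule continuous_on_product_then_coordinatewise[OF continuous_on_product_then_coordinatewise[OF continuous_on_id]])
  qed auto
  show "star v = Z \<inter> (\<Inter>i\<in>{1..n}. {t. 0 < t i (v i)})" by (auto simp: star_def)
qed

lemma cell_ex: "Q \<in> cubes \<Longrightarrow> \<exists>v. v \<in> cube_vertices n Q"
proof -
  assume Q: "Q \<in> cubes"
  have "Q i \<noteq> {}" if "i \<in> {1..n}" for i using cube_cell[OF Q that] by (auto simp: join_cells_def)
  then show ?thesis unfolding cube_vertices_def by (metis PiE_eq_empty_iff equals0I)
qed

lemma pt_star: "v \<in> X \<Longrightarrow> pt v \<in> star v"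
proof -
  assume v: "v \<in> X"
  define Q where "Q = (\<lambda>i\<in>{1..n}. {v i})"
  have "cube_vertices n Q = {v}"
  proof -
    have "v \<in> extensional {1..n}" using v unfolding X_iff PiE_def by blast
    then have "(\<Pi>\<^sub>E i\<in>{1..n}. {v i}) = {v}" by (rule PiE_singleton)
    then show ?thesis unfolding cube_vertices_def Q_def by (metis (no_types, lifting) PiE_cong restrict_apply')
  qed
  moreover have "Q \<in> product_cubes n \<Gamma>A \<Gamma>B"
    unfolding product_cubes_def Q_def join_cells_def using X_cell[OF v] by auto
  ultimately have "Q \<in> cubes" "v \<in> cube_vertices n Q" using v by (auto simp: coupled_link_cubes_def)
  then have "pt v \<in> Z" using pt_realize realize_Z by blast
  then show ?thesis by (simp add: star_def pt_def)
qed

text \<open>Any cube containing \<open>t\<close> has \<open>v\<close> as a vertex, so the segment to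
  \<open>pt v\<close> stays in that cube, and the weights at \<open>v\<close> remain positive along
  it.\<close>

lemma star_mix:
  assumes "t \<in> star v" "v \<in> X" "s \<in> {0..1}"
  shows "mix s t (pt v) \<in> star v"
proof -
  obtain Q where Q: "Q \<in> cubes" "t \<in> realize Q" using star_Z[OF assms(1)] unfolding Z_eq by blast
  have "mix s t (pt v) \<in> realize Q" using Q star_cube assms pt_realize realize_mix by blast
  then have "mix s t (pt v) \<in> Z" using Q realize_Z by blast
  moreover have "mix s t (pt v) i (v i) > 0" if "i \<in> {1..n}" for i
  proof -
    have "t i (v i) > 0" using assms(1) that by (simp add: star_def)
    then show ?thesis using assms(3) that
      by (cases "s = 1") (auto simp: mix_def pt_def intro: add_pos_nonneg)
  qed
  ultimately show ?thesis by (simp add: star_def)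
qed

lemma seg_star: "\<lbrakk>t \<in> star v; v \<in> X\<rbrakk> \<Longrightarrow> path_image (seg t (pt v)) \<subseteq> star v"
  using star_mix by (auto simp: path_image_def seg_def)

lemma seg_star': "\<lbrakk>t \<in> star v; v \<in> X\<rbrakk> \<Longrightarrow> path_image (seg (pt v) t) \<subseteq> star v"
proof -
  have "seg (pt v) t = reversepath (seg t (pt v))"
    by (auto simp: seg_def reversepath_def mix_swap)
  then show "\<lbrakk>t \<in> star v; v \<in> X\<rbrakk> \<Longrightarrow> path_image (seg (pt v) t) \<subseteq> star v" using seg_star by simp
qed

lemma realize_seg: "\<lbrakk>t \<in> realize Q; t' \<in> realize Q\<rbrakk> \<Longrightarrow> path_image (seg t t') \<subseteq> realize Q"
  using realize_mix by (auto simp: path_image_def seg_def)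

lemma homotopic_in_cube:
  assumes "path p" "path q" "pathstart p = pathstart q" "pathfinish p = pathfinish q"
    "Q \<in> cubes" "path_image p \<subseteq> realize Q" "path_image q \<subseteq> realize Q"
  shows "homotopic_paths Z p q"
  unfolding homotopic_paths
proof (intro exI conjI)
  let ?h = "\<lambda>x. mix (fst x) (p (snd x)) (q (snd x))"
  have c: "continuous_on ({0..1} \<times> {0..1}) (\<lambda>x. r (snd x))" if "path r" for r :: "real \<Rightarrow> nat \<Rightarrow> 'a + 'b \<Rightarrow> real"
    using that unfolding path_def
    by (rule continuous_on_compose2[OF _ continuous_on_snd[OF continuous_on_id]]) auto
  show "continuous_on ({0..1} \<times> {0..1}) ?h"
    by (intro continuous_on_mix c assms continuous_intros)
  have "p t \<in> realize Q" "q t \<in> realize Q" if "t \<in> {0..1}" for t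
    using assms that unfolding path_image_def by blast+
  then show "?h \<in> {0..1} \<times> {0..1} \<rightarrow> Z" using realize_mix realize_Z[OF assms(5)] by auto
qed (use assms in \<open>auto simp: pathstart_def pathfinish_def\<close>)

text \<open>The straight contraction to \<open>pt v\<close> maps a square into the star; its side at
  parameter 1 is constant and is dropped.\<close>

lemma homotopic_in_star:
  assumes p: "path p" "path_image p \<subseteq> star v" and v: "v \<in> X"
  shows "homotopic_paths Z p (seg (pathstart p) (pt v) +++ seg (pt v) (pathfinish p))"
proof -
  let ?h = "\<lambda>x. mix (fst x) (p (snd x)) (pt v)"
  have mem: "p t \<in> star v" if "t \<in> {0..1}" for t using p(2) that unfolding path_image_def by blast
  have "homotopic_paths (star v) (\<lambda>t. ?h (0, t)) ((\<lambda>s. ?h (s, 0)) +++ ((\<lambda>t. ?h (1, t)) +++ (\<lambda>s. ?h (1 - s, 1))))"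
  proof (rule homotopic_paths_square)
    have "continuous_on ({0..1} \<times> {0..1}) (\<lambda>x. p (snd x))"
      using p(1) unfolding path_def
      by (rule continuous_on_compose2[OF _ continuous_on_snd[OF continuous_on_id]]) auto
    then show "continuous_on ({0..1} \<times> {0..1}) ?h" by (intro continuous_on_mix continuous_on_fst continuous_on_id continuous_on_const)
    show "?h \<in> {0..1} \<times> {0..1} \<rightarrow> star v" using mem star_mix[OF _ v] by auto
  qed
  then have "homotopic_paths (star v) p (seg (p 0) (pt v) +++ ((\<lambda>t. pt v) +++ seg (pt v) (p 1)))"
    by (simp add: mix_swap seg_def)
  also have "homotopic_paths (star v) \<dots> (seg (p 0) (pt v) +++ seg (pt v) (p 1))"
  proof (rule homotopic_paths_join)
    show "homotopic_paths (star v) ((\<lambda>t. pt v) +++ seg (pt v) (p 1)) (seg (pt v) (p 1))"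
      using mem[of 1] seg_star' v by (intro homotopic_paths_const_left) auto
    show "pathfinish (seg (p 0) (pt v)) = pathstart ((\<lambda>t. pt v) +++ seg (pt v) (p 1))"
      unfolding pathstart_join seg_ends by (simp add: pathstart_def)
  qed (use mem[of 0] seg_star v in auto)
  finally show ?thesis
    using homotopic_paths_subset[of "star v" _ _ Z] star_Z unfolding pathstart_def pathfinish_def by blast
qed

lemma cubeI:
  assumes "v \<in> X" "t \<in> X"
    and "\<And>i. i \<in> {1..n} \<Longrightarrow> v i = t i \<or> isl (v i) \<noteq> isl (t i)"
    and "\<And>y. y \<in> (\<Pi>\<^sub>E i\<in>{1..n}. {v i, t i}) \<Longrightarrow> y \<in> X"
  shows "(\<lambda>i\<in>{1..n}. {v i, t i}) \<in> cubes"
proof -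
  have "{v i, t i} \<in> join_cells (colour_class \<Gamma>A i) (colour_class \<Gamma>B i)" if "i \<in> {1..n}" for i
  proof (cases "v i = t i")
    case True
    then show ?thesis using X_cell[OF assms(1) that] by (auto simp: join_cells_def)
  next
    case False
    then have "isl (v i) \<noteq> isl (t i)" using assms(3) that by blast
    then show ?thesis using X_cell[OF assms(1) that] X_cell[OF assms(2) that]
      unfolding join_cells_def by (cases "v i"; cases "t i") (auto simp: insert_commute)
  qed
  moreover have "cube_vertices n (\<lambda>i\<in>{1..n}. {v i, t i}) = (\<Pi>\<^sub>E i\<in>{1..n}. {v i, t i})"
    unfolding cube_vertices_def by (intro PiE_cong) auto
  ultimately show ?thesis using assms(4) by (auto simp: coupled_link_cubes_def product_cubes_def)
qed

lemma X_ext: "x \<in> X \<Longrightarrow> y \<in> X \<Longrightarrow> (\<And>i. i \<in> {1..n} \<Longrightarrow> x i = y i) \<Longrightarrow> x = y"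
  unfolding X_iff by (meson PiE_ext)

lemma mixed_ext: "\<lbrakk>y \<in> (\<Pi>\<^sub>E i\<in>{1..n}. {v i, t i}); x \<in> X; \<And>i. i \<in> {1..n} \<Longrightarrow> y i = x i\<rbrakk> \<Longrightarrow> y \<in> X"
proof -
  assume a: "y \<in> (\<Pi>\<^sub>E i\<in>{1..n}. {v i, t i})" "x \<in> X" "\<And>i. i \<in> {1..n} \<Longrightarrow> y i = x i"
  have "y k = x k" for k
  proof (cases "k \<in> {1..n}")
    case False
    then show ?thesis using PiE_arb[OF a(1)] a(2) PiE_arb unfolding X_iff by metis
  qed (rule a(3))
  then have "y = x" by (rule ext)
  then show "y \<in> X" using a by simp
qed

lemma isl_source_target: "isl (source l) \<noteq> isl (target l)"
  by (cases l) auto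

text \<open>The cube is the box between \<open>v\<close> and the opposite corner \<open>t\<close>. A
  corner of the box is determined by its values at \<open>lcol l\<close> and \<open>lcol m\<close>,
  which leaves only \<open>v\<close>, \<open>u\<close>, \<open>u'\<close> and \<open>t\<close>, all
  of them vertices of the complex.\<close>

lemma square_cube:
  assumes "step v l u" "step u m t" "lind l m"
  shows "\<exists>Q\<in>cubes. v \<in> cube_vertices n Q \<and> target l \<in> Q (lcol l) \<and> target m \<in> Q (lcol m)"
proof -
  let ?i = "lcol l" and ?j = "lcol m"
  obtain u' where u': "step v m u'" "step u' l t" using step_swap[OF assms] by blast
  have ij: "?i \<noteq> ?j" using assms(3) by (rule lind_lcol)
  have s: "v \<in> X" "u \<in> X" "u' \<in> X" "t \<in> X" "v ?i = source l" "v ?j = source m"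
    "u = v(?i := target l)" "u' = v(?j := target m)" "t = v(?i := target l, ?j := target m)"
    and r: "?i \<in> {1..n}" "?j \<in> {1..n}"
    using assms(1,2) u'(1) proper_lcol by (auto simp: step_def)
  have "(\<lambda>i\<in>{1..n}. {v i, t i}) \<in> cubes"
  proof (rule cubeI[OF s(1,4)])
    fix i show "v i = t i \<or> isl (v i) \<noteq> isl (t i)"
      using s ij isl_source_target[of l] isl_source_target[of m] by auto
  next
    fix y assume y: "y \<in> (\<Pi>\<^sub>E i\<in>{1..n}. {v i, t i})"
    have yk: "y k = v k" if "k \<in> {1..n}" "k \<noteq> ?i" "k \<noteq> ?j" for k
      using PiE_mem[OF y that(1)] s(9) that by auto
    have "y ?i = v ?i \<or> y ?i = target l" "y ?j = v ?j \<or> y ?j = target m"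
      using PiE_mem[OF y r(1)] PiE_mem[OF y r(2)] s(9) ij by auto
    then consider "y ?i = v ?i" "y ?j = v ?j" | "y ?i = target l" "y ?j = v ?j"
      | "y ?i = v ?i" "y ?j = target m" | "y ?i = target l" "y ?j = target m" by blast
    then show "y \<in> X"
    proof cases
      case 1
      then show ?thesis using mixed_ext[OF y s(1)] yk by metis
    next
      case 2
      then show ?thesis using mixed_ext[OF y s(2)] yk s(7) ij by (metis fun_upd_apply)
    next
      case 3
      then show ?thesis using mixed_ext[OF y s(3)] yk s(8) ij by (metis fun_upd_apply)
    next
      case 4
      then show ?thesis using mixed_ext[OF y s(4)] yk s(9) ij by (metis fun_upd_apply)
    qed
  qed
  moreover have "v \<in> cube_vertices n (\<lambda>i\<in>{1..n}. {v i, t i})"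
    using s(1) unfolding cube_vertices_def X_iff by (auto simp: PiE_iff)
  ultimately show ?thesis using r s(9) ij by (intro bexI) auto
qed

lemma edge_cube:
  assumes "step v l u"
  shows "\<exists>Q\<in>cubes. v \<in> cube_vertices n Q \<and> target l \<in> Q (lcol l)"
proof -
  let ?i = "lcol l"
  have s: "v \<in> X" "u \<in> X" "v ?i = source l" "u = v(?i := target l)" and r: "?i \<in> {1..n}"
    using assms proper_lcol by (auto simp: step_def)
  have "(\<lambda>i\<in>{1..n}. {v i, u i}) \<in> cubes"
  proof (rule cubeI[OF s(1,2)])
    fix i show "v i = u i \<or> isl (v i) \<noteq> isl (u i)"
      using s isl_source_target[of l] by auto
  next
    fix y assume y: "y \<in> (\<Pi>\<^sub>E i\<in>{1..n}. {v i, u i})"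
    have yk: "y k = v k" if "k \<in> {1..n}" "k \<noteq> ?i" for k
      using PiE_mem[OF y that(1)] s that by auto
    have "y ?i = v ?i \<or> y ?i = target l" using PiE_mem[OF y r(1)] s by auto
    then show "y \<in> X"
    proof
      assume "y ?i = v ?i"
      then show ?thesis using mixed_ext[OF y s(1)] yk by metis
    next
      assume "y ?i = target l"
      then show ?thesis using mixed_ext[OF y s(2)] yk s(4) by (metis fun_upd_apply)
    qed
  qed
  moreover have "v \<in> cube_vertices n (\<lambda>i\<in>{1..n}. {v i, u i})"
    using s(1) unfolding cube_vertices_def X_iff by (auto simp: PiE_iff)
  ultimately show ?thesis using r s(4) by (intro bexI) auto
qed

lemma step_cube: "\<lbrakk>step v l u; v \<in> cube_vertices n Q; target l \<in> Q (lcol l)\<rbrakk> \<Longrightarrow> u \<in> cube_vertices n Q"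
  using proper_lcol[of l] unfolding step_def cube_vertices_def by (auto simp: PiE_iff extensional_def)

lemma cube_upd: "\<lbrakk>v \<in> cube_vertices n Q; i \<in> {1..n}; z \<in> Q i\<rbrakk> \<Longrightarrow> v(i := z) \<in> cube_vertices n Q"
  unfolding cube_vertices_def by (auto simp: PiE_iff extensional_def)

section \<open>Edge paths as topological paths\<close>

fun epath :: "(nat \<Rightarrow> 'a + 'b) \<Rightarrow> ('a, 'b) letter list \<Rightarrow> real \<Rightarrow> nat \<Rightarrow> 'a + 'b \<Rightarrow> real" where
  "epath v [] = (\<lambda>_. pt v)"
| "epath v (l # w) = seg (pt v) (pt (v(lcol l := target l))) +++ epath (v(lcol l := target l)) w"

lemma epath_step: "step v l x \<Longrightarrow> epath v (l # w) = seg (pt v) (pt x) +++ epath x w"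
  by (simp add: step_def)

lemma pathstart_epath [simp]: "pathstart (epath v w) = pt v"
  by (cases w) (auto simp: pathstart_def[of "\<lambda>_. pt v"])

lemma path_epath [simp]: "path (epath v w)"
  by (induction w arbitrary: v) (simp_all add: path_def[of "\<lambda>_. pt _"])

lemma pathfinish_epath: "walk v w u \<Longrightarrow> pathfinish (epath v w) = pt u"
proof (induction w arbitrary: v)
  case Nil
  then show ?case by (simp add: pathfinish_def)
qed (auto simp: step_def)

lemma epath_cube:
  assumes "walk v w u" "Q \<in> cubes" "v \<in> cube_vertices n Q" "\<And>l. l \<in> set w \<Longrightarrow> target l \<in> Q (lcol l)"
  shows "path_image (epath v w) \<subseteq> realize Q"
  using assms(1,3,4)
proof (induction w arbitrary: v)
  case Nil
  then show ?case using pt_realize assms(2) by (auto simp: path_image_def)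
next
  case (Cons l w)
  then obtain x where x: "step v l x" "walk x w u" by auto
  have xQ: "x \<in> cube_vertices n Q" using step_cube[OF x(1)] Cons.prems by simp
  then have "path_image (epath x w) \<subseteq> realize Q" using Cons x by simp
  moreover have "path_image (seg (pt v) (pt x)) \<subseteq> realize Q"
    using pt_realize assms(2) Cons.prems xQ by (intro realize_seg) auto
  ultimately show ?case by (simp add: epath_step[OF x(1)] path_image_join del: epath.simps)
qed

lemma seg_step_Z: "step v l u \<Longrightarrow> path_image (seg (pt v) (pt u)) \<subseteq> Z"
proof -
  assume s: "step v l u"
  then obtain Q where Q: "Q \<in> cubes" "v \<in> cube_vertices n Q" "target l \<in> Q (lcol l)" using edge_cube by blast
  moreover have "u \<in> cube_vertices n Q" using step_cube s Q by blast
  ultimately show ?thesis using realize_seg pt_realize realize_Z by (meson subset_iff)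
qed

lemma epath_Z: "walk v w u \<Longrightarrow> path_image (epath v w) \<subseteq> Z"
proof (induction w arbitrary: v)
  case Nil
  then show ?case using pt_star star_Z by (auto simp: path_image_def)
next
  case (Cons l w)
  then obtain x where x: "step v l x" "walk x w u" by auto
  then show ?case using Cons.IH[OF x(2)] seg_step_Z[OF x(1)]
    by (simp add: epath_step[OF x(1)] path_image_join del: epath.simps)
qed

lemma epath_append:
  "walk v w u \<Longrightarrow> walk u w' t \<Longrightarrow> homotopic_paths Z (epath v (w @ w')) (epath v w +++ epath u w')"
proof (induction w arbitrary: v)
  case Nil
  then show ?case
    using homotopic_paths_const_left[OF path_epath epath_Z[OF Nil.prems(2)]] by (simp add: homotopic_paths_sym)
next
  case (Cons l w)
  then obtain x where x: "step v l x" "walk x w u" by auto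
  note Z = seg_step_Z[OF x(1)] epath_Z[OF x(2)] epath_Z[OF Cons.prems(2)]
  have "homotopic_paths Z (seg (pt v) (pt x) +++ epath x (w @ w')) (seg (pt v) (pt x) +++ (epath x w +++ epath u w'))"
    using Cons.IH[OF x(2) Cons.prems(2)] Z by (intro homotopic_paths_join) auto
  also have "homotopic_paths Z \<dots> ((seg (pt v) (pt x) +++ epath x w) +++ epath u w')"
    using Z pathfinish_epath[OF x(2)] by (intro homotopic_paths_assoc) auto
  finally show ?case by (simp add: epath_step[OF x(1)] del: epath.simps)
qed

lemma epath_same_cube:
  assumes "walk v w u" "walk v w' u" "Q \<in> cubes" "v \<in> cube_vertices n Q"
    "\<And>l. l \<in> set w \<union> set w' \<Longrightarrow> target l \<in> Q (lcol l)"
  shows "homotopic_paths Z (epath v w) (epath v w')"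
  using assms pathfinish_epath[OF assms(1)] pathfinish_epath[OF assms(2)] epath_cube
  by (intro homotopic_in_cube[OF _ _ _ _ assms(3)]) auto

lemma epath_cong_append:
  assumes "walk v w x" "walk v w' x" "walk x y u" "homotopic_paths Z (epath v w) (epath v w')"
  shows "homotopic_paths Z (epath v (w @ y)) (epath v (w' @ y))"
proof -
  have "homotopic_paths Z (epath v w +++ epath x y) (epath v w' +++ epath x y)"
    using assms(4) epath_Z[OF assms(3)] pathfinish_epath[OF assms(1)] by (intro homotopic_paths_join) auto
  then show ?thesis
    using epath_append[OF assms(1,3)] epath_append[OF assms(2,3)] homotopic_paths_trans homotopic_paths_sym by blast
qed

lemma epath_Cons_cong:
  assumes "step v l x" "homotopic_paths Z (epath x w) (epath x w')"
  shows "homotopic_paths Z (epath v (l # w)) (epath v (l # w'))"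
proof -
  have "homotopic_paths Z (seg (pt v) (pt x) +++ epath x w) (seg (pt v) (pt x) +++ epath x w')"
    using assms(2) seg_step_Z[OF assms(1)] by (intro homotopic_paths_join) auto
  then show ?thesis by (simp add: epath_step[OF assms(1)] del: epath.simps)
qed

text \<open>A swap replaces two sides of a square by the other two, and both lie in one convex
  cube.\<close>

lemma epath_ceq: "w \<asymp> w' \<Longrightarrow> walk v w u \<Longrightarrow> homotopic_paths Z (epath v w) (epath v w')"
proof (induction arbitrary: v rule: ceq.induct)
  case (ceq_refl w)
  then show ?case using epath_Z by simp
next
  case (ceq_swap l m w)
  then obtain x t where st: "step v l x" "step x m t" "walk t w u" by auto
  obtain x' where x': "step v m x'" "step x' l t" using step_swap[OF st(1,2) ceq_swap(1)] by blast
  obtain Q where Q: "Q \<in> cubes" "v \<in> cube_vertices n Q" "target l \<in> Q (lcol l)" "target m \<in> Q (lcol m)"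
    using square_cube[OF st(1,2) ceq_swap(1)] by blast
  have w: "walk v [l, m] t" "walk v [m, l] t" using st x' by (auto simp: step_def)
  have "homotopic_paths Z (epath v [l, m]) (epath v [m, l])"
    using Q by (intro epath_same_cube[OF w]) auto
  then show ?case using epath_cong_append[OF w st(3)] by simp
next
  case (ceq_Cons w w' l)
  then obtain x where "step v l x" "walk x w u" by auto
  then show ?case using ceq_Cons.IH epath_Cons_cong by blast
next
  case (ceq_trans w w' x)
  then show ?case using walk_ceq homotopic_paths_trans by blast
qed

lemma epath_cancel:
  assumes "step v l x" "walk v w u"
  shows "homotopic_paths Z (epath v (l # flip l # w)) (epath v w)"
proof -
  obtain Q where Q: "Q \<in> cubes" "v \<in> cube_vertices n Q" "target l \<in> Q (lcol l)"
    using edge_cube[OF assms(1)] by blast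
  have "walk v [l, flip l] v" using assms(1) step_flip[OF assms(1)] by (auto simp: step_def)
  moreover have "walk v [] v" using assms(1) by (simp add: step_def)
  moreover have "source l \<in> Q (lcol l)"
    using Q(2) assms(1) proper_lcol unfolding cube_vertices_def step_def by (metis PiE_mem)
  ultimately have "homotopic_paths Z (epath v ([l, flip l] @ w)) (epath v ([] @ w))"
    using Q by (intro epath_cong_append[OF _ _ assms(2)] epath_same_cube[of v _ v _ Q]) auto
  then show ?thesis by simp
qed

lemma epath_nf: "walk v w u \<Longrightarrow> homotopic_paths Z (epath v w) (epath v (nf w))"
proof (induction w arbitrary: v)
  case Nil
  then show ?case using epath_Z[of v "[]"] path_epath[of v "[]"] by simp
next
  case (Cons l w)
  then obtain x where x: "step v l x" "walk x w u" by auto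
  have "homotopic_paths Z (epath v (l # w)) (epath v (l # nf w))"
    using epath_Cons_cong[OF x(1)] Cons.IH[OF x(2)] by blast
  also have "homotopic_paths Z (epath v (l # nf w)) (epath v (mul l (nf w)))"
  proof (cases "del (flip l) (nf w)")
    case None
    have "walk v (l # nf w) u" using x walk_nf by auto
    then show ?thesis using None epath_Z[of v "l # nf w" u] by (auto simp: mul_def simp del: epath.simps)
  next
    case (Some w')
    have d: "nf w \<asymp> flip l # w'" using del_imp_ceq[OF Some] .
    have wx: "walk x (flip l # w') u" using walk_ceq[OF d walk_nf[OF x(2)]] .
    then have "walk v w' u" using x(1) step_flip[OF x(1)] by (auto simp: step_def)
    then have "homotopic_paths Z (epath v (l # flip l # w')) (epath v w')" using epath_cancel x(1) by blast
    moreover have "homotopic_paths Z (epath v (l # nf w)) (epath v (l # flip l # w'))"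
      using epath_Cons_cong[OF x(1)] epath_ceq[OF d walk_nf[OF x(2)]] by blast
    ultimately show ?thesis using Some homotopic_paths_trans by (simp add: mul_def)
  qed
  finally show ?case by simp
qed

text \<open>A derivation of \<open>w \<sim> w'\<close> may pass through words that are not edge
  paths from \<open>v\<close>. Normal forms avoid this: reducing \<open>w\<close> and
  \<open>w'\<close> preserves walks and homotopy classes, and the two normal forms differ by swaps
  only, which do so as well.\<close>

lemma epath_geq:
  assumes "walk v w u" "walk v w' u" "w \<sim> w'"
  shows "homotopic_paths Z (epath v w) (epath v w')"
  using epath_nf[OF assms(1)] epath_nf[OF assms(2)] epath_ceq[OF nf_geq[OF assms(3)] walk_nf[OF assms(1)]]
  by (meson homotopic_paths_sym homotopic_paths_trans)

end

subsection \<open>Words read off paths\<close>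

context trace_letters
begin

lemma ceq_commute: "\<forall>l\<in>set x. \<forall>m\<in>set y. ind l m \<Longrightarrow> x @ y \<asymp> y @ x"
proof (induction x)
  case (Cons l x)
  then have "l # x @ y \<asymp> l # y @ x" by (auto intro: ceq_Cons)
  also have "\<dots> \<asymp> y @ l # x" using Cons.prems by (intro ceq_sym[OF ceq_move]) auto
  finally show ?case by simp
qed simp

text \<open>Products over \<open>js\<close> multiply factor by factor when different factors
  commute; the factors will be the coordinates of a cube.\<close>

lemma geq_concat_zip:
  assumes "distinct js"
    and "\<And>i j l m. \<lbrakk>i \<in> set js; j \<in> set js; i \<noteq> j; l \<in> set (f i); m \<in> set (g j)\<rbrakk> \<Longrightarrow> ind l m"
    and "\<And>i. i \<in> set js \<Longrightarrow> f i @ g i \<sim> h i"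
  shows "concat (map f js) @ concat (map g js) \<sim> concat (map h js)"
  using assms
proof (induction js)
  case (Cons i js)
  let ?F = "concat (map f js)" and ?G = "concat (map g js)"
  have "?F @ g i \<asymp> g i @ ?F"
    using Cons.prems(1,2) by (intro ceq_commute) auto
  then have "f i @ (?F @ g i) @ ?G \<sim> f i @ (g i @ ?F) @ ?G"
    by (intro geq_append_left geq_append_right ceq_imp_geq)
  also have "\<dots> \<sim> (f i @ g i) @ (?F @ ?G)" by simp
  also have "\<dots> \<sim> h i @ concat (map h js)"
    using Cons by (intro geq_append) auto
  finally show ?case by simp
qed simp

end

section \<open>Transition words between vertices of a cube\<close>

context coloured_pair
begin

text \<open>Within a cell of a join two different values lie on different sides, so there the last
  equation applies to equal values only.\<close>

fun change :: "'a + 'b \<Rightarrow> 'a + 'b \<Rightarrow> ('a, 'b) letter list" where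
  "change (Inl a) (Inr b) = [(a, b, True)]"
| "change (Inr b) (Inl a) = [(a, b, False)]"
| "change _ _ = []"

lemma change_self [simp]: "change x x = []"
  by (cases x) auto

definition transit :: "(nat \<Rightarrow> 'a + 'b) \<Rightarrow> (nat \<Rightarrow> 'a + 'b) \<Rightarrow> ('a, 'b) letter list" where
  "transit v w = concat (map (\<lambda>i. change (v i) (w i)) [1..<Suc n])"

lemma transit_self [simp]: "transit v v = []"
  by (simp add: transit_def)

lemma cell_cases:
  assumes "Q \<in> cubes" "i \<in> {1..n}" "x \<in> Q i" "y \<in> Q i"
  obtains "x = y" | a b where "x = Inl a" "y = Inr b" "Q i = {Inl a, Inr b}"
  | a b where "x = Inr b" "y = Inl a" "Q i = {Inl a, Inr b}"
proof -
  consider p where "Q i = {p}" | a b where "Q i = {Inl a, Inr b}"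
    using cube_cell[OF assms(1,2)] unfolding join_cells_def by blast
  then show ?thesis
  proof cases
    case 1
    then show ?thesis using that(1) assms(3,4) by simp
  next
    case (2 a b)
    then consider "x = y" | "x = Inl a" "y = Inr b" | "x = Inr b" "y = Inl a" using assms(3,4) by auto
    then show ?thesis using that 2 by cases blast+
  qed
qed

lemma cell_colour:
  assumes "Q \<in> cubes" "i \<in> {1..n}" "x \<in> Q i"
  shows "x \<in> cells i"
proof -
  consider x' where "Q i = {x'}" "x' \<in> cells i"
    | a b where "Q i = {Inl a, Inr b}" "a \<in> colour_class \<Gamma>A i" "b \<in> colour_class \<Gamma>B i"
    using cube_cell[OF assms(1,2)] unfolding join_cells_def by blast
  then show ?thesis using assms(3) by cases auto
qed

lemma change_cell:
  assumes "Q \<in> cubes" "i \<in> {1..n}" "x \<in> Q i" "y \<in> Q i" "l \<in> set (change x y)"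
  shows "source l = x" "target l = y" "lcol l = i" "proper_letter l" "x \<noteq> y"
    "Inl (fst l) \<in> Q i" "Inr (fst (snd l)) \<in> Q i"
proof -
  obtain a b where ab: "x = Inl a \<and> y = Inr b \<and> l = (a, b, True) \<or> x = Inr b \<and> y = Inl a \<and> l = (a, b, False)"
    using assms(5) by (cases x; cases y) auto
  then have Q: "Inl a \<in> Q i" "Inr b \<in> Q i" using assms(3,4) by auto
  then have "Inl a \<in> cells i" "Inr b \<in> cells i" using cell_colour assms(1,2) by blast+
  then have "a \<in> colour_class \<Gamma>A i" "b \<in> colour_class \<Gamma>B i" by auto
  then show "lcol l = i" "proper_letter l" using ab by (auto simp: lcol_def proper_letter_def colour_class_def)
  show "source l = x" "target l = y" "x \<noteq> y" "Inl (fst l) \<in> Q i" "Inr (fst (snd l)) \<in> Q i"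
    using ab Q by auto
qed

lemma change_change:
  assumes "Q \<in> cubes" "i \<in> {1..n}" "x \<in> Q i" "y \<in> Q i" "z \<in> Q i"
  shows "change x y @ change y z \<sim> change x z"
proof -
  have c: "[(a, b, True), (a, b, False)] \<sim> []" "[(a, b, False), (a, b, True)] \<sim> []" for a b
    using geq_cancel[of "(a, b, True)" "[]"] geq_cancel[of "(a, b, False)" "[]"] by simp_all
  consider p where "Q i = {p}" | a b where "Q i = {Inl a, Inr b}"
    using cube_cell[OF assms(1,2)] unfolding join_cells_def by blast
  then show ?thesis
  proof cases
    case 1
    then show ?thesis using assms(3-5) by simp
  next
    case (2 a b)
    then show ?thesis using assms(3-5) c[of a b] by auto
  qed
qed

text \<open>The coordinates of a vertex of a cube can be chosen freely, so every pair of values from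
  \<open>Q i\<close> and \<open>Q j\<close> occurs at a vertex of the complex and is compatible.
  Applied to both sides, this gives adjacency in both complexes.\<close>

lemma change_ind:
  assumes "Q \<in> cubes" "i \<in> {1..n}" "j \<in> {1..n}" "i \<noteq> j"
    "x \<in> Q i" "y \<in> Q i" "x' \<in> Q j" "y' \<in> Q j" "l \<in> set (change x y)" "m \<in> set (change x' y')"
  shows "lind l m"
proof -
  note l = change_cell[OF assms(1,2,5,6,9)] and m = change_cell[OF assms(1,3,7,8,10)]
  obtain v where v: "v \<in> cube_vertices n Q" using cell_ex assms(1) by blast
  have "compat z z'" if "z \<in> Q i" "z' \<in> Q j" for z z'
  proof -
    have "v(i := z, j := z') \<in> cube_vertices n Q" using cube_upd assms(2,3) that v by blast
    then have "v(i := z, j := z') \<in> X" using cube_vertices_X assms(1) by blast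
    then show ?thesis using X_compat[of "v(i := z, j := z')" i j] assms(2-4) by simp
  qed
  then have "compat (Inl (fst l)) (Inl (fst m))" "compat (Inr (fst (snd l))) (Inr (fst (snd m)))"
    using l m by blast+
  then show ?thesis by (cases l; cases m) auto
qed

lemma cube_vertexD: "v \<in> cube_vertices n Q \<Longrightarrow> i \<in> {1..n} \<Longrightarrow> v i \<in> Q i"
  unfolding cube_vertices_def by (rule PiE_mem)

text \<open>The cocycle identity on a cube: different coordinates commute, and within one coordinate
  a change followed by the change back cancels.\<close>

lemma transit_transit:
  assumes "Q \<in> cubes" "u \<in> cube_vertices n Q" "v \<in> cube_vertices n Q" "w \<in> cube_vertices n Q"
  shows "transit u v @ transit v w \<sim> transit u w"
  unfolding transit_def
proof (rule geq_concat_zip)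
  have r: "i \<in> {1..n}" if "i \<in> set [1..<Suc n]" for i using that by auto
  show "lind l m" if "i \<in> set [1..<Suc n]" "j \<in> set [1..<Suc n]" "i \<noteq> j"
    "l \<in> set (change (u i) (v i))" "m \<in> set (change (v j) (w j))" for i j l m
    using that cube_vertexD assms r by (intro change_ind[OF assms(1), of i j "u i" "v i" "v j" "w j"]) blast+
  show "change (u i) (v i) @ change (v i) (w i) \<sim> change (u i) (w i)" if "i \<in> set [1..<Suc n]" for i
    using that cube_vertexD assms r by (intro change_change[OF assms(1), of i]) blast+
qed simp

lemma transit_target:
  assumes "Q \<in> cubes" "u \<in> cube_vertices n Q" "v \<in> cube_vertices n Q" "l \<in> set (transit u v)"
  shows "target l \<in> Q (lcol l)"
proof -
  obtain i where "i \<in> set [1..<Suc n]" and i2: "l \<in> set (change (u i) (v i))"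
    using assms(4) unfolding transit_def set_concat set_map by blast
  then have i: "i \<in> {1..n}" "l \<in> set (change (u i) (v i))" by auto
  then show ?thesis using change_cell[OF assms(1) i(1) _ _ i(2)] cube_vertexD assms by metis
qed

lemma walk_transit:
  assumes "Q \<in> cubes" "u \<in> cube_vertices n Q" "v \<in> cube_vertices n Q"
  shows "walk u (transit u v) v"
proof -
  \<comment> \<open>Generalized to a vertex \<open>y\<close> at which part of the coordinates may
    already have been changed; \<open>js\<close> lists those still to come.\<close>
  have "walk y (concat (map (\<lambda>i. change (u i) (v i)) js)) (\<lambda>i. if i \<in> set js then v i else y i)"
    if "distinct js" "set js \<subseteq> {1..n}" "y \<in> cube_vertices n Q" "\<forall>i\<in>set js. y i = u i" for js y
    using that
  proof (induction js arbitrary: y)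
    case Nil
    then show ?case using cube_vertices_X[OF assms(1)] by simp
  next
    case (Cons i js)
    then have i: "i \<in> {1..n}" and yi: "y i = u i" by auto
    define y' where "y' = y(i := v i)"
    have y': "y' \<in> cube_vertices n Q" unfolding y'_def using cube_upd Cons.prems i cube_vertexD assms by blast
    have eq: "(\<lambda>j. if j \<in> set (i # js) then v j else y j) = (\<lambda>j. if j \<in> set js then v j else y' j)"
      by (auto simp: y'_def)
    have "walk y' (concat (map (\<lambda>i. change (u i) (v i)) js)) (\<lambda>j. if j \<in> set js then v j else y' j)"
    proof (rule Cons.IH)
      show "\<forall>j\<in>set js. y' j = u j" using Cons.prems by (auto simp: y'_def)
    qed (use Cons.prems y' in auto)
    moreover have "walk y (change (u i) (v i)) y'"
    proof (cases "change (u i) (v i)")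
      case Nil
      have "u i = v i"
        by (rule cell_cases[OF assms(1) i cube_vertexD[OF assms(2) i] cube_vertexD[OF assms(3) i]])
          (use Nil in auto)
      then have "y' = y" using yi by (metis y'_def fun_upd_triv)
      then show ?thesis using Nil cube_vertices_X[OF assms(1)] Cons.prems by simp
    next
      case (Cons l w)
      then have "l \<in> set (change (u i) (v i))" by simp
      note c = change_cell[OF assms(1) i cube_vertexD[OF assms(2) i] cube_vertexD[OF assms(3) i] this]
      have "w = []" using Cons by (cases "u i"; cases "v i") auto
      moreover have "step y l y'" unfolding step_def
        using c yi cube_vertices_X[OF assms(1)] y' \<open>y \<in> cube_vertices n Q\<close> by (simp add: y'_def)
      ultimately show ?thesis using Cons cube_vertices_X[OF assms(1) y'] by auto
    qed
    ultimately show ?case unfolding eq list.map concat.simps walk_append by blast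
  qed
  moreover have "distinct [1..<Suc n]" "set [1..<Suc n] \<subseteq> {1..n}" by auto
  ultimately have *: "walk u (transit u v) (\<lambda>i. if i \<in> set [1..<Suc n] then v i else u i)" (is "walk _ _ ?v")
    using assms(2) unfolding transit_def by blast
  have "?v = v"
    by (rule X_ext) (use walk_in_X[OF *] cube_vertices_X[OF assms(1,3)] in auto)
  with * show ?thesis by simp
qed

lemma transit_step: "step v l u \<Longrightarrow> transit v u = [l]"
proof -
  assume s: "step v l u"
  have "source l = Inl (fst l) \<and> target l = Inr (fst (snd l)) \<and> snd (snd l)
     \<or> source l = Inr (fst (snd l)) \<and> target l = Inl (fst l) \<and> \<not> snd (snd l)" by (cases l) auto
  then have c: "change (source l) (target l) = [l]" by (cases l) auto
  have "concat (map (\<lambda>i. change (v i) (u i)) js) = (if lcol l \<in> set js then [l] else [])" if "distinct js" for js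
    using that s c by (induction js) (auto simp: step_def)
  from this[of "[1..<Suc n]"] show ?thesis unfolding transit_def using s proper_lcol[of l] by (auto simp: step_def)
qed

text \<open>Any cube containing \<open>t\<close> will do, since the positive weights of
  \<open>t\<close> sit at vertices of that cube. It makes the cocycle identity available wherever
  three stars overlap.\<close>

lemma star_common_cube:
  assumes "t \<in> star v"
  shows "\<exists>Q\<in>cubes. t \<in> realize Q \<and> (\<forall>w\<in>X. t \<in> star w \<longrightarrow> w \<in> cube_vertices n Q)"
proof -
  obtain Q where "Q \<in> cubes" "t \<in> realize Q" using star_Z[OF assms] unfolding Z_eq by blast
  then show ?thesis using star_cube by blast
qed

lemma transit_star:
  assumes "t \<in> star u" "t \<in> star v" "t \<in> star w" "u \<in> X" "v \<in> X" "w \<in> X"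
  shows "transit u v @ transit v w \<sim> transit u w"
proof -
  obtain Q where Q: "Q \<in> cubes" "\<forall>w\<in>X. t \<in> star w \<longrightarrow> w \<in> cube_vertices n Q"
    using star_common_cube[OF assms(1)] by blast
  show ?thesis by (rule transit_transit[OF Q(1)]) (use Q(2) assms in auto)
qed

text \<open>The word read off a path on \<open>{a..b}\<close> that is cut into pieces lying in open stars. It is the
  monodromy of the covering of the complex by the complex of reduced words.\<close>

inductive reads :: "(real \<Rightarrow> nat \<Rightarrow> 'a + 'b \<Rightarrow> real) \<Rightarrow> real \<Rightarrow> real \<Rightarrow> (nat \<Rightarrow> 'a + 'b)
    \<Rightarrow> ('a, 'b) letter list \<Rightarrow> (nat \<Rightarrow> 'a + 'b) \<Rightarrow> bool" for p where
  reads_base: "\<lbrakk>a \<le> b; v \<in> X; p ` {a..b} \<subseteq> star v\<rbrakk> \<Longrightarrow> reads p a b v [] v"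
| reads_step: "\<lbrakk>reads p a b v w u; u' \<in> X; b \<le> c; p ` {b..c} \<subseteq> star u'\<rbrakk>
    \<Longrightarrow> reads p a c v (w @ transit u u') u'"

lemma reads_ends: "reads p a b v w u \<Longrightarrow> a \<le> b \<and> v \<in> X \<and> u \<in> X \<and> p a \<in> star v \<and> p b \<in> star u"
proof (induction rule: reads.induct)
  case (reads_step a b v w u u' c)
  then show ?case by (auto simp: image_subset_iff)
qed (auto simp: image_subset_iff)

lemma reads_walk: "reads p a b v w u \<Longrightarrow> walk v w u"
proof (induction rule: reads.induct)
  case (reads_step a b v w u u' c)
  have e: "p b \<in> star u" "u \<in> X" using reads_ends reads_step by blast+
  have "p b \<in> star u'" using reads_step by (auto simp: image_subset_iff)
  obtain Q where Q: "Q \<in> cubes" "\<forall>w\<in>X. p b \<in> star w \<longrightarrow> w \<in> cube_vertices n Q"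
    using star_common_cube[OF e(1)] by blast
  then have "u \<in> cube_vertices n Q" "u' \<in> cube_vertices n Q"
    using e(2) reads_step(2) \<open>p b \<in> star u\<close> \<open>p b \<in> star u'\<close> by simp_all
  then have "walk u (transit u u') u'" by (rule walk_transit[OF Q(1)])
  then show ?case using reads_step.IH unfolding walk_append by blast
qed simp

lemma reads_point: "p a \<in> star v \<Longrightarrow> v \<in> X \<Longrightarrow> reads p a a v [] v"
  by (intro reads_base) auto

text \<open>If the cut falls inside a piece, a transition to \<open>x\<close> ends the first part
  and the transition back starts the second; they cancel because the cut point lies in both
  stars.\<close>

lemma reads_split:
  assumes "reads p a b v w u" "a \<le> c" "c \<le> b" "p c \<in> star x" "x \<in> X"
  shows "\<exists>w1 w2. reads p a c v w1 x \<and> reads p c b x w2 u \<and> w \<sim> w1 @ w2"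
  using assms
proof (induction rule: reads.induct)
  case (reads_base a b v)
  have pc: "p c \<in> star v" using reads_base by auto
  have "{a..c} \<subseteq> {a..b}" "{c..b} \<subseteq> {a..b}" using reads_base by auto
  then have sub: "p ` {a..c} \<subseteq> star v" "p ` {c..b} \<subseteq> star v" using reads_base(3) by blast+
  have "reads p a c v [] v" using sub reads_base by (intro reads.reads_base) auto
  then have 1: "reads p a c v ([] @ transit v x) x" by (rule reads_step) (use reads_base in auto)
  have "reads p c c x [] x" using reads_point reads_base by blast
  then have 2: "reads p c b x ([] @ transit x v) v" by (rule reads_step) (use sub reads_base in auto)
  have "transit v x @ transit x v \<sim> transit v v"
    using transit_star[of "p c" v x v] pc reads_base by blast
  then show ?case using 1 2 by (metis append_Nil geq_sym transit_self)
next
  case (reads_step a b v w u u' d)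
  show ?case
  proof (cases "c \<le> b")
    case True
    then obtain w1 w2 where w: "reads p a c v w1 x" "reads p c b x w2 u" "w \<sim> w1 @ w2"
      using reads_step.IH reads_step.prems by blast
    have "reads p c d x (w2 @ transit u u') u'" using reads.reads_step w(2) reads_step by blast
    moreover have "w @ transit u u' \<sim> w1 @ w2 @ transit u u'" using geq_append_right[OF w(3)] by simp
    ultimately show ?thesis using w(1) by blast
  next
    case False
    have e: "p b \<in> star u" "u \<in> X" using reads_ends reads_step(1) by blast+
    have "{b..c} \<subseteq> {b..d}" "{c..d} \<subseteq> {b..d}" "c \<in> {b..d}" using reads_step False by auto
    then have sub: "p ` {b..c} \<subseteq> star u'" "p ` {c..d} \<subseteq> star u'" "p c \<in> star u'" using reads_step(4) by blast+
    have "b \<le> c" using False by simp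
    note h = reads.reads_step[OF reads_step(1,2) this sub(1)]
    have 1: "reads p a c v ((w @ transit u u') @ transit u' x) x"
      by (rule reads.reads_step[OF h]) (use reads_step.prems in auto)
    have "reads p c c x [] x" using reads_point reads_step.prems by blast
    then have 2: "reads p c d x ([] @ transit x u') u'"
      by (rule reads.reads_step) (use sub reads_step in auto)
    have "transit u' x @ transit x u' \<sim> transit u' u'"
      using transit_star[of "p c" u' x u'] sub reads_step by blast
    then have "(w @ transit u u') @ transit u' x @ transit x u' \<sim> (w @ transit u u') @ []"
      by (intro geq_append_left) simp
    then have "w @ transit u u' \<sim> ((w @ transit u u') @ transit u' x) @ [] @ transit x u'"
      by (simp add: geq_sym)
    then show ?thesis using 1 2 by blast
  qed
qed

text \<open>Every cut point lies in the stars of its two neighbouring pieces and in that of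
  \<open>x\<close>, so the cocycle identity telescopes.\<close>

lemma reads_in_star:
  assumes "reads p a b v w u" "p ` {a..b} \<subseteq> star x" "x \<in> X"
  shows "transit v x \<sim> w @ transit u x"
  using assms
proof (induction rule: reads.induct)
  case (reads_base a b v)
  show ?case by simp
next
  case (reads_step a b v w u u' c)
  have ab: "a \<le> b" using reads_ends reads_step(1) by blast
  then have "{a..b} \<subseteq> {a..c}" "b \<in> {a..c}" "b \<in> {b..c}" using reads_step by auto
  then have sub: "p ` {a..b} \<subseteq> star x" "p b \<in> star x" "p b \<in> star u'" using reads_step by blast+
  have e: "p b \<in> star u" "u \<in> X" using reads_ends reads_step(1) by blast+
  have "transit v x \<sim> w @ transit u x" using reads_step sub by blast
  also have "\<dots> \<sim> w @ transit u u' @ transit u' x"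
  proof (rule geq_append_left, rule geq_sym)
    show "transit u u' @ transit u' x \<sim> transit u x"
      using transit_star[of "p b" u u' x] sub e reads_step by blast
  qed
  finally show ?case by simp
qed

text \<open>Induction on one reading, splitting the other at the last cut point of the first. Up to
  transitions at the two ends, the group element read does not depend on the subdivision or on the
  stars chosen.\<close>

lemma reads_unique:
  assumes "reads p a b v' w' u'" "reads p a b v w u"
  shows "transit v v' @ w' \<sim> w @ transit u u'"
  using assms
proof (induction arbitrary: v w u rule: reads.induct)
  case (reads_base a b v')
  then show ?case using reads_in_star by simp
next
  case (reads_step a b v' w' x x' c)
  have ab: "a \<le> b" "p b \<in> star x" "x \<in> X" using reads_ends reads_step(1) by blast+
  obtain w1 w2 where w: "reads p a b v w1 x" "reads p b c x w2 u" "w \<sim> w1 @ w2"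
    using reads_split[OF reads_step.prems ab(1) reads_step(3) ab(2,3)] by blast
  have "transit v v' @ w' \<sim> w1 @ transit x x" using reads_step.IH w(1) by blast
  then have "transit v v' @ w' \<sim> w1" by simp
  then have "(transit v v' @ w') @ transit x x' \<sim> w1 @ transit x x'" by (rule geq_append_right)
  also have "\<dots> \<sim> w1 @ w2 @ transit u x'"
    using reads_in_star[OF w(2) reads_step(4,2)] by (rule geq_append_left)
  also have "\<dots> \<sim> w @ transit u x'" using geq_append_right[OF geq_sym[OF w(3)]] by simp
  finally show ?case by simp
qed

lemma reads_unique': "reads p a b v w' u \<Longrightarrow> reads p a b v w u \<Longrightarrow> w' \<sim> w"
  using reads_unique[of p a b v w' u v w u] by simp

lemma reads_concat:
  assumes "reads p b c u w' t" "reads p a b v w u"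
  shows "reads p a c v (w @ w') t"
  using assms
proof (induction rule: reads.induct)
  case (reads_base b c u)
  then show ?case using reads_step[of p a b v w u u c] by simp
next
  case (reads_step b d u w' x x' c)
  then show ?case using reads.reads_step[of p a d v "w @ w'" x x' c] by simp
qed

lemma reads_affine:
  assumes "reads p a b v w u" "k > 0" "\<And>x. x \<in> {a..b} \<Longrightarrow> q (k * x + d) = p x"
  shows "reads q (k * a + d) (k * b + d) v w u"
  using assms(1,3)
proof (induction rule: reads.induct)
  have img: "q ` {k * a + d..k * b + d} \<subseteq> S" if "p ` {a..b} \<subseteq> S" "\<And>x. x \<in> {a..b} \<Longrightarrow> q (k * x + d) = p x" for a b S
  proof clarify
    fix y assume "y \<in> {k * a + d..k * b + d}"
    then have y: "(y - d) / k \<in> {a..b}" using assms(2) by (simp add: field_simps)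
    have "y = k * ((y - d) / k) + d" using assms(2) by simp
    then have "q y = p ((y - d) / k)" using that(2)[OF y] by metis
    then show "q y \<in> S" using that(1) y by auto
  qed
  {
    case (reads_base a b v)
    then show ?case using assms(2) img[of a b] by (intro reads.reads_base) auto
  next
    case (reads_step a b v w u u' c)
    have "a \<le> b" using reads_ends reads_step(1) by blast
    then have r: "reads q (k * a + d) (k * b + d) v w u" using reads_step by auto
    have "q ` {k * b + d..k * c + d} \<subseteq> star u'"
      using reads_step \<open>a \<le> b\<close> by (intro img) auto
    moreover have "k * b + d \<le> k * c + d" using assms(2) reads_step(3) by simp
    ultimately show ?case using reads.reads_step[OF r reads_step(2)] by blast
  }
qed

lemma reads_join:
  assumes "reads p 0 1 v w u" "reads q 0 1 u w' t" "pathfinish p = pathstart q"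
  shows "reads (p +++ q) 0 1 v (w @ w') t"
proof -
  have "reads (p +++ q) (1/2 * 0 + 0) (1/2 * 1 + 0) v w u"
    using assms(1) by (rule reads_affine) (auto simp: joinpaths_def)
  moreover have "reads (p +++ q) (1/2 * 0 + 1/2) (1/2 * 1 + 1/2) u w' t"
    using assms(2)
  proof (rule reads_affine)
    fix x :: real assume "x \<in> {0..1}"
    then show "(p +++ q) (1/2 * x + 1/2) = q x"
      using assms(3) by (cases "x = 0") (auto simp: joinpaths_def pathfinish_def pathstart_def)
  qed simp
  ultimately show ?thesis using reads_concat[of "p +++ q" "1/2" 1 u w' t 0 v w] by simp
qed

text \<open>The preimages of the open stars cover the unit interval, and a subdivision finer than a
  Lebesgue number puts each piece into one star.\<close>

lemma reads_ex:
  assumes p: "path p" "path_image p \<subseteq> Z" and v: "v \<in> X" "pathstart p \<in> star v" and u: "u \<in> X" "pathfinish p \<in> star u"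
  shows "\<exists>w. reads p 0 1 v w u"
proof -
  have pc: "continuous_on {0..1} p" using p(1) by (simp add: path_def)
  have "\<exists>B. open B \<and> B \<inter> {0..1} = p -` star x \<inter> {0..1}" for x
  proof -
    obtain U where U: "open U" "star x = Z \<inter> U" using star_open by blast
    obtain B where "open B" "B \<inter> {0..1} = p -` U \<inter> {0..1}"
      using pc U(1) unfolding continuous_on_open_invariant by blast
    moreover have "p -` U \<inter> {0..1} = p -` star x \<inter> {0..1}" using U(2) p(2) by (auto simp: path_image_def)
    ultimately show ?thesis by auto
  qed
  then obtain B where B: "\<And>x. open (B x)" "\<And>x. B x \<inter> {0..1} = p -` star x \<inter> {0..1}" by metis
  have cover: "{0..1} \<subseteq> \<Union> (B ` X)"
  proof
    fix s :: real assume s: "s \<in> {0..1}"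
    then have "p s \<in> Z" using p(2) by (auto simp: path_image_def)
    then obtain x where "x \<in> X" "p s \<in> star x" using star_ex by blast
    then show "s \<in> \<Union> (B ` X)" using B(2)[of x] s by auto
  qed
  have ne: "B ` X \<noteq> {}" using v by blast
  have op: "open U" if "U \<in> B ` X" for U using that B(1) by blast
  obtain \<delta> where \<delta>: "0 < \<delta>" "\<And>T. \<lbrakk>T \<subseteq> {0..1}; diameter T < \<delta>\<rbrakk> \<Longrightarrow> \<exists>U \<in> B ` X. T \<subseteq> U"
    by (rule Lebesgue_number_lemma[OF compact_Icc ne cover op]) (assumption, rule that)
  obtain N :: nat where N: "1 / \<delta> < N" using reals_Archimedean2 by blast
  then have N0: "N > 0" using \<delta>(1) by (metis of_nat_0 gr0I less_asym zero_less_divide_1_iff)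
  have small: "\<exists>x\<in>X. p ` {k / N..(k + 1) / N} \<subseteq> star x" if "k < N" for k :: nat
  proof -
    let ?T = "{k / N..(k + 1) / N}"
    have T: "?T \<subseteq> {0..1}" using that N0 by (auto simp: field_simps)
    have "1 / N < \<delta>" using N N0 \<delta>(1) by (simp add: field_simps)
    moreover have "diameter ?T \<le> 1 / N"
    proof (rule diameter_le)
      fix x y assume "x \<in> ?T" "y \<in> ?T"
      then have "\<bar>x - y\<bar> \<le> (k + 1) / N - k / N" by auto
      then show "norm (x - y) \<le> 1 / N" by (simp add: diff_divide_distrib[symmetric])
    qed simp
    ultimately obtain x where "x \<in> X" "?T \<subseteq> B x" using \<delta>(2)[OF T] by auto
    then show ?thesis using B(2)[of x] T by blast
  qed
  have "k \<le> N \<Longrightarrow> \<exists>w x. reads p 0 (k / N) v w x" for k :: nat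
  proof (induction k)
    case 0
    then show ?case using reads_point[of p 0 v] v by (auto simp: pathstart_def)
  next
    case (Suc k)
    then obtain w x where wx: "reads p 0 (k / N) v w x" by auto
    obtain x' where "x' \<in> X" "p ` {k / N..(k + 1) / N} \<subseteq> star x'" using small[of k] Suc.prems by auto
    then have "reads p 0 ((k + 1) / N) v (w @ transit x x') x'"
      using N0 by (intro reads_step[OF wx]) (auto simp: divide_right_mono)
    then show ?case by (metis Suc_eq_plus1 of_nat_1 of_nat_add)
  qed
  from this[of N] obtain w x where "reads p 0 1 v w x" using N0 by auto
  \<comment> \<open>A degenerate last piece, the point 1 alone, changes the final star to the
    prescribed one.\<close>
  then have "reads p 0 1 v (w @ transit x u) u"
    by (rule reads_step) (use u in \<open>auto simp: pathfinish_def\<close>)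
  then show ?thesis by blast
qed

section \<open>Homotopy invariance of the word read off a path\<close>

lemma tube_star:
  fixes h :: "real \<times> real \<Rightarrow> nat \<Rightarrow> 'a + 'b \<Rightarrow> real"
  assumes h: "continuous_on ({0..1} \<times> {0..1}) h" "h \<in> {0..1} \<times> {0..1} \<rightarrow> Z"
    and s: "s \<in> {0..1}" and ab: "{a..b} \<subseteq> {0..1}" and sub: "(\<lambda>t. h (s, t)) ` {a..b} \<subseteq> star v"
  shows "\<forall>\<^sub>F s' in at s within {0..1}. (\<lambda>t. h (s', t)) ` {a..b} \<subseteq> star v"
proof -
  obtain U where U: "open U" "star v = Z \<inter> U" using star_open by blast
  obtain W where W: "open W" "W \<inter> ({0..1} \<times> {0..1}) = h -` U \<inter> ({0..1} \<times> {0..1})"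
    using h(1) U(1) unfolding continuous_on_open_invariant by blast
  have sW: "{s} \<times> {a..b} \<subseteq> W"
  proof clarify
    fix t assume t: "t \<in> {a..b}"
    then have "(s, t) \<in> {0..1} \<times> {0..1}" "h (s, t) \<in> U" using s ab sub U(2) by auto
    then show "(s, t) \<in> W" using W(2) by blast
  qed
  obtain X0 where X0: "s \<in> X0" "open X0" "X0 \<times> {a..b} \<subseteq> W"
    using Elementary_Topology.tube_lemma[OF compact_Icc W(1) sW] by blast
  have "(\<lambda>t. h (s', t)) ` {a..b} \<subseteq> star v" if "s' \<in> X0" "s' \<in> {0..1}" for s'
  proof clarify
    fix t assume t: "t \<in> {a..b}"
    then have "(s', t) \<in> W" "(s', t) \<in> {0..1} \<times> {0..1}" using X0(3) that ab by auto
    moreover from this have "h (s', t) \<in> Z" using h(2) by blast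
    ultimately show "h (s', t) \<in> star v" using W(2) U(2) by blast
  qed
  then show ?thesis using X0 unfolding eventually_at_topological by blast
qed

text \<open>By compactness of the pieces the same subdivision and the same stars serve for all
  nearby paths of the homotopy, so the very same word is read.\<close>

lemma reads_stable:
  fixes h :: "real \<times> real \<Rightarrow> nat \<Rightarrow> 'a + 'b \<Rightarrow> real"
  assumes h: "continuous_on ({0..1} \<times> {0..1}) h" "h \<in> {0..1} \<times> {0..1} \<rightarrow> Z" and s: "s \<in> {0..1}"
    and r: "reads (\<lambda>t. h (s, t)) a b v w u" "{a..b} \<subseteq> {0..1}"
  shows "\<forall>\<^sub>F s' in at s within {0..1}. reads (\<lambda>t. h (s', t)) a b v w u"
  using r
proof (induction rule: reads.induct)
  case (reads_base a b v)
  then show ?case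
    using eventually_mono[OF tube_star[OF h s reads_base(4,3)]] reads.reads_base by simp
next
  case (reads_step a b v w u u' c)
  have "a \<le> b" using reads_ends reads_step(1) by blast
  then have ab: "{a..b} \<subseteq> {0..1}" and bc: "{b..c} \<subseteq> {0..1}" using reads_step by auto
  have "\<forall>\<^sub>F s' in at s within {0..1}. reads (\<lambda>t. h (s', t)) a b v w u" using reads_step ab by blast
  moreover have "\<forall>\<^sub>F s' in at s within {0..1}. (\<lambda>t. h (s', t)) ` {b..c} \<subseteq> star u'"
    using tube_star[OF h s bc reads_step(4)] .
  ultimately show ?case
    by eventually_elim (rule reads.reads_step[OF _ reads_step(2,3)])
qed

lemma reads_cong: "reads p a b v w u \<Longrightarrow> (\<And>x. x \<in> {a..b} \<Longrightarrow> q x = p x) \<Longrightarrow> reads q a b v w u"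
  using reads_affine[of p a b v w u 1 q 0] by simp

text \<open>The class of the word is a locally constant function of the homotopy parameter, hence
  constant on the connected unit interval.\<close>

lemma reads_homotopic:
  assumes hom: "homotopic_paths Z p q" and p: "reads p 0 1 v w u" and q: "reads q 0 1 v w' u"
  shows "w \<sim> w'"
proof -
  obtain h where h: "continuous_on ({0..1} \<times> {0..1}) h" "h \<in> ({0..1} \<times> {0..1}) \<rightarrow> Z"
    "\<And>x. x \<in> {0..1} \<Longrightarrow> h (0, x) = p x" "\<And>x. x \<in> {0..1} \<Longrightarrow> h (1, x) = q x"
    "\<And>t. t \<in> {0..1::real} \<Longrightarrow> pathstart (h \<circ> Pair t) = pathstart p \<and> pathfinish (h \<circ> Pair t) = pathfinish p"
    using hom unfolding homotopic_paths by blast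
  \<comment> \<open>By uniqueness of readings this is one full \<open>geq\<close> class, so
    \<open>f\<close> involves no choice of a subdivision.\<close>
  define f where "f s = {x. \<exists>y. reads (\<lambda>t. h (s, t)) 0 1 v y u \<and> y \<sim> x}" for s
  have ends: "v \<in> X" "u \<in> X" "p 0 \<in> star v" "p 1 \<in> star u" using reads_ends[OF p] by auto
  have feq: "f s = {x. y \<sim> x}" if "reads (\<lambda>t. h (s, t)) 0 1 v y u" for s y
  proof (rule Set.set_eqI)
    fix x
    show "x \<in> f s \<longleftrightarrow> x \<in> {x. y \<sim> x}"
      unfolding f_def mem_Collect_eq using that reads_unique'[OF _ that] geq_trans geq_sym by blast
  qed
  have "f 0 = f 1"
  proof (rule connected_local_const[of "{0..1::real}"])
    show "\<forall>s\<in>{0..1}. \<forall>\<^sub>F s' in at s within {0..1}. f s = f s'"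
    proof
      fix s :: real assume s: "s \<in> {0..1}"
      have "path (\<lambda>t. h (s, t))" unfolding path_def
        using s by (intro continuous_on_compose2[OF h(1)] continuous_intros) auto
      moreover have "path_image (\<lambda>t. h (s, t)) \<subseteq> Z" using h(2) s by (auto simp: path_image_def)
      moreover have "h (s, 0) = p 0" "h (s, 1) = p 1"
        using h(5)[OF s] by (auto simp: pathstart_def pathfinish_def)
      ultimately obtain y where y: "reads (\<lambda>t. h (s, t)) 0 1 v y u"
        using reads_ex[of "\<lambda>t. h (s, t)" v u] ends by (auto simp: pathstart_def pathfinish_def)
      show "\<forall>\<^sub>F s' in at s within {0..1}. f s = f s'"
        using reads_stable[OF h(1,2) s y order_refl] by (rule eventually_mono) (use feq feq[OF y] in auto)
    qed
  qed auto
  moreover have "reads (\<lambda>t. h (0, t)) 0 1 v w u" "reads (\<lambda>t. h (1, t)) 0 1 v w' u"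
    using reads_cong[OF p] reads_cong[OF q] h(3,4) by auto
  ultimately show ?thesis using feq by (metis geq_refl geq_sym mem_Collect_eq)
qed

lemma reads_seg_star:
  assumes "t \<in> star v" "v \<in> X"
  shows "reads (seg t (pt v)) 0 1 v [] v" "reads (seg (pt v) t) 0 1 v [] v"
  using seg_star[OF assms] seg_star'[OF assms] assms(2) by (auto simp: path_image_def intro: reads_base)

text \<open>The first half of an edge lies in the star of its start and the second half in the star
  of its end, so a single transition is read, which is the letter itself.\<close>

lemma reads_seg_step:
  assumes "step v l u"
  shows "reads (seg (pt v) (pt u)) 0 1 v [l] u"
proof -
  let ?p = "seg (pt v) (pt u)"
  have vu: "v \<in> X" "u \<in> X" using assms by (auto simp: step_def)
  have Z: "?p s \<in> Z" if "s \<in> {0..1}" for s using seg_step_Z[OF assms] that by (auto simp: path_image_def)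
  have 1: "?p ` {0..1/2} \<subseteq> star v"
  proof clarify
    fix s :: real assume s: "s \<in> {0..1/2}"
    then have "?p s i (v i) > 0" if "i \<in> {1..n}" for i
      using that by (auto simp: seg_def mix_def pt_def)
    then show "?p s \<in> star v" using Z s by (simp add: star_def)
  qed
  have 2: "?p ` {1/2..1} \<subseteq> star u"
  proof clarify
    fix s :: real assume s: "s \<in> {1/2..1}"
    then have "?p s i (u i) > 0" if "i \<in> {1..n}" for i
      using that by (auto simp: seg_def mix_def pt_def)
    then show "?p s \<in> star u" using Z s by (simp add: star_def)
  qed
  have "reads ?p 0 (1/2) v [] v" using 1 vu by (intro reads_base) auto
  then have "reads ?p 0 1 v ([] @ transit v u) u" by (rule reads_step) (use 2 vu in auto)
  then show ?thesis using transit_step[OF assms] by simp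
qed

lemma reads_epath: "walk v w u \<Longrightarrow> reads (epath v w) 0 1 v w u"
proof (induction w arbitrary: v)
  case Nil
  then show ?case using pt_star by (auto intro: reads_base)
next
  case (Cons l w)
  then obtain x where x: "step v l x" "walk x w u" by auto
  have "reads (seg (pt v) (pt x) +++ epath x w) 0 1 v ([l] @ w) u"
    using reads_seg_step[OF x(1)] Cons.IH[OF x(2)] by (rule reads_join) simp
  then show ?case by (simp add: epath_step[OF x(1)] del: epath.simps)
qed

lemma seg_Z: "t \<in> star v \<Longrightarrow> v \<in> X \<Longrightarrow> path_image (seg t (pt v)) \<subseteq> Z \<and> path_image (seg (pt v) t) \<subseteq> Z"
  using seg_star seg_star' star_Z by blast

text \<open>Each piece is contracted towards the centre of its star. At a cut point, the segment
  arriving from \<open>pt u\<close> and the one leaving for \<open>pt u'\<close> lie in a common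
  cube, where they are replaced by the edge path of the transition word. Hence the word determines
  the homotopy class.\<close>

lemma reads_imp_epath:
  assumes "path p" "path_image p \<subseteq> Z" "reads p a b v w u" "0 \<le> a" "b \<le> 1"
  shows "homotopic_paths Z (p \<circ> linepath a b) (seg (p a) (pt v) +++ (epath v w +++ seg (pt u) (p b)))"
  using assms(3-5)
proof (induction rule: reads.induct)
  have sub: "path (p \<circ> linepath a b) \<and> path_image (p \<circ> linepath a b) = p ` {a..b}"
    if "0 \<le> a" "a \<le> b" "b \<le> 1" for a b
  proof -
    have "path_image (linepath a b) = {a..b}" using that by (simp add: closed_segment_eq_real_ivl)
    moreover from this have "path (p \<circ> linepath a b)"
      using that assms(1) by (intro path_continuous_image) (auto simp: path_def elim: continuous_on_subset)
    ultimately show ?thesis by (metis path_image_compose)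
  qed
  have ends: "pathstart (p \<circ> linepath a b) = p a" "pathfinish (p \<circ> linepath a b) = p b" for a b
    by (auto simp: pathstart_def pathfinish_def linepath_def)
  have base: "homotopic_paths Z (p \<circ> linepath a b) (seg (p a) (pt v) +++ seg (pt v) (p b))"
    if "0 \<le> a" "a \<le> b" "b \<le> 1" "v \<in> X" "p ` {a..b} \<subseteq> star v" for a b v
    using homotopic_in_star[of "p \<circ> linepath a b" v] sub[OF that(1-3)] that ends by simp
  {
    case (reads_base a b v)
    have st: "p a \<in> star v" "p b \<in> star v" using reads_base by auto
    have "homotopic_paths Z (p \<circ> linepath a b) (seg (p a) (pt v) +++ seg (pt v) (p b))"
      using base reads_base by blast
    also have "homotopic_paths Z \<dots> (seg (p a) (pt v) +++ ((\<lambda>_. pt v) +++ seg (pt v) (p b)))"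
    proof (rule homotopic_paths_join)
      show "homotopic_paths Z (seg (pt v) (p b)) ((\<lambda>_. pt v) +++ seg (pt v) (p b))"
        using seg_Z[OF st(2)] reads_base by (intro homotopic_paths_sym[OF homotopic_paths_const_left]) auto
    qed (use seg_Z[OF st(1)] reads_base in auto)
    finally show ?case by (simp only: epath.simps)
  next
    case (reads_step a b v w u u' c)
    have e: "a \<le> b" "v \<in> X" "u \<in> X" "p a \<in> star v" "p b \<in> star u" using reads_ends[OF reads_step(1)] by auto
    have e': "p b \<in> star u'" "p c \<in> star u'" "u' \<in> X" using reads_step by auto
    obtain Q where Q1: "Q \<in> cubes" "p b \<in> realize Q" "\<forall>w\<in>X. p b \<in> star w \<longrightarrow> w \<in> cube_vertices n Q"
      using star_common_cube[OF e(5)] by blast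
    then have Q: "Q \<in> cubes" "p b \<in> realize Q" "u \<in> cube_vertices n Q" "u' \<in> cube_vertices n Q"
      using e(3,5) e'(1,3) by simp_all
    have w: "walk v w u" using reads_walk reads_step(1) by blast
    have tr: "walk u (transit u u') u'" using walk_transit[OF Q(1,3,4)] .
    note Zs = seg_Z[OF e(4,2)] seg_Z[OF e(5,3)] seg_Z[OF e'(1,3)] seg_Z[OF e'(2,3)] epath_Z[OF w] epath_Z[OF tr]
    note fin = pathfinish_epath[OF w] pathfinish_epath[OF tr]
    let ?a = "seg (p a) (pt v)" and ?b = "epath v w" and ?c = "seg (pt u) (p b)" and ?d = "seg (p b) (pt u')"
      and ?e = "seg (pt u') (p c)"
    have "homotopic_paths Z ((p \<circ> linepath a b) +++ (p \<circ> linepath b c)) (p \<circ> linepath a c)"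
      using assms(1,2) e(1) reads_step by (intro homotopic_paths_join_subpaths) auto
    then have "homotopic_paths Z (p \<circ> linepath a c) ((p \<circ> linepath a b) +++ (p \<circ> linepath b c))"
      by (rule homotopic_paths_sym)
    also have "homotopic_paths Z \<dots> ((?a +++ (?b +++ ?c)) +++ (?d +++ ?e))"
    proof (rule homotopic_paths_join)
      show "homotopic_paths Z (p \<circ> linepath a b) (?a +++ (?b +++ ?c))"
        by (rule reads_step.IH) (use reads_step.prems reads_step(3) in auto)
      show "homotopic_paths Z (p \<circ> linepath b c) (?d +++ ?e)"
        by (rule base) (use reads_step e in auto)
    qed (simp add: ends)
    also have "homotopic_paths Z \<dots> (?a +++ ((?b +++ (?c +++ ?d)) +++ ?e))"
      using Zs fin by (intro homotopic_paths_assoc5) auto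
    also have "homotopic_paths Z \<dots> (?a +++ (epath v (w @ transit u u') +++ ?e))"
    proof -
      have 1: "homotopic_paths Z (?c +++ ?d) (epath u (transit u u'))"
        using Q pt_realize realize_seg epath_cube[OF tr Q(1,3) transit_target[OF Q(1,3,4)]] fin
        by (intro homotopic_in_cube[OF _ _ _ _ Q(1)]) (auto simp: path_image_join)
      have "homotopic_paths Z (?b +++ (?c +++ ?d)) (?b +++ epath u (transit u u'))"
        using 1 Zs fin by (intro homotopic_paths_join) auto
      also have "homotopic_paths Z \<dots> (epath v (w @ transit u u'))"
        using epath_append[OF w tr] by (rule homotopic_paths_sym)
      finally show ?thesis using Zs fin by (intro homotopic_paths_join) auto
    qed
    finally show ?case .
  }
qed

end

text \<open>Reading words identifies loop classes with closed words at a vertex \<open>v\<close>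
  whose star contains \<open>x\<close>. Homotopy invariance gives multiplicativity,
  \<open>reads_imp_epath\<close> with \<open>epath_geq\<close> gives injectivity, and the edge path
  of a closed word, joined to \<open>x\<close> by segments, gives surjectivity.\<close>

lemma (in large_coloured_pair) fundamental_group_hyperbolic:
  assumes C: "C \<in> components Z" and x: "x \<in> C"
  shows "hyperbolic_group (fundamental_group C x)"
proof -
  let ?G = "fundamental_group C x"
  have CZ: "C \<subseteq> Z" using C in_components_subset by blast
  then obtain v where v: "v \<in> X" "x \<in> star v" using star_ex x by blast
  have loopZ: "path p \<and> path_image p \<subseteq> Z \<and> p 0 = x \<and> p 1 = x" if "p \<in> loops_at C x" for p
    using that CZ by (auto simp: loops_at_def pathstart_def pathfinish_def)
  \<comment> \<open>A group element is a set of loops, so a word is chosen that some member reads;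
    \<open>reads_homotopic\<close> makes it unique up to \<open>geq\<close>.\<close>
  define \<rho> where "\<rho> c = (SOME w. \<exists>p\<in>c. reads p 0 1 v w v)" for c
  have in_class: "p \<in> loops_at C x \<and> homotopic_paths Z q p" if "q \<in> loops_at C x" "p \<in> hclass C q" for p q
  proof -
    have h: "homotopic_paths C q p" using that by (simp add: hclass_def)
    then have "p \<in> loops_at C x"
      using that(1) homotopic_paths_imp_path[OF h] homotopic_paths_imp_subset[OF h]
        homotopic_paths_imp_pathstart[OF h] homotopic_paths_imp_pathfinish[OF h]
      by (simp add: loops_at_def)
    then show ?thesis using homotopic_paths_subset[OF h CZ] by simp
  qed
  have rho: "\<exists>p. p \<in> loops_at C x \<and> homotopic_paths Z q p \<and> reads p 0 1 v (\<rho> (hclass C q)) v"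
    if q: "q \<in> loops_at C x" for q
  proof -
    obtain w where "reads q 0 1 v w v"
      using reads_ex[of q v v] loopZ[OF q] v by (auto simp: pathstart_def pathfinish_def)
    then have "\<exists>w. \<exists>p\<in>hclass C q. reads p 0 1 v w v" using hclass_self q by blast
    then have "\<exists>p\<in>hclass C q. reads p 0 1 v (\<rho> (hclass C q)) v" unfolding \<rho>_def by (rule someI_ex)
    then show ?thesis using in_class q by blast
  qed
  have rho_reads: "\<rho> (hclass C q) \<sim> w" if q: "q \<in> loops_at C x" and w: "reads q 0 1 v w v" for q w
  proof -
    obtain p where "homotopic_paths Z q p" "reads p 0 1 v (\<rho> (hclass C q)) v" using rho q by blast
    then have "w \<sim> \<rho> (hclass C q)" using reads_homotopic w by blast
    then show ?thesis by (rule geq_sym)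
  qed
  show ?thesis
  proof (rule hyperbolic_group_of_words[where \<rho> = \<rho>, OF group_fundamental_group[OF x] v(1)];
      unfold carrier_fundamental_group)
    fix c assume "c \<in> hclass C ` loops_at C x"
    then show "walk v (\<rho> c) v" using rho reads_walk by blast
  next
    fix c d assume "c \<in> hclass C ` loops_at C x" "d \<in> hclass C ` loops_at C x"
    then obtain q r where qr: "q \<in> loops_at C x" "r \<in> loops_at C x" "c = hclass C q" "d = hclass C r" by blast
    obtain q' where q': "q' \<in> loops_at C x" "homotopic_paths Z q q'" "reads q' 0 1 v (\<rho> c) v" using rho qr by blast
    obtain r' where r': "r' \<in> loops_at C x" "homotopic_paths Z r r'" "reads r' 0 1 v (\<rho> d) v" using rho qr by blast
    have "reads (q' +++ r') 0 1 v (\<rho> c @ \<rho> d) v"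
      using q' r' by (intro reads_join) (auto simp: loops_at_def)
    moreover have qr': "q +++ r \<in> loops_at C x" using qr loops_at_join by blast
    moreover obtain w where w: "reads (q +++ r) 0 1 v w v"
      using reads_ex[of "q +++ r" v v] loopZ[OF qr'] v by (auto simp: pathstart_def pathfinish_def)
    moreover have "homotopic_paths Z (q +++ r) (q' +++ r')"
      using q' r' qr by (intro homotopic_paths_join) (auto simp: loops_at_def)
    ultimately have "w \<sim> \<rho> c @ \<rho> d" using reads_homotopic by blast
    moreover have "\<rho> (c \<otimes>\<^bsub>?G\<^esub> d) \<sim> w"
      using rho_reads[OF qr' w] mult_fundamental_group qr by metis
    ultimately show "\<rho> (c \<otimes>\<^bsub>?G\<^esub> d) \<sim> \<rho> c @ \<rho> d" using geq_trans by blast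
  next
    fix c d assume "c \<in> hclass C ` loops_at C x" "d \<in> hclass C ` loops_at C x" and eq: "\<rho> c \<sim> \<rho> d"
    then obtain q r where qr: "q \<in> loops_at C x" "r \<in> loops_at C x" "c = hclass C q" "d = hclass C r" by blast
    have normal: "homotopic_paths Z q (seg x (pt v) +++ (epath v (\<rho> (hclass C q)) +++ seg (pt v) x))"
      and rw: "walk v (\<rho> (hclass C q)) v"
      if q: "q \<in> loops_at C x" for q
    proof -
      obtain p where p: "p \<in> loops_at C x" "homotopic_paths Z q p" "reads p 0 1 v (\<rho> (hclass C q)) v"
        using rho q by blast
      have "homotopic_paths Z (p \<circ> linepath 0 1) (seg (p 0) (pt v) +++ (epath v (\<rho> (hclass C q)) +++ seg (pt v) (p 1)))"
        using loopZ[OF p(1)] p(3) by (intro reads_imp_epath) auto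
      then have "homotopic_paths Z p (seg x (pt v) +++ (epath v (\<rho> (hclass C q)) +++ seg (pt v) x))"
        using loopZ[OF p(1)] by (simp only: compose_linepath_simps)
      with p(2) show "homotopic_paths Z q (seg x (pt v) +++ (epath v (\<rho> (hclass C q)) +++ seg (pt v) x))"
        by (rule homotopic_paths_trans)
      show "walk v (\<rho> (hclass C q)) v" using reads_walk p(3) by blast
    qed
    have "homotopic_paths Z (seg x (pt v) +++ (epath v (\<rho> c) +++ seg (pt v) x))
        (seg x (pt v) +++ (epath v (\<rho> d) +++ seg (pt v) x))"
      using epath_geq[OF _ _ eq] rw qr seg_Z[OF v(2,1)] pathfinish_epath
      by (intro homotopic_paths_join) auto
    then have "homotopic_paths Z q (seg x (pt v) +++ (epath v (\<rho> d) +++ seg (pt v) x))"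
      using homotopic_paths_trans[OF normal[OF qr(1)]] qr(3) by simp
    then have "homotopic_paths Z q r"
      using homotopic_paths_trans homotopic_paths_sym[OF normal[OF qr(2)]] qr(4) by blast
    then have "homotopic_paths C q r"
      using homotopic_paths_component[OF _ C] qr(1) x by (auto simp: loops_at_def)
    then show "c = d" using qr hclass_eq by blast
  next
    fix w assume w: "walk v w v"
    let ?p = "seg x (pt v) +++ (epath v w +++ seg (pt v) x)"
    have p: "path ?p" "path_image ?p \<subseteq> Z" "pathstart ?p = x" "pathfinish ?p = x"
      using seg_Z[OF v(2,1)] epath_Z[OF w] pathfinish_epath[OF w] by (auto simp: path_image_join)
    then have loop: "?p \<in> loops_at C x"
      using path_image_component[OF p(1,2) C] x by (simp add: loops_at_def)
    have "reads ?p 0 1 v ([] @ (w @ [])) v"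
      using reads_seg_star[OF v(2,1)] reads_epath[OF w] pathfinish_epath[OF w]
      by (intro reads_join) auto
    then show "\<exists>c\<in>hclass C ` loops_at C x. \<rho> c \<sim> w" using rho_reads[OF loop] loop by fastforce
  qed
qed

theorem theoremD:
  fixes n :: nat
    and \<Gamma>A :: "'a coloured_complex"
    and \<Gamma>B :: "'b coloured_complex"
  assumes "coloured_simplicial_complex n \<Gamma>A"
    and "coloured_simplicial_complex n \<Gamma>B"
    and "flag_complex \<Gamma>A"
    and "flag_complex \<Gamma>B"
    and "pairwise_5_large \<Gamma>A \<Gamma>B"
  shows "\<forall>C\<in>components (coupled_link_complex n \<Gamma>A \<Gamma>B). \<forall>x\<in>C.
    hyperbolic_group (fundamental_group C x)"
proof -
  interpret large_coloured_pair n \<Gamma>A \<Gamma>B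
    using assms by unfold_locales
  show ?thesis using fundamental_group_hyperbolic by blast
qed

end
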